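(* Let $\omega_1\neq\omega_2$ be nonzero real numbers with $|\omega_1|\le|\omega_2|$. Consider the holomorphic system $$\dot x=i\omega_1x+f,\quad \dot y=i\omega_2y+g,\quad \dot z=i\omega_2z+h,$$ where $f,g,h$ are holomorphic near $0\in\mathbb{C}^3$ and vanish to order at least $2$. Then: 1) There is a $(y,z)$-invariant holomorphic center manifold at the origin containing an isochronous center family of period $2\pi/|\omega_2|$. 2) If $\omega_2/\omega_1\notin\mathbb{N}$, there is an $x$-invariant holomorphic center manifold at the origin containing an isochronous center family of period $2\pi/|\omega_1|$. 3) Suppose $\omega_2/\omega_1=k\in\mathbb{N}$. Apply $k-2$ reduction steps to the Briot–Bouquet system in the $x$-direction, and let $(\bar p,\bar r)$ be the resulting constant vector. If $\bar p=\bar r=0$, there are infinitely many $x$-invariant holomorphic center manifolds at the origin, each containing an isochronous center family of period $2\pi/|\omega_1|$. If $\bar p\neq0$ or $\bar r\neq0$, there is no $x$-invariant holomorphic center manifold at the origin.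
   Context: A (two-dimensional) Briot–Bouquet system is a system $x\,w'(x)=x\,a+Mw+F(x,w)$ for $w=(u,v)$. Here $a\in\mathbb{C}^2$ is called its constant vector, $M$ is a complex $2\times2$ matrix called its linear matrix, and $F$ is holomorphic near $0\in\mathbb{C}^3$ with $F(0)=0$ and $DF(0)=0$. Reduction step: take such a system and a vector $c\in\mathbb{C}^2$ with $(I-M)c=a$. The substitution $w=x(\tilde w+c)$ transforms the system into the Briot–Bouquet system $x\tilde w'=x\tilde a+(M-I)\tilde w+\tilde F(x,\tilde w)$. Here $\tilde a=F_2(1,c)$, where $F_2$ is the homogeneous quadratic part of $F$, and $\tilde F(x,\tilde w)=x^{-1}F(x,x(\tilde w+c))-x\tilde a$. If $1$ is not an eigenvalue of $M$, then $c=(I-M)^{-1}a$ is unique and this is called the reduction step. "Applying $k$ reduction steps" means iterating it $k$ times; zero steps leaves the system unchanged. For a system $\dot x=P$, $\dot y=Q$, $\dot z=R$, the Briot–Bouquet system in the $x$-direction is $x u'=\frac{Q(x,xu,xv)}{P(x,xu,xv)}-u$, $x v'=\frac{R(x,xu,xv)}{P(x,xu,xv)}-v$, with $u=y/x$, $v=z/x$. Its right-hand side is holomorphic near the origin and vanishes there. An $x$-invariant holomorphic center manifold at the origin is a germ at $0$ of a one-dimensional complex submanifold of $\mathbb{C}^3$ through $0$ that is invariant under the system and tangent at $0$ to the $x$-axis. A $(y,z)$-invariant one is such a germ of a two-dimensional complex invariant submanifold tangent at $0$ to the $(y,z)$-plane. Such a manifold $S$ contains an isochronous center family of period $T$ if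 every real-time trajectory of the system starting at a point of $S\setminus\{0\}$ sufficiently close to $0$ is periodic of period $T$. $\mathbb{N}=\{1,2,3,\dots\}$. *)

theory Defs
  imports "HOL-Analysis.Analysis"
begin

type_synonym c3 = "complex \<times> complex \<times> complex"

definition holo3 :: "(c3 \<Rightarrow> complex) \<Rightarrow> c3 set \<Rightarrow> bool" where
  "holo3 F U \<longleftrightarrow> open U \<and> (\<forall>p\<in>U. \<exists>D. (F has_derivative D) (at p) \<and>
      (\<forall>c a b d. D (c * a, c * b, c * d) = c * D (a, b, d)))"

definition holo2 :: "(complex \<times> complex \<Rightarrow> complex) \<Rightarrow> (complex \<times> complex) set \<Rightarrow> bool" where
  "holo2 F U \<longleftrightarrow> open U \<and> (\<forall>p\<in>U. \<exists>D. (F has_derivative D) (at p) \<and>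
      (\<forall>c a b. D (c * a, c * b) = c * D (a, b)))"

definition hol_order2 :: "(c3 \<Rightarrow> complex) \<Rightarrow> bool" where
  "hol_order2 F \<longleftrightarrow> (\<exists>r>0. holo3 F (ball 0 r)) \<and> F 0 = 0 \<and> (F has_derivative (\<lambda>_. 0)) (at 0)"

definition sys :: "real \<Rightarrow> real \<Rightarrow> (c3 \<Rightarrow> complex) \<Rightarrow> (c3 \<Rightarrow> complex) \<Rightarrow> (c3 \<Rightarrow> complex) \<Rightarrow> c3 \<Rightarrow> c3" where
  "sys w1 w2 f g h = (\<lambda>(x, y, z). (\<i> * of_real w1 * x + f (x, y, z),
                                     \<i> * of_real w2 * y + g (x, y, z),
                                     \<i> * of_real w2 * z + h (x, y, z)))"

definition periodic_traj :: "(c3 \<Rightarrow> c3) \<Rightarrow> c3 \<Rightarrow> real \<Rightarrow> bool" where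
  "periodic_traj X p T \<longleftrightarrow>
     (\<exists>\<gamma>. \<gamma> 0 = p \<and> (\<forall>t. (\<gamma> has_vector_derivative X (\<gamma> t)) (at t))) \<and>
     (\<forall>\<gamma>. \<gamma> 0 = p \<and> (\<forall>t. (\<gamma> has_vector_derivative X (\<gamma> t)) (at t)) \<longrightarrow>
        (\<forall>t. \<gamma> (t + T) = \<gamma> t) \<and> (\<forall>s. 0 < s \<and> s < T \<longrightarrow> \<gamma> s \<noteq> p))"

text \<open>x-invariant holomorphic center manifold germ, given as the graph
  y = phi x, z = psi x (tangent to the x-axis at 0), invariant (vector field tangent to it).\<close>
definition x_center_manifold :: "(c3 \<Rightarrow> c3) \<Rightarrow> (complex \<Rightarrow> complex) \<Rightarrow> (complex \<Rightarrow> complex) \<Rightarrow> bool" where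
  "x_center_manifold X \<phi> \<psi> \<longleftrightarrow> (\<exists>r>0. \<phi> holomorphic_on ball 0 r \<and> \<psi> holomorphic_on ball 0 r \<and>
     \<phi> 0 = 0 \<and> \<psi> 0 = 0 \<and> deriv \<phi> 0 = 0 \<and> deriv \<psi> 0 = 0 \<and>
     (\<forall>x\<in>ball 0 r.
        deriv \<phi> x * fst (X (x, \<phi> x, \<psi> x)) = fst (snd (X (x, \<phi> x, \<psi> x))) \<and>
        deriv \<psi> x * fst (X (x, \<phi> x, \<psi> x)) = snd (snd (X (x, \<phi> x, \<psi> x)))))"

definition x_isochronous :: "(c3 \<Rightarrow> c3) \<Rightarrow> (complex \<Rightarrow> complex) \<Rightarrow> (complex \<Rightarrow> complex) \<Rightarrow> real \<Rightarrow> bool" where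
  "x_isochronous X \<phi> \<psi> T \<longleftrightarrow>
     (\<exists>\<epsilon>>0. \<forall>x. 0 < cmod x \<and> cmod x < \<epsilon> \<longrightarrow> periodic_traj X (x, \<phi> x, \<psi> x) T)"

definition same_germ :: "(complex \<Rightarrow> complex) \<times> (complex \<Rightarrow> complex) \<Rightarrow> (complex \<Rightarrow> complex) \<times> (complex \<Rightarrow> complex) \<Rightarrow> bool" where
  "same_germ A B \<longleftrightarrow> eventually (\<lambda>x. fst A x = fst B x \<and> snd A x = snd B x) (nhds 0)"

text \<open>(y,z)-invariant holomorphic center manifold germ, graph x = chi(y,z), tangent to the
  (y,z)-plane at 0, invariant (vector field tangent to it).\<close>
definition yz_center_manifold :: "(c3 \<Rightarrow> c3) \<Rightarrow> (complex \<times> complex \<Rightarrow> complex) \<Rightarrow> bool" where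
  "yz_center_manifold X C \<longleftrightarrow> (\<exists>r>0. holo2 C (ball 0 r) \<and> C 0 = 0 \<and>
     (C has_derivative (\<lambda>_. 0)) (at 0) \<and>
     (\<forall>q\<in>ball 0 r. \<exists>D. (C has_derivative D) (at q) \<and>
        D (fst (snd (X (C q, q))), snd (snd (X (C q, q)))) = fst (X (C q, q))))"

definition yz_isochronous :: "(c3 \<Rightarrow> c3) \<Rightarrow> (complex \<times> complex \<Rightarrow> complex) \<Rightarrow> real \<Rightarrow> bool" where
  "yz_isochronous X C T \<longleftrightarrow>
     (\<exists>\<epsilon>>0. \<forall>q. 0 < norm q \<and> norm q < \<epsilon> \<longrightarrow> periodic_traj X (C q, q) T)"

text \<open>Briot--Bouquet systems  x w' = G(x,w)  are represented by their right-hand side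
  G (holomorphic near 0, G(0)=0). Writing G(x,w) = x a + M w + F(x,w), the constant vector
  is a = dG(0)(1,0) and the linear matrix is M w = dG(0)(0,w).\<close>

definition bb_const :: "(c3 \<Rightarrow> complex \<times> complex) \<Rightarrow> complex \<times> complex" where
  "bb_const G = frechet_derivative G (at 0) (1, 0, 0)"

definition bb_lin :: "(c3 \<Rightarrow> complex \<times> complex) \<Rightarrow> complex \<times> complex \<Rightarrow> complex \<times> complex" where
  "bb_lin G w = frechet_derivative G (at 0) (0, w)"

text \<open>Briot--Bouquet system in the x-direction (holomorphically extended to x = 0).\<close>
definition bb_x_expr :: "(c3 \<Rightarrow> c3) \<Rightarrow> complex \<Rightarrow> complex \<Rightarrow> complex \<Rightarrow> complex \<times> complex" where
  "bb_x_expr X t u v =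
     (fst (snd (X (t, t * u, t * v))) / fst (X (t, t * u, t * v)) - u,
      snd (snd (X (t, t * u, t * v))) / fst (X (t, t * u, t * v)) - v)"

definition bb_x :: "(c3 \<Rightarrow> c3) \<Rightarrow> c3 \<Rightarrow> complex \<times> complex" where
  "bb_x X = (\<lambda>(x, u, v). if x \<noteq> 0 then bb_x_expr X x u v else Lim (at 0) (\<lambda>t. bb_x_expr X t u v))"

text \<open>Reduction step: c with (I - M) c = a (unique since 1 is not an eigenvalue of M);
  substituting w = x (w~ + c) gives  x w~' = x^{-1} G(x, x(w~+c)) - w~ - c, which equals
  x a~ + (M - I) w~ + F~(x, w~) as in the paper; extended holomorphically to x = 0.\<close>
definition red_expr :: "(c3 \<Rightarrow> complex \<times> complex) \<Rightarrow> complex \<times> complex \<Rightarrow> complex \<Rightarrow> complex \<Rightarrow> complex \<Rightarrow> complex \<times> complex" where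
  "red_expr G c t u v =
     (fst (G (t, t * (u + fst c), t * (v + snd c))) / t - u - fst c,
      snd (G (t, t * (u + fst c), t * (v + snd c))) / t - v - snd c)"

definition reduction_step :: "(c3 \<Rightarrow> complex \<times> complex) \<Rightarrow> c3 \<Rightarrow> complex \<times> complex" where
  "reduction_step G =
     (let c = (THE c. c - bb_lin G c = bb_const G)
      in (\<lambda>(x, u, v). if x \<noteq> 0 then red_expr G c x u v else Lim (at 0) (\<lambda>t. red_expr G c t u v)))"

end

theory Submission
  imports Defs "HOL-Complex_Analysis.Complex_Analysis"
begin

text \<open>
  All parts rest on one fact about singular equations \<open>s \<Omega>' = -b \<Omega> + s K(s, \<Omega>, e)\<close> with \<open>b \<ge> 0\<close> and
  holomorphic \<open>K\<close>: the Picard map \<open>\<Omega> \<mapsto> s \<integral>\<^sub>0\<^sup>1 t\<^sup>b K(ts, \<Omega>(ts, e), e) dt\<close> is a contraction near \<open>0\<close>, so there is a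
  solution with \<open>\<Omega>(0, e) = 0\<close>, holomorphic also in the parameter \<open>e\<close>.

  For the \<open>(y,z)\<close>-manifold one looks for curves \<open>W(s) = s((0, e) + \<Omega>(s, e))\<close> with \<open>i w\<^sub>2 s W' = X(W)\<close>. Here
  \<open>b\<close> is \<open>1 - w\<^sub>1/w\<^sub>2 \<ge> 0\<close> or \<open>0\<close>, and by homogeneity \<open>W\<close> depends on \<open>q = s e\<close> only. The resulting map
  \<open>\<Phi>(q)\<close> conjugates the linear flow \<open>exp (i w\<^sub>2 t) q\<close> to the given one, which yields invariance and the
  common period at once.

  In the \<open>x\<close>-direction the Briot--Bouquet system has the form \<open>x w' = b w + x H(x, w)\<close> with
  \<open>b = w\<^sub>2/w\<^sub>1 - 1\<close>. A reduction step preserves this form and lowers \<open>b\<close> by one, and its solutions correspond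
  to those of the original system. Without resonance one arrives at \<open>b \<le> 0\<close>. With \<open>w\<^sub>2/w\<^sub>1 = k\<close> one arrives at
  \<open>b = 1\<close> after \<open>k - 2\<close> steps, where comparing first-order terms forces the constant vector to vanish;
  if it does, \<open>w'(0)\<close> is arbitrary. On the resulting curves the flow is one-dimensional and is linearised
  explicitly.
\<close>

section \<open>Holomorphic maps between complex normed spaces\<close>

text \<open>Signs shape the argument. The weight t^b is bounded on the unit interval only for b >=
  0. For the (y,z)-curves the bound on |w1| secures this. In the x-direction the exponent has the
  wrong sign as soon as w2/w1 > 1, and the reduction steps repair it one unit at a time. Such a step
  needs a c with (1 - b) c = H(0), where H(0) is the constant vector. This is solvable for every
  H(0) unless b = 1; there H(0) is an obstruction if nonzero and leaves c free if zero.

  A second difficulty is that periodicity is demanded of every solution through a point, although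
  the field is controlled only near the origin. Uniqueness is therefore proved with only one of the
  two solutions known to stay near 0.

  Holomorphy in several variables is reduced to one variable by restriction to complex lines. This
  is why the spaces carry a complex scaling that is compatible with the norm: a disc on such a line
  then lies in a ball of known radius.\<close>

class complex_normed = real_normed_vector +
  fixes cscale :: "complex \<Rightarrow> 'a \<Rightarrow> 'a" (infixr \<open>*\<^sub>C\<close> 75)
  assumes cscale_add_right: "c *\<^sub>C (x + y) = c *\<^sub>C x + c *\<^sub>C y"
    and cscale_add_left: "(c + d) *\<^sub>C x = c *\<^sub>C x + d *\<^sub>C x"
    and cscale_cscale: "c *\<^sub>C d *\<^sub>C x = (c * d) *\<^sub>C x"
    and cscale_of_real: "of_real r *\<^sub>C x = r *\<^sub>R x"
    and norm_cscale: "norm (c *\<^sub>C x) = cmod c * norm x"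

instantiation complex :: complex_normed
begin
definition cscale_complex_def: "c *\<^sub>C (x::complex) = c * x"
instance
  by standard (auto simp: cscale_complex_def algebra_simps norm_mult scaleR_conv_of_real)
end

instantiation prod :: (complex_normed, complex_normed) complex_normed
begin
definition cscale_prod_def: "c *\<^sub>C p = (c *\<^sub>C fst p, c *\<^sub>C snd p)"
instance
proof
  fix c :: complex and x :: "'a \<times> 'b"
  have "sqrt ((cmod c * norm (fst x))\<^sup>2 + (cmod c * norm (snd x))\<^sup>2)
      = sqrt ((cmod c)\<^sup>2 * ((norm (fst x))\<^sup>2 + (norm (snd x))\<^sup>2))"
    by (simp add: algebra_simps)
  then show "norm (c *\<^sub>C x) = cmod c * norm x"
    by (simp add: cscale_prod_def norm_prod_def norm_cscale real_sqrt_mult)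
qed (auto simp: cscale_prod_def cscale_add_right cscale_add_left cscale_cscale cscale_of_real
       prod_eq_iff)
end

lemma cscale_Pair [simp]: "c *\<^sub>C (x, y) = (c *\<^sub>C x, c *\<^sub>C y)"
  by (simp add: cscale_prod_def)

lemma fst_cscale [simp]: "fst (c *\<^sub>C p) = c *\<^sub>C fst p"
  and snd_cscale [simp]: "snd (c *\<^sub>C p) = c *\<^sub>C snd p"
  by (simp_all add: cscale_prod_def)

lemma cscale_complex [simp]: "c *\<^sub>C (x::complex) = c * x"
  by (simp add: cscale_complex_def)

lemma cscale_one [simp]: "1 *\<^sub>C x = x"
  using cscale_of_real[of 1 x] by simp

lemma cscale_zero_left [simp]: "0 *\<^sub>C x = 0"
  using cscale_of_real[of 0 x] by simp

lemma cscale_zero_right [simp]: "c *\<^sub>C 0 = (0::'a::complex_normed)"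
  by (metis mult_zero_right norm_cscale norm_eq_zero norm_zero)

lemma cscale_scaleR: "c *\<^sub>C (r *\<^sub>R x) = r *\<^sub>R (c *\<^sub>C x)"
  by (metis cscale_cscale cscale_of_real mult.commute)

lemma bounded_bilinear_cscale: "bounded_bilinear (cscale :: complex \<Rightarrow> 'a \<Rightarrow> 'a::complex_normed)"
proof
  fix r c and x :: 'a
  show "(r *\<^sub>R c) *\<^sub>C x = r *\<^sub>R c *\<^sub>C x"
    by (simp add: scaleR_conv_of_real cscale_cscale[symmetric] cscale_of_real)
  show "\<exists>K. \<forall>(a::complex) b::'a. norm (a *\<^sub>C b) \<le> norm a * norm b * K"
    by (rule exI[of _ 1]) (simp add: norm_cscale)
qed (simp_all add: cscale_add_right cscale_add_left cscale_scaleR)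

lemmas continuous_on_cscale [continuous_intros] =
  bounded_bilinear.continuous_on[OF bounded_bilinear_cscale]
lemmas tendsto_cscale [tendsto_intros] = bounded_bilinear.tendsto[OF bounded_bilinear_cscale]
lemmas has_derivative_cscale = bounded_bilinear.FDERIV[OF bounded_bilinear_cscale]

text \<open>The coordinate-free form of \<open>holo2\<close> and \<open>holo3\<close>, so that one
  calculus serves all products of copies of the complex plane. Additivity of \<open>D\<close> is
  part of \<open>has_derivative\<close>, hence commuting with \<open>cscale\<close> makes it
  complex-linear.\<close>

definition chol :: "('a::complex_normed \<Rightarrow> 'b::complex_normed) \<Rightarrow> 'a set \<Rightarrow> bool" where
  "chol F U \<longleftrightarrow> open U \<and>
     (\<forall>p\<in>U. \<exists>D. (F has_derivative D) (at p) \<and> (\<forall>c v. D (c *\<^sub>C v) = c *\<^sub>C D v))"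

section \<open>Calculus of complex-differentiable maps\<close>

lemma cholE:
  assumes "chol F U" "p \<in> U"
  obtains D where "(F has_derivative D) (at p)" "\<And>c v. D (c *\<^sub>C v) = c *\<^sub>C D v"
  using assms unfolding chol_def by blast

lemma cholI:
  assumes "open U"
    and "\<And>p. p \<in> U \<Longrightarrow> \<exists>D. (F has_derivative D) (at p) \<and> (\<forall>c v. D (c *\<^sub>C v) = c *\<^sub>C D v)"
  shows "chol F U"
  using assms unfolding chol_def by blast

lemma chol_open: "chol F U \<Longrightarrow> open U"
  by (simp add: chol_def)

lemma chol_subset: "chol F U \<Longrightarrow> V \<subseteq> U \<Longrightarrow> open V \<Longrightarrow> chol F V"
  unfolding chol_def by blast

lemma chol_imp_continuous_on: "chol F U \<Longrightarrow> continuous_on U F"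
  by (metis cholE continuous_at_imp_continuous_on has_derivative_continuous)

lemma chol_cong:
  assumes "chol F U" "\<And>p. p \<in> U \<Longrightarrow> F p = G p"
  shows "chol G U"
proof (rule cholI)
  show "open U" using assms chol_open by blast
  fix p assume "p \<in> U"
  with assms(1) obtain D where "(F has_derivative D) (at p)" "\<forall>c v. D (c *\<^sub>C v) = c *\<^sub>C D v"
    by (metis cholE)
  with assms \<open>p \<in> U\<close> show "\<exists>D. (G has_derivative D) (at p) \<and> (\<forall>c v. D (c *\<^sub>C v) = c *\<^sub>C D v)"
    by (meson chol_open has_derivative_transform_within_open)
qed

lemma chol_compose:
  assumes "chol G V" "chol F U" "F ` U \<subseteq> V"
  shows "chol (\<lambda>p. G (F p)) U"
proof (rule cholI)
  show "open U" using assms chol_open by blast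
  fix p assume p: "p \<in> U"
  obtain D where D: "(F has_derivative D) (at p)" "\<And>c v. D (c *\<^sub>C v) = c *\<^sub>C D v"
    using assms(2) p by (metis cholE)
  obtain E where E: "(G has_derivative E) (at (F p))" "\<And>c v. E (c *\<^sub>C v) = c *\<^sub>C E v"
    using assms(1,3) p by (metis cholE image_subset_iff)
  have "((\<lambda>p. G (F p)) has_derivative (\<lambda>v. E (D v))) (at p)"
    using diff_chain_at[OF D(1) E(1)] by (simp add: o_def)
  then show "\<exists>D. ((\<lambda>p. G (F p)) has_derivative D) (at p) \<and> (\<forall>c v. D (c *\<^sub>C v) = c *\<^sub>C D v)"
    using D(2) E(2) by (intro exI[of _ "\<lambda>v. E (D v)"]) simp
qed

lemma chol_const: "open U \<Longrightarrow> chol (\<lambda>p. k) U"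
  by (auto intro!: cholI exI[of _ "\<lambda>_. 0"] derivative_eq_intros)

lemma chol_linear:
  assumes "bounded_linear L" "\<And>c v. L (c *\<^sub>C v) = c *\<^sub>C L v" "open U"
  shows "chol L U"
  using assms by (auto intro!: cholI exI[of _ L] bounded_linear_imp_has_derivative)

lemma chol_id: "open U \<Longrightarrow> chol (\<lambda>p. p) U"
  by (rule chol_linear) (auto intro: bounded_linear_ident)

lemma chol_fst: "open U \<Longrightarrow> chol fst U"
  and chol_snd: "open U \<Longrightarrow> chol snd U"
  by (auto intro!: chol_linear bounded_linear_fst bounded_linear_snd)

lemma chol_Pair:
  assumes "chol F U" "chol G U"
  shows "chol (\<lambda>p. (F p, G p)) U"
proof (rule cholI)
  show "open U" using assms chol_open by blast
  fix p assume p: "p \<in> U"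
  obtain D where D: "(F has_derivative D) (at p)" "\<And>c v. D (c *\<^sub>C v) = c *\<^sub>C D v"
    using assms(1) p by (metis cholE)
  obtain E where E: "(G has_derivative E) (at p)" "\<And>c v. E (c *\<^sub>C v) = c *\<^sub>C E v"
    using assms(2) p by (metis cholE)
  show "\<exists>D. ((\<lambda>p. (F p, G p)) has_derivative D) (at p) \<and> (\<forall>c v. D (c *\<^sub>C v) = c *\<^sub>C D v)"
    using has_derivative_Pair[OF D(1) E(1)] D(2) E(2) by (intro exI[of _ "\<lambda>v. (D v, E v)"]) simp
qed

lemma chol_fst_compose: "chol F U \<Longrightarrow> chol (\<lambda>p. fst (F p)) U"
  by (rule chol_compose[of fst UNIV]) (auto intro: chol_fst)

lemma chol_snd_compose: "chol F U \<Longrightarrow> chol (\<lambda>p. snd (F p)) U"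
  by (rule chol_compose[of snd UNIV]) (auto intro: chol_snd)

lemma chol_add:
  assumes "chol F U" "chol G U"
  shows "chol (\<lambda>p. F p + G p) U"
proof (rule cholI)
  show "open U" using assms chol_open by blast
  fix p assume p: "p \<in> U"
  obtain D where D: "(F has_derivative D) (at p)" "\<And>c v. D (c *\<^sub>C v) = c *\<^sub>C D v"
    using assms(1) p by (metis cholE)
  obtain E where E: "(G has_derivative E) (at p)" "\<And>c v. E (c *\<^sub>C v) = c *\<^sub>C E v"
    using assms(2) p by (metis cholE)
  show "\<exists>D. ((\<lambda>p. F p + G p) has_derivative D) (at p) \<and> (\<forall>c v. D (c *\<^sub>C v) = c *\<^sub>C D v)"
    using has_derivative_add[OF D(1) E(1)] D(2) E(2)
    by (intro exI[of _ "\<lambda>v. D v + E v"]) (simp add: cscale_add_right)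
qed

lemma chol_cscale:
  assumes "chol F U" "chol G U"
  shows "chol (\<lambda>p. F p *\<^sub>C G p) U"
proof (rule cholI)
  show "open U" using assms chol_open by blast
  fix p assume p: "p \<in> U"
  obtain D where D: "(F has_derivative D) (at p)" "\<And>c v. D (c *\<^sub>C v) = c *\<^sub>C D v"
    using assms(1) p by (metis cholE)
  obtain E where E: "(G has_derivative E) (at p)" "\<And>c v. E (c *\<^sub>C v) = c *\<^sub>C E v"
    using assms(2) p by (metis cholE)
  show "\<exists>D. ((\<lambda>p. F p *\<^sub>C G p) has_derivative D) (at p) \<and> (\<forall>c v. D (c *\<^sub>C v) = c *\<^sub>C D v)"
    using has_derivative_cscale[OF D(1) E(1)] D(2) E(2)
    by (intro exI[of _ "\<lambda>v. F p *\<^sub>C E v + D v *\<^sub>C G p"])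
       (simp add: cscale_add_right cscale_cscale mult.commute)
qed

lemma chol_mult:
  fixes F G :: "'a::complex_normed \<Rightarrow> complex"
  shows "chol F U \<Longrightarrow> chol G U \<Longrightarrow> chol (\<lambda>p. F p * G p) U"
  using chol_cscale[of F U G] by simp

lemma chol_diff:
  assumes "chol F U" "chol G U"
  shows "chol (\<lambda>p. F p - G p) U"
proof -
  have "chol (\<lambda>p. F p + (- 1) *\<^sub>C G p) U"
    by (intro chol_add chol_cscale chol_const assms chol_open[OF assms(1)])
  moreover have "F p + (- 1) *\<^sub>C G p = F p - G p" for p
    using cscale_of_real[of "-1" "G p"] by simp
  ultimately show ?thesis by (simp add: chol_cong)
qed

lemma chol_iff_holomorphic:
  fixes f :: "complex \<Rightarrow> complex"
  assumes "open U"
  shows "chol f U \<longleftrightarrow> f holomorphic_on U"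
proof
  assume f: "chol f U"
  show "f holomorphic_on U"
  proof (rule holomorphic_onI)
    fix x assume "x \<in> U"
    with f obtain D where D: "(f has_derivative D) (at x)" "\<And>c v. D (c *\<^sub>C v) = c *\<^sub>C D v"
      by (metis cholE)
    have "D = (*) (D 1)"
    proof (rule ext)
      show "D v = D 1 * v" for v using D(2)[of v 1] by (simp add: mult.commute)
    qed
    with D(1) have "(f has_field_derivative D 1) (at x)"
      by (simp add: has_field_derivative_def)
    then show "f field_differentiable at x within U"
      using field_differentiable_at_within field_differentiable_def by blast
  qed
next
  assume f: "f holomorphic_on U"
  show "chol f U"
  proof (rule cholI[OF assms])
    fix p assume "p \<in> U"
    then have "(f has_field_derivative deriv f p) (at p)"
      using f assms holomorphic_derivI by blast
    then show "\<exists>D. (f has_derivative D) (at p) \<and> (\<forall>c v. D (c *\<^sub>C v) = c *\<^sub>C D v)"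
      by (intro exI[of _ "(*) (deriv f p)"]) (simp add: has_field_derivative_def)
  qed
qed

lemma chol_inverse:
  fixes F :: "'a::complex_normed \<Rightarrow> complex"
  assumes "chol F U" "\<And>p. p \<in> U \<Longrightarrow> F p \<noteq> 0"
  shows "chol (\<lambda>p. inverse (F p)) U"
proof (rule chol_compose[OF _ assms(1), of inverse "- {0}"])
  have "(inverse :: complex \<Rightarrow> complex) holomorphic_on - {0}"
    by (auto intro!: holomorphic_intros)
  then show "chol (inverse :: complex \<Rightarrow> complex) (- {0})"
    by (subst chol_iff_holomorphic) auto
qed (use assms in auto)

lemma chol_divide:
  fixes F G :: "'a::complex_normed \<Rightarrow> complex"
  assumes "chol F U" "chol G U" "\<And>p. p \<in> U \<Longrightarrow> G p \<noteq> 0"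
  shows "chol (\<lambda>p. F p / G p) U"
  using chol_mult[OF assms(1) chol_inverse[OF assms(2,3)]] by (simp add: divide_inverse)

section \<open>Cauchy estimates along complex lines\<close>

lemma chol_line:
  fixes F :: "'a::complex_normed \<Rightarrow> complex"
  assumes "(F has_derivative D) (at (p + t *\<^sub>C d))" "\<And>c v. D (c *\<^sub>C v) = c *\<^sub>C D v"
  shows "((\<lambda>t. F (p + t *\<^sub>C d)) has_field_derivative D d) (at t)"
proof -
  have "((\<lambda>t. p + t *\<^sub>C d) has_derivative (\<lambda>h. h *\<^sub>C d)) (at t)"
    by (rule has_derivative_eq_rhs, rule has_derivative_add[OF has_derivative_const
         has_derivative_cscale[OF has_derivative_ident has_derivative_const]]) auto
  from diff_chain_at[OF this assms(1)] show ?thesis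
    using assms(2) by (simp add: has_field_derivative_def o_def mult.commute[of _ "D d"])
qed

text \<open>Cauchy's inequality on discs of radius \<open>R/2\<close> about points of the closed
  unit disc; these stay inside the domain because \<open>1 + R/2 < R\<close>. In the application
  \<open>R\<close> is \<open>r / norm d\<close>, so the two bounds become quadratic and linear in
  \<open>norm d\<close>.\<close>

lemma Taylor_remainder_bound_1:
  assumes g: "g holomorphic_on ball 0 R" and M: "\<And>z. z \<in> ball 0 R \<Longrightarrow> cmod (g z) \<le> M"
    and R: "R \<ge> 4"
  shows "cmod (g 1 - g 0 - deriv g 0) \<le> 8 * M / R\<^sup>2"
    and "cmod (deriv g 0) \<le> 2 * M / R"
proof -
  have bd: "cmod ((deriv ^^ n) g z) \<le> fact n * M / (R/2) ^ n" if "z \<in> cball 0 1" for z n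
  proof (rule Cauchy_inequality)
    have sub: "cball z (R/2) \<subseteq> ball 0 R"
    proof
      fix w assume "w \<in> cball z (R/2)"
      with that have "norm w \<le> 1 + R/2"
        using norm_triangle_sub[of w z] by (auto simp: dist_norm norm_minus_commute)
      with R show "w \<in> ball 0 R" by simp
    qed
    then show "g holomorphic_on ball z (R/2)" "continuous_on (cball z (R/2)) g"
      by (meson g ball_subset_cball holomorphic_on_subset holomorphic_on_imp_continuous_on order_trans)+
    show "0 < R/2" using R by simp
    show "cmod (g x) \<le> M" if "cmod (z - x) = R / 2" for x
      using that sub M by (auto simp: dist_norm subset_eq)
  qed
  have "cmod ((deriv ^^ 0) g 1 - (\<Sum>i\<le>1. (deriv ^^ i) g 0 * (1 - 0) ^ i / fact i))
      \<le> (8 * M / R\<^sup>2) * cmod (1 - 0) ^ Suc 1 / fact 1"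
  proof (rule complex_Taylor[of "cball 0 1"])
    fix i :: nat and x :: complex assume x: "x \<in> cball 0 1"
    have "(deriv ^^ i) g holomorphic_on ball 0 R"
      by (intro holomorphic_higher_deriv g) auto
    then have "((deriv ^^ i) g has_field_derivative (deriv ^^ Suc i) g x) (at x)"
      using x R by (auto intro!: holomorphic_derivI[where S = "ball 0 R"])
    then show "((deriv ^^ i) g has_field_derivative (deriv ^^ Suc i) g x) (at x within cball 0 1)"
      by (rule has_field_derivative_at_within)
  next
    fix x :: complex assume x: "x \<in> cball 0 1"
    show "cmod ((deriv ^^ Suc 1) g x) \<le> 8 * M / R\<^sup>2"
      using bd[OF x, of 2] by (simp add: power2_eq_square numeral_2_eq_2)
  qed auto
  then show "cmod (g 1 - g 0 - deriv g 0) \<le> 8 * M / R\<^sup>2"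
    by (simp add: algebra_simps)
  show "cmod (deriv g 0) \<le> 2 * M / R"
    using bd[of 0 1] by (simp add: mult.commute)
qed

text \<open>On the line through \<open>p\<close> in direction \<open>d\<close> the map is a
  one-variable function on the disc of radius \<open>r / norm d\<close>. The condition
  \<open>norm d \<le> r/4\<close> makes this radius at least 4, and \<open>t = 1\<close> corresponds
  to the point \<open>p + d\<close>.\<close>

lemma chol_bounds:
  fixes F :: "'a::complex_normed \<Rightarrow> complex"
  assumes F: "chol F (ball p r)" and M: "\<And>x. x \<in> ball p r \<Longrightarrow> cmod (F x) \<le> M"
    and r: "r > 0"
    and D: "(F has_derivative D) (at p)" "\<And>c v. D (c *\<^sub>C v) = c *\<^sub>C D v"
  shows chol_derivative_bound: "cmod (D d) \<le> 2 * M / r * norm d"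
    and chol_Taylor_bound: "norm d \<le> r/4 \<Longrightarrow> cmod (F (p + d) - F p - D d) \<le> 8 * M / r\<^sup>2 * (norm d)\<^sup>2"
proof -
  have lin: "linear D"
    using D(1) has_derivative_linear by blast
  have main: "cmod (F (p + d) - F p - D d) \<le> 8 * M / r\<^sup>2 * (norm d)\<^sup>2 \<and> cmod (D d) \<le> 2 * M / r * norm d"
    if d: "norm d \<le> r/4" for d
  proof (cases "d = 0")
    case True
    then show ?thesis using linear_0[OF lin] by simp
  next
    case False
    define g where "g = (\<lambda>t. F (p + t *\<^sub>C d))"
    define R where "R = r / norm d"
    have R: "R \<ge> 4" using d False r by (simp add: R_def field_simps)
    have inb: "p + t *\<^sub>C d \<in> ball p r" if "t \<in> ball 0 R" for t
      using that False by (simp add: R_def dist_norm norm_cscale field_simps)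
    have g: "g holomorphic_on ball 0 R"
    proof (rule holomorphic_onI)
      fix t :: complex assume "t \<in> ball 0 R"
      with inb obtain E where "(F has_derivative E) (at (p + t *\<^sub>C d))" "\<And>c v. E (c *\<^sub>C v) = c *\<^sub>C E v"
        using F by (metis cholE)
      from chol_line[OF this] show "g field_differentiable at t within ball 0 R"
        unfolding g_def field_differentiable_def using has_field_derivative_at_within by blast
    qed
    have "(g has_field_derivative D d) (at 0)"
      unfolding g_def using D by (intro chol_line) auto
    then have dg: "deriv g 0 = D d" by (rule DERIV_imp_deriv)
    have "cmod (g z) \<le> M" if "z \<in> ball 0 R" for z
      unfolding g_def using inb[OF that] M by simp
    from Taylor_remainder_bound_1[OF g this R] dg False show ?thesis
      by (auto simp: g_def R_def power_divide)
  qed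
  show "norm d \<le> r/4 \<Longrightarrow> cmod (F (p + d) - F p - D d) \<le> 8 * M / r\<^sup>2 * (norm d)\<^sup>2"
    using main by blast
  show "cmod (D d) \<le> 2 * M / r * norm d"
  proof (cases "d = 0")
    case True
    then show ?thesis using linear_0[OF lin] by simp
  next
    case False
    \<comment> \<open>The line argument covers short vectors only. The derivative bound is
      homogeneous in \<open>d\<close>, so it may be read off from a rescaled vector.\<close>
    define s where "s = r / (4 * norm d)"
    have s: "s > 0" using r False by (simp add: s_def)
    have "norm (s *\<^sub>R d) \<le> r/4" using False r by (simp add: s_def)
    from conjunct2[OF main[OF this]] have "s * cmod (D d) \<le> s * (2 * M / r * norm d)"
      using s by (simp add: linear_cmul[OF lin] mult.assoc mult.left_commute)
    then show ?thesis using s by (simp only: mult_le_cancel_left_pos)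
  qed
qed

section \<open>Uniform limits and parameter integrals of holomorphic maps\<close>

lemma has_derivative_quadratic_remainder:
  assumes "bounded_linear D" "e > 0"
    and "\<And>d. norm d \<le> e \<Longrightarrow> norm (F (p + d) - F p - D d) \<le> C * (norm d)\<^sup>2"
  shows "(F has_derivative D) (at p)"
  unfolding has_derivative_iff_norm
proof (intro conjI assms(1))
  have lim: "((\<lambda>y. C * norm (y - p)) \<longlongrightarrow> 0) (at p)"
    by (auto intro!: tendsto_eq_intros)
  show "((\<lambda>y. norm (F y - F p - D (y - p)) / norm (y - p)) \<longlongrightarrow> 0) (at p)"
  proof (rule Lim_null_comparison[OF _ lim])
    show "\<forall>\<^sub>F y in at p. norm (norm (F y - F p - D (y - p)) / norm (y - p)) \<le> C * norm (y - p)"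
      unfolding eventually_at
    proof (intro exI[of _ e] conjI ballI impI assms(2))
      fix y assume y: "y \<noteq> p \<and> dist y p < e"
      then have "norm (F (p + (y - p)) - F p - D (y - p)) \<le> C * (norm (y - p))\<^sup>2"
        by (intro assms(3)) (simp add: dist_norm)
      with y show "norm (norm (F y - F p - D (y - p)) / norm (y - p)) \<le> C * norm (y - p)"
        by (simp add: field_simps power2_eq_square)
    qed
  qed
qed

text \<open>The Cauchy estimate for \<open>Fn m - Fn n\<close> turns uniform closeness of the maps
  into closeness of their derivatives at a point, so these converge. The quadratic Taylor bound
  holds with one constant for all large \<open>n\<close> and survives the limit, which identifies
  the limit of the derivatives as the derivative of \<open>F\<close>.\<close>

lemma chol_uniform_limit:
  fixes F :: "'a::complex_normed \<Rightarrow> complex"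
  assumes Fn: "\<And>n. chol (Fn n) U" and lim: "uniform_limit U Fn F sequentially" and U: "open U"
  shows "chol F U"
proof (rule cholI[OF U])
  fix p assume p: "p \<in> U"
  have contF: "continuous_on U F"
    by (rule uniform_limit_theorem[OF _ lim]) (auto intro!: always_eventually chol_imp_continuous_on Fn)
  obtain r1 where r1: "r1 > 0" "ball p r1 \<subseteq> U"
    using p U openE by blast
  obtain r2 where r2: "r2 > 0" "\<And>x. x \<in> U \<Longrightarrow> dist x p < r2 \<Longrightarrow> dist (F x) (F p) < 1"
    using contF p unfolding continuous_on_iff by (metis zero_less_one)
  define r where "r = min r1 r2"
  have r: "r > 0" "ball p r \<subseteq> U" using r1 r2 by (auto simp: r_def subset_eq)
  have FM: "cmod (F x) \<le> cmod (F p) + 1" if "x \<in> ball p r" for x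
  proof -
    have "dist (F x) (F p) < 1"
      using that r by (intro r2) (auto simp: r_def dist_commute)
    then show ?thesis using norm_triangle_sub[of "F x" "F p"] by (simp add: dist_norm)
  qed
  have close: "\<exists>N. \<forall>n\<ge>N. \<forall>x\<in>U. cmod (Fn n x - F x) < e" if "e > 0" for e
    using lim that unfolding uniform_limit_sequentially_iff by (simp add: dist_norm)
  \<comment> \<open>One unit for the oscillation of \<open>F\<close> on the ball, one for the
    distance of \<open>Fn n\<close> from \<open>F\<close>.\<close>
  define M where "M = cmod (F p) + 2"
  obtain N1 where N1: "\<And>n x. n \<ge> N1 \<Longrightarrow> x \<in> U \<Longrightarrow> cmod (Fn n x - F x) < 1"
    using close[of 1] by auto
  have FnM: "cmod (Fn n x) \<le> M" if "n \<ge> N1" "x \<in> ball p r" for n x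
    using N1[OF that(1), of x] FM[OF that(2)] r that norm_triangle_sub[of "Fn n x" "F x"]
    by (auto simp: M_def)
  have "\<forall>n. \<exists>D. (Fn n has_derivative D) (at p) \<and> (\<forall>c v. D (c *\<^sub>C v) = c *\<^sub>C D v)"
    using Fn p unfolding chol_def by blast
  then obtain D where D: "\<And>n. (Fn n has_derivative D n) (at p)" "\<And>n c v. D n (c *\<^sub>C v) = c *\<^sub>C D n v"
    by metis
  have cFn: "chol (Fn n) (ball p r)" for n
    using Fn r by (auto intro: chol_subset)
  have "Cauchy (\<lambda>n. D n d)" for d
  proof (rule CauchyI)
    fix e :: real assume e: "e > 0"
    \<comment> \<open>The Cauchy estimate for the difference costs a factor
      \<open>4 * norm d / r\<close>; this choice leaves at most \<open>e / 2\<close>, also for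
      \<open>d = 0\<close>.\<close>
    define e' where "e' = e * r / (8 * (norm d + 1))"
    have nd: "norm d + 1 > 0" by (simp add: add_nonneg_pos)
    have e': "e' > 0" using e r nd by (simp add: e'_def)
    have e'r: "e' = r * (e / (8 * (norm d + 1)))" by (simp add: e'_def)
    obtain N where N: "\<And>n x. n \<ge> N \<Longrightarrow> x \<in> U \<Longrightarrow> cmod (Fn n x - F x) < e'"
      using close[OF e'] by blast
    have "norm (D m d - D n d) < e" if mn: "m \<ge> N" "n \<ge> N" for m n
    proof -
      have "cmod (D m d - D n d) \<le> 2 * (2 * e') / r * norm d"
      proof (rule chol_derivative_bound[where F = "\<lambda>x. Fn m x - Fn n x" and D = "\<lambda>d. D m d - D n d"])
        show "chol (\<lambda>x. Fn m x - Fn n x) (ball p r)"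
          by (intro chol_diff cFn)
        show "cmod (Fn m x - Fn n x) \<le> 2 * e'" if "x \<in> ball p r" for x
          using N[OF mn(1), of x] N[OF mn(2), of x] that r norm_triangle_ineq4[of "Fn m x - F x" "Fn n x - F x"]
          by auto
        show "((\<lambda>x. Fn m x - Fn n x) has_derivative (\<lambda>d. D m d - D n d)) (at p)"
          by (intro has_derivative_diff D)
      qed (use r D in \<open>auto simp: algebra_simps\<close>)
      also have "\<dots> = e / 2 * (norm d / (norm d + 1))"
        using r(1) nd by (simp add: e'r) (simp add: field_simps)
      also have "\<dots> \<le> e / 2 * 1"
        using e nd by (intro mult_left_mono) auto
      also have "\<dots> < e" using e by simp
      finally show ?thesis .
    qed
    then show "\<exists>N. \<forall>m\<ge>N. \<forall>n\<ge>N. norm (D m d - D n d) < e" by blast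
  qed
  then have "\<forall>d. \<exists>l. (\<lambda>n. D n d) \<longlonglongrightarrow> l"
    using Cauchy_convergent convergent_def by blast
  then obtain L where L: "\<And>d. (\<lambda>n. D n d) \<longlonglongrightarrow> L d" by metis
  have linD: "linear (D n)" for n using D(1) has_derivative_linear by blast
  have Ladd: "L (a + b) = L a + L b" for a b
  proof (rule LIMSEQ_unique[OF L])
    show "(\<lambda>n. D n (a + b)) \<longlonglongrightarrow> L a + L b"
      using tendsto_add[OF L[of a] L[of b]] by (simp add: linear_add[OF linD])
  qed
  have Lc: "L (c *\<^sub>C v) = c *\<^sub>C L v" for c v
  proof (rule LIMSEQ_unique[OF L])
    show "(\<lambda>n. D n (c *\<^sub>C v)) \<longlonglongrightarrow> c *\<^sub>C L v"
      using tendsto_mult_left[OF L[of v], of c] by (simp add: D)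
  qed
  have Lb: "norm (L d) \<le> norm d * (2 * M / r)" for d
  proof (rule Lim_bounded[OF tendsto_norm[OF L]])
    show "\<forall>n\<ge>N1. norm (D n d) \<le> norm d * (2 * M / r)"
    proof (intro allI impI)
      fix n assume "n \<ge> N1"
      have "norm (D n d) \<le> 2 * M / r * norm d"
        by (rule chol_derivative_bound[OF cFn _ r(1) D(1) D(2)]) (use FnM \<open>n \<ge> N1\<close> in auto)
      then show "norm (D n d) \<le> norm d * (2 * M / r)" by (simp only: mult.commute)
    qed
  qed
  have bl: "bounded_linear L"
  proof (rule bounded_linear_intro[OF Ladd _ Lb])
    show "L (s *\<^sub>R v) = s *\<^sub>R L v" for s v
      using Lc[of "of_real s" v] by (simp add: cscale_of_real scaleR_conv_of_real)
  qed
  have Fnlim: "(\<lambda>n. Fn n x) \<longlonglongrightarrow> F x" if "x \<in> U" for x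
    using tendsto_uniform_limitI[OF lim that] .
  have "(F has_derivative L) (at p)"
  proof (rule has_derivative_quadratic_remainder[OF bl])
    show "r / 4 > 0" using r by simp
    fix d :: 'a assume d: "norm d \<le> r/4"
    have "p + d \<in> U" using d r by (auto simp: subset_eq dist_norm)
    then have lim2: "(\<lambda>n. Fn n (p + d) - Fn n p - D n d) \<longlonglongrightarrow> F (p + d) - F p - L d"
      by (intro tendsto_intros Fnlim L p)
    show "norm (F (p + d) - F p - L d) \<le> 8 * M / r\<^sup>2 * (norm d)\<^sup>2"
    proof (rule Lim_bounded[OF tendsto_norm[OF lim2]])
      show "\<forall>n\<ge>N1. norm (Fn n (p + d) - Fn n p - D n d) \<le> 8 * M / r\<^sup>2 * (norm d)\<^sup>2"
        using chol_Taylor_bound[OF cFn _ r(1) D(1) D(2) d] FnM by blast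
    qed
  qed
  then show "\<exists>D. (F has_derivative D) (at p) \<and> (\<forall>c v. D (c *\<^sub>C v) = c *\<^sub>C D v)"
    using Lc by blast
qed

lemma norm_integral_unit_interval_le:
  fixes h :: "real \<Rightarrow> complex"
  assumes "h integrable_on {0..1}" "\<And>t. t \<in> {0..1} \<Longrightarrow> norm (h t) \<le> B"
  shows "norm (integral {0..1} h) \<le> B"
  using integral_norm_bound_integral[OF assms(1) integrable_const_ivl[of B] assms(2)] by simp

text \<open>Differentiation under the integral sign without a hypothesis on the derivative of the
  integrand. Cauchy estimates give a linear bound on \<open>D t\<close> and a quadratic remainder,
  both uniform in \<open>t\<close>; integrating them shows that the integral of \<open>D t\<close>
  is the derivative.\<close>

lemma chol_integral:
  fixes f :: "'a::complex_normed \<Rightarrow> real \<Rightarrow> complex"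
  assumes cont: "continuous_on (U \<times> {0..1}) (\<lambda>(p, t). f p t)"
    and hol: "\<And>t. t \<in> {0..1} \<Longrightarrow> chol (\<lambda>p. f p t) U" and U: "open U"
  shows "chol (\<lambda>p. integral {0..1} (f p)) U"
proof (rule cholI[OF U])
  fix p assume p: "p \<in> U"
  have contt: "continuous_on {0..1} (f x)" if "x \<in> U" for x
  proof -
    have "continuous_on {0..1} (\<lambda>t. case (x, t) of (p, t) \<Rightarrow> f p t)"
      by (rule continuous_on_compose2[OF cont]) (use that in \<open>auto intro!: continuous_intros\<close>)
    then show ?thesis by simp
  qed
  have int: "f x integrable_on {0..1}" if "x \<in> U" for x
    using contt[OF that] by (rule integrable_continuous_interval)
  \<comment> \<open>Compactness of the interval yields one neighbourhood of \<open>p\<close> that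
    serves all \<open>t\<close>, hence one bound \<open>M\<close>.\<close>
  obtain X0 where X0: "p \<in> X0" "open X0"
      "\<forall>x\<in>X0 \<inter> U. \<forall>t\<in>{0..1}. dist (case (x, t) of (x, t) \<Rightarrow> f x t) (case (p, t) of (p, t) \<Rightarrow> f p t) \<le> 1"
    using continuous_on_prod_compactE[OF cont _ p, of 1] by (metis compact_Icc zero_less_one)
  obtain r where r: "r > 0" "ball p r \<subseteq> X0 \<inter> U"
    using p X0 U by (meson IntI open_Int openE)
  have "bounded (f p ` {0..1})"
    using compact_continuous_image[OF contt[OF p]] compact_Icc compact_imp_bounded by blast
  then obtain M0 where M0: "\<And>t. t \<in> {0..1} \<Longrightarrow> cmod (f p t) \<le> M0"
    unfolding bounded_iff by (metis imageI)
  define M where "M = M0 + 1"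
  have fM: "cmod (f x t) \<le> M" if "x \<in> ball p r" "t \<in> {0..1}" for x t
  proof -
    have "dist (f x t) (f p t) \<le> 1" using X0(3) that r(2) by (auto simp: subset_eq)
    then show ?thesis
      using M0[OF that(2)] norm_triangle_sub[of "f x t" "f p t"] by (simp add: dist_norm M_def)
  qed
  have M: "M \<ge> 0" using M0[of 0] norm_ge_zero[of "f p 0"] by (simp add: M_def del: norm_ge_zero)
  have "\<forall>t\<in>{0..1}. \<exists>D. ((\<lambda>p. f p t) has_derivative D) (at p) \<and> (\<forall>c v. D (c *\<^sub>C v) = c *\<^sub>C D v)"
    using hol p unfolding chol_def by blast
  then obtain D where D: "\<And>t. t \<in> {0..1} \<Longrightarrow> ((\<lambda>p. f p t) has_derivative D t) (at p)"
      "\<And>t c v. t \<in> {0..1} \<Longrightarrow> D t (c *\<^sub>C v) = c *\<^sub>C D t v"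
    by metis
  have cf: "chol (\<lambda>p. f p t) (ball p r)" if "t \<in> {0..1}" for t
    using hol[OF that] r by (auto intro: chol_subset)
  have linD: "linear (D t)" if "t \<in> {0..1}" for t using D(1)[OF that] has_derivative_linear by blast
  have Dbound: "cmod (D t d) \<le> 2 * M / r * norm d" if "t \<in> {0..1}" for t d
    by (rule chol_derivative_bound[OF cf[OF that] _ r(1) D[OF that]]) (use fM that in auto)
  have rem: "cmod (f (p + d) t - f p t - D t d) \<le> 8 * M / r\<^sup>2 * (norm d)\<^sup>2"
    if "t \<in> {0..1}" "norm d \<le> r/4" for t d
    by (rule chol_Taylor_bound[OF cf[OF that(1)] _ r(1) D[OF that(1)] that(2)]) (use fM that in auto)
  \<comment> \<open>The derivatives are merely chosen for each \<open>t\<close>, so their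
    integrability in \<open>t\<close> is not automatic. By the quadratic remainder the difference
    quotients along \<open>s n\<close> converge to \<open>D t d\<close> uniformly in
    \<open>t\<close>, and each quotient is continuous in \<open>t\<close>.\<close>
  have contD: "continuous_on {0..1} (\<lambda>t. D t d)" for d
  proof -
    define s where "s = (\<lambda>n::nat. r / (4 * (norm d + 1) * real (Suc n)))"
    have nd: "norm d + 1 > 0" by (simp add: add_nonneg_pos)
    have spos: "s n > 0" for n using r nd by (simp add: s_def)
    have sd: "norm (s n *\<^sub>R d) \<le> r / 4" for n
    proof -
      have "norm (s n *\<^sub>R d) = r / 4 * (norm d / (norm d + 1) * (1 / real (Suc n)))"
        using r by (simp add: s_def field_simps)
      also have "\<dots> \<le> r/4 * (1 * 1)"
        using r nd by (intro mult_left_mono mult_mono) auto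
      finally show ?thesis by simp
    qed
    have s0: "s \<longlonglongrightarrow> 0"
    proof -
      have "(\<lambda>n. r / (4 * (norm d + 1)) * inverse (real (Suc n))) \<longlonglongrightarrow> r / (4 * (norm d + 1)) * 0"
        by (intro tendsto_mult_left LIMSEQ_inverse_real_of_nat)
      then show ?thesis by (simp add: s_def field_simps)
    qed
    have ul: "uniform_limit {0..1} (\<lambda>n t. (1 / s n) *\<^sub>R (f (p + s n *\<^sub>R d) t - f p t)) (\<lambda>t. D t d) sequentially"
    proof (rule uniform_limitI)
      fix e :: real assume e: "e > 0"
      have "(\<lambda>n. 8 * M / r\<^sup>2 * (norm d)\<^sup>2 * s n) \<longlonglongrightarrow> 8 * M / r\<^sup>2 * (norm d)\<^sup>2 * 0"
        by (intro tendsto_mult_left s0)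
      then have "eventually (\<lambda>n. 8 * M / r\<^sup>2 * (norm d)\<^sup>2 * s n < e) sequentially"
        using e by (simp add: order_tendsto_iff)
      then show "\<forall>\<^sub>F n in sequentially. \<forall>t\<in>{0..1}. dist ((1 / s n) *\<^sub>R (f (p + s n *\<^sub>R d) t - f p t)) (D t d) < e"
      proof eventually_elim
        case (elim n)
        show ?case
        proof
          fix t :: real assume t: "t \<in> {0..1}"
          have "(1 / s n) *\<^sub>R (f (p + s n *\<^sub>R d) t - f p t) - D t d
              = (1 / s n) *\<^sub>R (f (p + s n *\<^sub>R d) t - f p t - D t (s n *\<^sub>R d))"
            using spos[of n] by (simp add: linear_cmul[OF linD[OF t]] scaleR_right_diff_distrib)
          then have "dist ((1 / s n) *\<^sub>R (f (p + s n *\<^sub>R d) t - f p t)) (D t d)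
              = (1 / s n) * cmod (f (p + s n *\<^sub>R d) t - f p t - D t (s n *\<^sub>R d))"
            using spos[of n] by (simp add: dist_norm)
          also have "\<dots> \<le> (1 / s n) * (8 * M / r\<^sup>2 * (norm (s n *\<^sub>R d))\<^sup>2)"
            using spos[of n] rem[OF t sd[of n]] by (intro mult_left_mono) auto
          also have "\<dots> = 8 * M / r\<^sup>2 * (norm d)\<^sup>2 * s n"
            using spos[of n] by (simp add: power_mult_distrib power2_eq_square)
          finally show "dist ((1 / s n) *\<^sub>R (f (p + s n *\<^sub>R d) t - f p t)) (D t d) < e"
            using elim by simp
        qed
      qed
    qed
    have "continuous_on {0..1} (\<lambda>t. (1 / s n) *\<^sub>R (f (p + s n *\<^sub>R d) t - f p t))" for n
    proof -
      have "p + s n *\<^sub>R d \<in> ball p r"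
        using sd[of n] r by (simp add: dist_norm)
      then have "p + s n *\<^sub>R d \<in> U" using r by blast
      then show ?thesis by (intro continuous_intros contt p)
    qed
    then show ?thesis
      by (intro uniform_limit_theorem[OF _ ul]) auto
  qed
  have intD: "(\<lambda>t. D t d) integrable_on {0..1}" for d
    by (rule integrable_continuous_interval[OF contD])
  define L where "L = (\<lambda>d. integral {0..1} (\<lambda>t. D t d))"
  have Lc: "L (c *\<^sub>C v) = c *\<^sub>C L v" for c v
  proof -
    have "L (c *\<^sub>C v) = integral {0..1} (\<lambda>t. c * D t v)"
      unfolding L_def by (rule integral_cong) (simp add: D)
    then show ?thesis by (simp add: L_def)
  qed
  have Ladd: "L (a + b) = L a + L b" for a b
  proof -
    have "L (a + b) = integral {0..1} (\<lambda>t. D t a + D t b)"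
      unfolding L_def by (rule integral_cong) (simp add: linear_add[OF linD])
    then show ?thesis by (simp add: L_def integral_add intD)
  qed
  have bl: "bounded_linear L"
  proof (rule bounded_linear_intro[OF Ladd, where K = "2 * M / r"])
    show "L (s *\<^sub>R v) = s *\<^sub>R L v" for s v
      using Lc[of "of_real s" v] by (simp add: cscale_of_real scaleR_conv_of_real)
    show "norm (L x) \<le> norm x * (2 * M / r)" for x
      unfolding L_def using Dbound by (intro norm_integral_unit_interval_le intD) (simp add: mult.commute)
  qed
  have "((\<lambda>p. integral {0..1} (f p)) has_derivative L) (at p)"
  proof (rule has_derivative_quadratic_remainder[OF bl])
    show "r / 4 > 0" using r by simp
    fix d :: 'a assume d: "norm d \<le> r/4"
    have "p + d \<in> ball p r" using d r by (simp add: dist_norm)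
    then have pd: "p + d \<in> U" using r by blast
    have "integral {0..1} (f (p + d)) - integral {0..1} (f p) - L d
        = integral {0..1} (\<lambda>t. f (p + d) t - f p t - D t d)"
      unfolding L_def by (simp add: integral_diff int p pd intD integrable_diff)
    then show "norm (integral {0..1} (f (p + d)) - integral {0..1} (f p) - L d) \<le> 8 * M / r\<^sup>2 * (norm d)\<^sup>2"
      using rem[OF _ d] by (simp only:) (intro norm_integral_unit_interval_le integrable_diff int p pd intD, auto)
  qed
  then show "\<exists>D. ((\<lambda>p. integral {0..1} (f p)) has_derivative D) (at p) \<and> (\<forall>c v. D (c *\<^sub>C v) = c *\<^sub>C D v)"
    using Lc by blast
qed

text \<open>The quotient is given by the Cauchy kernel: on the circle \<open>\<zeta>(\<theta>) = (r/2) exp (2\<pi>i\<theta>)\<close>,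
  \<open>x/(\<zeta>(\<zeta> - x)) = 1/(\<zeta> - x) - 1/\<zeta>\<close>.\<close>

lemma chol_divide_by_coordinate:
  fixes H :: "complex \<times> 'a::complex_normed \<Rightarrow> complex"
  assumes H: "chol H (ball 0 r \<times> W)" and r: "r > 0" and W: "open W"
    and zero: "\<And>w. w \<in> W \<Longrightarrow> H (0, w) = 0"
  shows "\<exists>Q. chol Q (ball 0 (r/2) \<times> W) \<and> (\<forall>x\<in>ball 0 (r/2). \<forall>w\<in>W. H (x, w) = x * Q (x, w))"
proof -
  define z where "z = circlepath 0 (r/2)"
  have z_eq: "z t = of_real (r/2) * exp (2 * of_real pi * \<i> * of_real t)" for t
    by (simp add: z_def circlepath)
  have nz: "cmod (z t) = r/2" for t
  proof -
    have "2 * of_real pi * \<i> * of_real t = \<i> * complex_of_real (2 * pi * t)" by simp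
    then have "cmod (exp (2 * of_real pi * \<i> * of_real t)) = 1"
      by (simp only: norm_exp_i_times)
    then show ?thesis using r unfolding z_eq norm_mult norm_of_real by simp
  qed
  \<comment> \<open>Only \<open>1 / (z - x)\<close> of the kernel \<open>1 / (z (z - x))\<close> is
    visible: the factor \<open>1 / z\<close> cancels against the velocity \<open>2 pi i z\<close> of
    the circle.\<close>
  define q where "q = (\<lambda>(p::complex \<times> 'a) t. H (z t, snd p) / (z t - fst p))"
  define U where "U = ball (0::complex) (r/2) \<times> W"
  have U: "open U" unfolding U_def by (intro open_Times W open_ball)
  have contz: "continuous_on A z" for A
    unfolding z_eq by (intro continuous_intros)
  have nezf: "z t - fst p \<noteq> 0" if "p \<in> U" for p t
    using that nz[of t] by (auto simp: U_def)
  have zb: "z t \<in> ball 0 r" for t using nz[of t] r by simp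
  have "chol (\<lambda>p. integral {0..1} (q p)) U"
  proof (rule chol_integral[OF _ _ U])
    have "continuous_on (U \<times> {0..1}) (\<lambda>pt. H (z (snd pt), snd (fst pt)))"
    proof (rule continuous_on_compose2[OF chol_imp_continuous_on[OF H]])
      show "continuous_on (U \<times> {0..1}) (\<lambda>pt. (z (snd pt), snd (fst pt)))"
        by (intro continuous_intros continuous_on_compose2[OF contz[of UNIV]]) auto
    qed (use zb in \<open>auto simp: U_def\<close>)
    then have "continuous_on (U \<times> {0..1}) (\<lambda>pt. H (z (snd pt), snd (fst pt)) / (z (snd pt) - fst (fst pt)))"
      using nezf by (intro continuous_intros continuous_on_compose2[OF contz[of UNIV]]) auto
    then show "continuous_on (U \<times> {0..1}) (\<lambda>(p, t). q p t)"
      by (simp add: q_def case_prod_beta')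
  next
    fix t :: real assume "t \<in> {0..1}"
    have "chol (\<lambda>p. H (z t, snd p)) U"
    proof (rule chol_compose[OF H])
      show "chol (\<lambda>p. (z t, snd p)) U" by (intro chol_Pair chol_const chol_snd U)
    qed (use zb in \<open>auto simp: U_def\<close>)
    then show "chol (\<lambda>p. q p t) U"
      unfolding q_def using nezf by (intro chol_divide chol_diff chol_const chol_fst U) auto
  qed
  moreover have "H (x, w) = x * integral {0..1} (q (x, w))" if x: "x \<in> ball 0 (r/2)" and w: "w \<in> W" for x w
  proof -
    define h where "h = (\<lambda>x. H (x, w))"
    have "chol h (ball 0 r)" unfolding h_def
      by (rule chol_compose[OF H]) (use w in \<open>auto intro!: chol_Pair chol_const chol_id\<close>)
    then have "h holomorphic_on ball 0 r" by (simp add: chol_iff_holomorphic)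
    then have hol: "h holomorphic_on cball 0 (r/2)"
      by (rule holomorphic_on_subset) (use r in auto)
    have "((\<lambda>u. h u / (u - x)) has_contour_integral (2 * of_real pi * \<i> * h x)) (circlepath 0 (r/2))"
      using x by (intro Cauchy_integral_circlepath_simple[OF hol]) auto
    moreover have "((\<lambda>u. h u / (u - 0)) has_contour_integral (2 * of_real pi * \<i> * h 0)) (circlepath 0 (r/2))"
      using r by (intro Cauchy_integral_circlepath_simple[OF hol]) auto
    ultimately have "((\<lambda>u. h u / (u - x) - h u / (u - 0)) has_contour_integral
        (2 * of_real pi * \<i> * h x - 2 * of_real pi * \<i> * h 0)) (circlepath 0 (r/2))"
      by (rule has_contour_integral_diff)
    moreover have "vector_derivative z (at t within {0..1}) = 2 * pi * \<i> * z t" if "t \<in> {0..1}" for t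
      using that unfolding z_def by (subst vector_derivative_circlepath01) (auto simp: circlepath)
    moreover have "h 0 = 0" using zero[OF w] by (simp add: h_def)
    ultimately have "((\<lambda>t. (h (z t) / (z t - x) - h (z t) / (z t - 0)) * (2 * pi * \<i> * z t)) has_integral
        (2 * of_real pi * \<i> * h x - 2 * of_real pi * \<i> * h 0)) {0..1}"
      unfolding has_contour_integral_def z_def[symmetric]
      by (subst (asm) has_integral_cong) auto
    with \<open>h 0 = 0\<close> have "((\<lambda>t. (h (z t) / (z t - x) - h (z t) / (z t - 0)) * (2 * pi * \<i> * z t)) has_integral
        (2 * of_real pi * \<i> * h x)) {0..1}"
      by simp
    then have "((\<lambda>t. (2 * of_real pi * \<i>) * (x * q (x, w) t)) has_integral (2 * of_real pi * \<i> * h x)) {0..1}"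
    proof (rule has_integral_eq[rotated])
      fix t
      have "z t \<noteq> 0" using nz[of t] r by auto
      moreover have "z t - x \<noteq> 0" using nezf[of "(x, w)" t] x w by (auto simp: U_def)
      ultimately show "(h (z t) / (z t - x) - h (z t) / (z t - 0)) * (2 * pi * \<i> * z t)
          = (2 * of_real pi * \<i>) * (x * q (x, w) t)"
        by (simp add: q_def h_def field_simps)
    qed
    then have "integral {0..1} (\<lambda>t. (2 * of_real pi * \<i>) * (x * q (x, w) t)) = 2 * of_real pi * \<i> * h x"
      by (rule integral_unique)
    then show ?thesis by (simp add: h_def)
  qed
  ultimately show ?thesis unfolding U_def by blast
qed

text \<open>A point of the half ball still has room \<open>r/2\<close> around it, so the Cauchy
  estimate bounds all derivatives there by \<open>2 * M / (r/2)\<close>; convexity of the ball turns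
  this into a Lipschitz constant.\<close>

lemma chol_locally_lipschitz_complex:
  fixes F :: "'a::complex_normed \<Rightarrow> complex"
  assumes F: "chol F U" and p: "p \<in> U"
  shows "\<exists>r>0. \<exists>L. ball p r \<subseteq> U \<and> L-lipschitz_on (ball p r) F"
proof -
  have contF: "continuous_on U F" using F by (rule chol_imp_continuous_on)
  obtain r1 where r1: "r1 > 0" "ball p r1 \<subseteq> U"
    using p F chol_open openE by blast
  obtain r2 where r2: "r2 > 0" "\<And>x. x \<in> U \<Longrightarrow> dist x p < r2 \<Longrightarrow> dist (F x) (F p) < 1"
    using contF p unfolding continuous_on_iff by (metis zero_less_one)
  define r where "r = min r1 r2"
  have r: "r > 0" "ball p r \<subseteq> U" using r1 r2 by (auto simp: r_def subset_eq)
  define M where "M = cmod (F p) + 1"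
  have FM: "cmod (F x) \<le> M" if "x \<in> ball p r" for x
  proof -
    have "dist (F x) (F p) < 1"
      using that r by (intro r2) (auto simp: r_def dist_commute)
    then show ?thesis using norm_triangle_sub[of "F x" "F p"] by (simp add: dist_norm M_def)
  qed
  have "\<forall>x\<in>U. \<exists>D. (F has_derivative D) (at x) \<and> (\<forall>c v. D (c *\<^sub>C v) = c *\<^sub>C D v)"
    using F unfolding chol_def by blast
  then obtain D where D: "\<And>x. x \<in> U \<Longrightarrow> (F has_derivative D x) (at x)"
      "\<And>x c v. x \<in> U \<Longrightarrow> D x (c *\<^sub>C v) = c *\<^sub>C D x v"
    by metis
  have M0: "M \<ge> 0" by (simp add: M_def)
  have "(4 * M / r)-lipschitz_on (ball p (r/2)) F"
  proof (rule lipschitz_onI)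
    fix x y assume xy: "x \<in> ball p (r/2)" "y \<in> ball p (r/2)"
    have "norm (F x - F y) \<le> 4 * M / r * norm (x - y)"
    proof (rule differentiable_bound[OF convex_ball _ _ xy])
      fix x assume x: "x \<in> ball p (r/2)"
      then have "x \<in> ball p r" using r by auto
      then have xU: "x \<in> U" using r by blast
      then show "(F has_derivative D x) (at x within ball p (r/2))"
        using D has_derivative_at_withinI by blast
      have sub: "ball x (r/2) \<subseteq> ball p r"
      proof
        fix y assume "y \<in> ball x (r/2)"
        then show "y \<in> ball p r" using x dist_triangle[of p y x] by auto
      qed
      show "onorm (D x) \<le> 4 * M / r"
      proof (rule onorm_bound)
        fix d
        have "cmod (D x d) \<le> 2 * M / (r/2) * norm d"
          by (rule chol_derivative_bound[OF chol_subset[OF F] _ _ D(1)[OF xU] D(2)[OF xU]])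
             (use r sub FM in auto)
        then show "norm (D x d) \<le> 4 * M / r * norm d" by simp
      qed (use M0 r in auto)
    qed
    then show "dist (F x) (F y) \<le> 4 * M / r * dist x y" by (simp add: dist_norm)
  qed (use M0 r in auto)
  moreover have "ball p (r/2) \<subseteq> U" using r by (auto simp: subset_eq)
  ultimately show ?thesis using r by (intro exI[of _ "r/2"]) auto
qed

lemma lipschitz_on_Pair:
  assumes "L-lipschitz_on A F" "M-lipschitz_on A G"
  shows "(L + M)-lipschitz_on A (\<lambda>x. (F x, G x))"
proof (rule lipschitz_onI)
  fix x y assume xy: "x \<in> A" "y \<in> A"
  have "dist (F x, G x) (F y, G y) \<le> dist (F x) (F y) + dist (G x) (G y)"
    unfolding dist_Pair_Pair by (rule sqrt_sum_squares_le_sum) auto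
  also have "\<dots> \<le> L * dist x y + M * dist x y"
    using assms xy by (intro add_mono lipschitz_onD) auto
  finally show "dist (F x, G x) (F y, G y) \<le> (L + M) * dist x y" by (simp add: algebra_simps)
qed (use assms in \<open>auto intro: lipschitz_on_nonneg add_nonneg_nonneg\<close>)

lemma chol_locally_lipschitz_c3:
  fixes F :: "'a::complex_normed \<Rightarrow> c3"
  assumes F: "chol F U" and p: "p \<in> U"
  shows "\<exists>r>0. \<exists>L. ball p r \<subseteq> U \<and> L-lipschitz_on (ball p r) F"
proof -
  obtain r1 L1 where 1: "r1 > 0" "ball p r1 \<subseteq> U" "L1-lipschitz_on (ball p r1) (\<lambda>x. fst (F x))"
    using chol_locally_lipschitz_complex[OF chol_fst_compose[OF F] p] by blast
  obtain r2 L2 where 2: "r2 > 0" "ball p r2 \<subseteq> U" "L2-lipschitz_on (ball p r2) (\<lambda>x. fst (snd (F x)))"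
    using chol_locally_lipschitz_complex[OF chol_fst_compose[OF chol_snd_compose[OF F]] p] by blast
  obtain r3 L3 where 3: "r3 > 0" "ball p r3 \<subseteq> U" "L3-lipschitz_on (ball p r3) (\<lambda>x. snd (snd (F x)))"
    using chol_locally_lipschitz_complex[OF chol_snd_compose[OF chol_snd_compose[OF F]] p] by blast
  define r where "r = min r1 (min r2 r3)"
  have sub: "ball p r \<subseteq> ball p r1" "ball p r \<subseteq> ball p r2" "ball p r \<subseteq> ball p r3"
    by (auto simp: r_def)
  have "(L1 + (L2 + L3))-lipschitz_on (ball p r) (\<lambda>x. (fst (F x), fst (snd (F x)), snd (snd (F x))))"
    by (intro lipschitz_on_Pair lipschitz_on_subset[OF 1(3) sub(1)] lipschitz_on_subset[OF 2(3) sub(2)]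
          lipschitz_on_subset[OF 3(3) sub(3)])
  moreover have "ball p r \<subseteq> U" "r > 0" using sub(1) 1 2 3 by (auto simp: r_def)
  ultimately show ?thesis by auto
qed

section \<open>A singular differential equation with parameter\<close>

text \<open>The contraction principle for a class \<open>P\<close> of functions, measured by the
  supremum over \<open>D\<close>. Keeping \<open>P\<close> as a predicate closed under uniform
  limits lets holomorphy, bounds and symmetries be carried through the iteration together, without
  making the class a complete metric space of its own.\<close>

lemma uniform_fixed_point:
  fixes T :: "('x \<Rightarrow> 'b::banach) \<Rightarrow> 'x \<Rightarrow> 'b"
  assumes P0: "P v0" and PT: "\<And>v. P v \<Longrightarrow> P (T v)"
    and bd: "\<And>v x. P v \<Longrightarrow> x \<in> D \<Longrightarrow> norm (v x) \<le> B"
    and contr: "\<And>u v c x. P u \<Longrightarrow> P v \<Longrightarrow> (\<And>x. x \<in> D \<Longrightarrow> norm (u x - v x) \<le> c) \<Longrightarrow> x \<in> D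
        \<Longrightarrow> norm (T u x - T v x) \<le> c / 2"
    and closed: "\<And>u l. (\<And>n. P (u n)) \<Longrightarrow> uniform_limit D u l sequentially \<Longrightarrow> P l"
  shows "\<exists>v. P v \<and> (\<forall>x\<in>D. T v x = v x)"
proof -
  define u where "u = (\<lambda>n. (T ^^ n) v0)"
  have Pu: "P (u n)" for n by (induction n) (auto simp: u_def P0 PT)
  have uS: "u (Suc n) = T (u n)" for n by (simp add: u_def)
  \<comment> \<open>Any two iterates are within \<open>2 * B\<close> of each other, and every
    application of \<open>T\<close> halves this. The iterates are thus uniformly Cauchy without
    summing a geometric series.\<close>
  have diff: "norm (u (n + k) x - u n x) \<le> 2 * B / 2 ^ n" if "x \<in> D" for n k x
    using that
  proof (induction n arbitrary: x)
    case 0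
    have "norm (u k x) \<le> B" "norm (u 0 x) \<le> B" using bd Pu 0 by blast+
    then show ?case using norm_triangle_ineq4[of "u k x" "u 0 x"] by simp
  next
    case (Suc n)
    have "norm (T (u (n + k)) x - T (u n) x) \<le> (2 * B / 2 ^ n) / 2"
      by (rule contr[OF Pu Pu Suc.IH Suc.prems])
    then show ?case by (simp add: uS)
  qed
  have small: "\<exists>N. \<forall>n\<ge>N. 2 * B / 2 ^ n < e" if "e > 0" for e
  proof -
    have "(\<lambda>n. 2 * B * (1 / 2) ^ n) \<longlonglongrightarrow> 2 * B * 0"
      by (intro tendsto_mult_left LIMSEQ_power_zero) auto
    then have "eventually (\<lambda>n. 2 * B * (1/2) ^ n < e) sequentially"
      using that by (simp add: order_tendsto_iff)
    then show ?thesis by (simp add: eventually_sequentially power_one_over field_simps)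
  qed
  have "uniformly_Cauchy_on D u"
    unfolding uniformly_Cauchy_on_def
  proof (intro allI impI)
    fix e :: real assume "e > 0"
    then obtain N where N: "\<And>n. n \<ge> N \<Longrightarrow> 2 * B / 2 ^ n < e" using small by blast
    have le: "dist (u m x) (u n x) < e" if "x \<in> D" "N \<le> n" "n \<le> m" for x m n
      using diff[OF that(1), of n "m - n"] N[OF that(2)] that by (simp add: dist_norm)
    show "\<exists>M. \<forall>x\<in>D. \<forall>m\<ge>M. \<forall>n\<ge>M. dist (u m x) (u n x) < e"
      by (metis le dist_commute nle_le)
  qed
  then obtain l where l: "uniform_limit D u l sequentially"
    using Cauchy_uniformly_convergent uniformly_convergent_on_def by blast
  have Pl: "P l" using closed[OF Pu l] .
  have "T l x = l x" if x: "x \<in> D" for x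
  proof (rule ccontr)
    assume ne: "T l x \<noteq> l x"
    define e where "e = norm (T l x - l x) / 2"
    have e: "e > 0" using ne by (simp add: e_def)
    from l e obtain N where N: "\<And>n x. n \<ge> N \<Longrightarrow> x \<in> D \<Longrightarrow> norm (u n x - l x) < e"
      unfolding uniform_limit_sequentially_iff dist_norm by meson
    have "norm (T (u N) x - T l x) \<le> e / 2"
      by (rule contr[OF Pu Pl _ x]) (use N in \<open>auto intro: less_imp_le\<close>)
    moreover have "norm (u (Suc N) x - l x) < e" using N x by auto
    moreover have "norm (T l x - l x) \<le> norm (T (u N) x - T l x) + norm (u (Suc N) x - l x)"
      using norm_triangle_ineq4[of "u (Suc N) x - l x" "T (u N) x - T l x"] by (simp add: uS add.commute)
    ultimately show False using e unfolding e_def by linarith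
  qed
  with Pl show ?thesis by blast
qed

text \<open>The case distinction is needed because \<open>0 powr 0 = 0\<close>.\<close>

definition weight :: "real \<Rightarrow> real \<Rightarrow> real" where
  "weight b t = (if b = 0 then 1 else t powr b)"

section \<open>The weighted mean and its differential equation\<close>

lemma continuous_on_weight: "b \<ge> 0 \<Longrightarrow> continuous_on {0..1} (weight b)"
  unfolding weight_def by (cases "b = 0") (auto intro!: continuous_intros continuous_on_powr')

lemma weight_bounds: "b \<ge> 0 \<Longrightarrow> t \<in> {0..1} \<Longrightarrow> 0 \<le> weight b t \<and> weight b t \<le> 1"
  by (auto simp: weight_def intro: powr_le1)

lemma weight_one [simp]: "weight b 1 = 1"
  by (simp add: weight_def)

text \<open>With tau = t s, the product \<open>s * weighted_mean b k (s, e)\<close> is formally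
  s^(-b) times the integral of tau^b k(tau, e) from 0 to s, that is, variation of constants for the
  singular equation. The rescaled form raises only real numbers to the power \<open>b\<close>, so no
  branch of a complex power occurs.\<close>

definition weighted_mean :: "real \<Rightarrow> (complex \<times> 'a \<Rightarrow> complex) \<Rightarrow> complex \<times> 'a \<Rightarrow> complex" where
  "weighted_mean b k p = integral {0..1} (\<lambda>t. of_real (weight b t) * k (of_real t * fst p, snd p))"

lemma continuous_on_weighted_integrand:
  fixes k :: "complex \<times> 'a::real_normed_vector \<Rightarrow> complex"
  assumes k: "continuous_on (ball 0 r \<times> E) k" and b: "b \<ge> 0"
  shows "continuous_on ((ball 0 r \<times> E) \<times> {0..1})
           (\<lambda>(p, t). of_real (weight b t) * k (of_real t * fst p, snd p))"
proof -
  have "continuous_on ((ball 0 r \<times> E) \<times> {0..1}) (\<lambda>q. k (of_real (snd q) * fst (fst q), snd (fst q)))"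
  proof (rule continuous_on_compose2[OF k])
    show "(\<lambda>q. (complex_of_real (snd q) * fst (fst q), snd (fst q))) ` ((ball 0 r \<times> E) \<times> {0..1}) \<subseteq> ball 0 r \<times> E"
    proof clarsimp
      fix a :: complex and t :: real
      assume a: "cmod a < r" and t: "0 \<le> t" "t \<le> 1"
      have "\<bar>t\<bar> * cmod a \<le> 1 * cmod a" using t by (intro mult_right_mono) auto
      then show "cmod (of_real t * a) < r" using a by (simp add: norm_mult)
    qed
  qed (intro continuous_intros)
  moreover have "continuous_on ((ball 0 r \<times> E) \<times> {0..1}) (\<lambda>q. weight b (snd q))"
    by (rule continuous_on_compose2[OF continuous_on_weight[OF b]]) (auto intro!: continuous_intros)
  ultimately show ?thesis
    unfolding case_prod_beta' by (intro continuous_intros)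
qed

lemma of_real_mult_in_ball:
  "t \<in> {0..1} \<Longrightarrow> x \<in> ball 0 r \<Longrightarrow> complex_of_real t * x \<in> ball 0 r"
  using mult_right_mono[of "\<bar>t\<bar>" 1 "cmod x"] by (auto simp: norm_mult)

lemma chol_weighted_mean:
  fixes k :: "complex \<times> 'a::complex_normed \<Rightarrow> complex"
  assumes k: "chol k (ball 0 r \<times> E)" and E: "open E" and b: "b \<ge> 0"
  shows "chol (weighted_mean b k) (ball 0 r \<times> E)"
  unfolding weighted_mean_def
proof (rule chol_integral)
  show "continuous_on ((ball 0 r \<times> E) \<times> {0..1}) (\<lambda>(p, t). of_real (weight b t) * k (of_real t * fst p, snd p))"
    by (intro continuous_on_weighted_integrand chol_imp_continuous_on k b)
  show U: "open (ball (0::complex) r \<times> E)" by (intro open_Times open_ball E)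
  show "chol (\<lambda>p. of_real (weight b t) * k (of_real t * fst p, snd p)) (ball 0 r \<times> E)" if t: "t \<in> {0..1}" for t
  proof (intro chol_mult chol_const U chol_compose[OF k] chol_Pair chol_fst chol_snd)
    show "(\<lambda>p. (complex_of_real t * fst p, snd p)) ` (ball 0 r \<times> E) \<subseteq> ball 0 r \<times> E"
      using of_real_mult_in_ball[OF t] by auto
  qed
qed

lemma weighted_integrand_integrable:
  fixes k :: "complex \<times> 'a::complex_normed \<Rightarrow> complex"
  assumes k: "continuous_on (ball 0 r \<times> E) k" and b: "b \<ge> 0" and p: "p \<in> ball 0 r \<times> E"
  shows "(\<lambda>t. of_real (weight b t) * k (of_real t * fst p, snd p)) integrable_on {0..1}"
proof (rule integrable_continuous_interval)
  have "continuous_on {0..1} (\<lambda>t. case (p, t) of (p, t) \<Rightarrow> of_real (weight b t) * k (of_real t * fst p, snd p))"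
    by (rule continuous_on_compose2[OF continuous_on_weighted_integrand[OF k b]])
       (use p in \<open>auto intro!: continuous_intros\<close>)
  then show "continuous_on {0..1} (\<lambda>t. of_real (weight b t) * k (of_real t * fst p, snd p))" by simp
qed

lemma norm_weighted_mean_diff_le:
  fixes k k' :: "complex \<times> 'a::complex_normed \<Rightarrow> complex"
  assumes "continuous_on (ball 0 r \<times> E) k" "continuous_on (ball 0 r \<times> E) k'"
    and b: "b \<ge> 0" and p: "p \<in> ball 0 r \<times> E"
    and le: "\<And>q. q \<in> ball 0 r \<times> E \<Longrightarrow> norm (k q - k' q) \<le> C"
  shows "norm (weighted_mean b k p - weighted_mean b k' p) \<le> C"
proof -
  have "weighted_mean b k p - weighted_mean b k' p =
      integral {0..1} (\<lambda>t. of_real (weight b t) * k (of_real t * fst p, snd p)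
        - of_real (weight b t) * k' (of_real t * fst p, snd p))"
    unfolding weighted_mean_def
    by (intro integral_diff[symmetric] weighted_integrand_integrable[OF assms(1) b p]
          weighted_integrand_integrable[OF assms(2) b p])
  also have "norm \<dots> \<le> C"
  proof (intro norm_integral_unit_interval_le integrable_diff weighted_integrand_integrable[OF assms(1) b p]
          weighted_integrand_integrable[OF assms(2) b p])
    fix t :: real assume t: "t \<in> {0..1}"
    have "norm (of_real (weight b t) * k (of_real t * fst p, snd p) - of_real (weight b t) * k' (of_real t * fst p, snd p))
      = weight b t * norm (k (of_real t * fst p, snd p) - k' (of_real t * fst p, snd p))"
      using weight_bounds[OF b t] by (simp add: right_diff_distrib[symmetric] norm_mult)
    also have "\<dots> \<le> 1 * norm (k (of_real t * fst p, snd p) - k' (of_real t * fst p, snd p))"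
      using weight_bounds[OF b t] by (intro mult_right_mono) auto
    also have "\<dots> \<le> C"
      using le[of "(of_real t * fst p, snd p)"] of_real_mult_in_ball[OF t, of "fst p" r] p by auto
    finally show "norm (of_real (weight b t) * k (of_real t * fst p, snd p)
        - of_real (weight b t) * k' (of_real t * fst p, snd p)) \<le> C" .
  qed
  finally show ?thesis .
qed

text \<open>Differentiate \<open>t * weight b t * h (t * s)\<close> in \<open>t\<close> and
  integrate over the unit interval. The result is \<open>h s\<close> on one side, and
  \<open>(b + 1) * J s\<close> plus \<open>s\<close> times the integral for \<open>J'\<close> on the
  other.\<close>

lemma weighted_mean_ode:
  fixes h :: "complex \<Rightarrow> complex"
  assumes h: "h holomorphic_on ball 0 r" and b: "b \<ge> 0" and s: "s \<in> ball 0 r"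
  defines "J \<equiv> \<lambda>s. integral {0..1} (\<lambda>t. of_real (weight b t) * h (of_real t * s))"
  shows "\<exists>J'. (J has_field_derivative J') (at s) \<and> s * J' = h s - (of_real b + 1) * J s"
proof -
  define fx where "fx = (\<lambda>s t. of_real (weight b t) * (of_real t * deriv h (of_real t * s)))"
  have conth: "continuous_on (ball 0 r) h" using h holomorphic_on_imp_continuous_on by blast
  have dh: "deriv h holomorphic_on ball 0 r" by (intro holomorphic_deriv h open_ball)
  have contdh: "continuous_on (ball 0 r) (deriv h)" using dh holomorphic_on_imp_continuous_on by blast
  have derh: "(h has_field_derivative deriv h z) (at z)" if "z \<in> ball 0 r" for z
    using that h by (intro holomorphic_derivI[where S = "ball 0 r"]) auto
  have cw: "continuous_on (ball 0 r \<times> {0..1}) (\<lambda>q::complex \<times> real. weight b (snd q))"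
    by (rule continuous_on_compose2[OF continuous_on_weight[OF b]]) (auto intro!: continuous_intros)
  have cont2: "continuous_on (ball 0 r \<times> {0..1}) (\<lambda>q::complex \<times> real. g (of_real (snd q) * fst q))"
    if "continuous_on (ball 0 r) g" for g :: "complex \<Rightarrow> complex"
    by (rule continuous_on_compose2[OF that])
       (use of_real_mult_in_ball in \<open>auto intro!: continuous_intros simp del: mem_ball\<close>)
  have cf: "continuous_on (ball 0 r \<times> {0..1}) (\<lambda>(s, t). of_real (weight b t) * h (of_real t * s))"
    unfolding case_prod_beta' by (intro continuous_intros cw cont2 conth)
  have cfx: "continuous_on (ball 0 r \<times> {0..1}) (\<lambda>(s, t). fx s t)"
    unfolding case_prod_beta' fx_def by (intro continuous_intros cw cont2 contdh)
  have slice: "continuous_on {0..1} (g x)" if "continuous_on (ball 0 r \<times> {0..1}) (\<lambda>(s, t). g s t)" "x \<in> ball 0 r"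
    for g :: "complex \<Rightarrow> real \<Rightarrow> complex" and x
  proof -
    have "continuous_on {0..1} (\<lambda>t. case (x, t) of (s, t) \<Rightarrow> g s t)"
      by (rule continuous_on_compose2[OF that(1)]) (use that in \<open>auto intro!: continuous_intros\<close>)
    then show ?thesis by simp
  qed
  have inth: "(\<lambda>t. of_real (weight b t) * h (of_real t * s)) integrable_on {0..1}"
    using slice[OF cf s] by (rule integrable_continuous_interval)
  have intfx: "fx s integrable_on {0..1}"
    using slice[OF cfx s] by (rule integrable_continuous_interval)
  have "((\<lambda>x. integral (cbox 0 1) (\<lambda>t. of_real (weight b t) * h (of_real t * x)))
      has_field_derivative integral (cbox 0 1) (fx s)) (at s within ball 0 r)"
  proof (rule leibniz_rule_field_derivative)
    fix x :: complex and t :: real assume x: "x \<in> ball 0 r" and t: "t \<in> cbox 0 1"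
    then have tx: "of_real t * x \<in> ball 0 r" using of_real_mult_in_ball[of t x r] by auto
    have "((\<lambda>x. h (of_real t * x)) has_field_derivative deriv h (of_real t * x) * of_real t) (at x)"
      by (rule DERIV_chain2[where f = h and g = "\<lambda>x. of_real t * x", OF derh[OF tx]]) (auto intro!: derivative_eq_intros)
    then have "((\<lambda>x. of_real (weight b t) * h (of_real t * x)) has_field_derivative fx x t) (at x)"
      unfolding fx_def by (auto intro!: derivative_eq_intros)
    then show "((\<lambda>x. of_real (weight b t) * h (of_real t * x)) has_field_derivative fx x t) (at x within ball 0 r)"
      by (rule has_field_derivative_at_within)
  next
    show "(\<lambda>t. of_real (weight b t) * h (of_real t * x)) integrable_on cbox 0 1" if "x \<in> ball 0 r" for x
      using slice[OF cf that] integrable_continuous_interval by auto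
  qed (use cfx s in auto)
  then have DJ: "(J has_field_derivative integral {0..1} (fx s)) (at s)"
    using s unfolding J_def by (simp add: at_within_open[OF s open_ball])
  \<comment> \<open>The interior form of the fundamental theorem is used because t^b may fail to be
    differentiable at 0. The extra factor \<open>t\<close> removes the boundary term there.\<close>
  have "((\<lambda>t. (b + 1) * (of_real (weight b t) * h (of_real t * s)) + s * fx s t) has_integral
      (of_real 1 * of_real (weight b 1) * h (of_real 1 * s) - of_real 0 * of_real (weight b 0) * h (of_real 0 * s))) {0..1}"
  proof (rule fundamental_theorem_of_calculus_interior)
    show "continuous_on {0..1} (\<lambda>t. of_real t * of_real (weight b t) * h (of_real t * s))"
      using slice[OF cf s] by (auto simp: mult.assoc intro!: continuous_intros)
    fix t :: real assume t: "t \<in> {0<..<1}"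
    have ts: "of_real t * s \<in> ball 0 r" using of_real_mult_in_ball[of t s r] s t by auto
    have "((\<lambda>t. weight b t) has_real_derivative b * t powr (b - 1)) (at t)"
    proof (cases "b = 0")
      case True
      then show ?thesis by (simp add: weight_def)
    next
      case False
      then show ?thesis unfolding weight_def using t by (auto intro!: derivative_eq_intros)
    qed
    then have dw: "((\<lambda>t. complex_of_real (weight b t)) has_vector_derivative of_real (b * t powr (b - 1))) (at t)"
      by (rule has_vector_derivative_of_real)
    have dt: "((\<lambda>t. complex_of_real t * s) has_vector_derivative s) (at t)"
      by (rule has_vector_derivative_eq_rhs, (rule derivative_intros)+) auto
    have dhs: "((\<lambda>t. h (of_real t * s)) has_vector_derivative s * deriv h (of_real t * s)) (at t)"
      using field_vector_diff_chain_at[OF dt derh[OF ts]] by (simp add: o_def)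
    have dtr: "(complex_of_real has_vector_derivative 1) (at t)"
      using has_vector_derivative_of_real[OF DERIV_ident[of "at t"]] by simp
    have "t powr (b - 1) * t = weight b t"
      using t by (simp add: weight_def powr_diff)
    then have *: "complex_of_real t * of_real (b * t powr (b - 1)) = b * of_real (weight b t)"
      by (simp flip: of_real_mult add: mult.left_commute mult.commute)
    have "((\<lambda>t. of_real t * of_real (weight b t) * h (of_real t * s)) has_vector_derivative
       (of_real t * of_real (weight b t) * (s * deriv h (of_real t * s))
         + (of_real t * of_real (b * t powr (b - 1)) + 1 * of_real (weight b t)) * h (of_real t * s))) (at t)"
      by (intro has_vector_derivative_mult dtr dw dhs)
    then show "((\<lambda>t. of_real t * of_real (weight b t) * h (of_real t * s)) has_vector_derivative
      (b + 1) * (of_real (weight b t) * h (of_real t * s)) + s * fx s t) (at t)"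
      unfolding * by (simp add: fx_def algebra_simps)
  qed auto
  then have "integral {0..1} (\<lambda>t. (b + 1) * (of_real (weight b t) * h (of_real t * s)) + s * fx s t) = h s"
    by (simp add: integral_unique)
  moreover have "integral {0..1} (\<lambda>t. (b + 1) * (of_real (weight b t) * h (of_real t * s)) + s * fx s t)
      = (b + 1) * J s + s * integral {0..1} (fx s)"
    unfolding J_def
    by (subst integral_add) (auto intro!: integrable_on_mult_right inth intfx)
  ultimately have "s * integral {0..1} (fx s) = h s - (b + 1) * J s"
    by (simp add: algebra_simps)
  with DJ show ?thesis by (intro exI[of _ "integral {0..1} (fx s)"]) simp
qed

lemma chol_uniform_limit_c3:
  fixes F :: "'a::complex_normed \<Rightarrow> c3"
  assumes Fn: "\<And>n. chol (Fn n) U" and lim: "uniform_limit U Fn F sequentially" and U: "open U"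
  shows "chol F U"
proof -
  note f = bounded_linear.uniform_limit[OF bounded_linear_fst]
  note s = bounded_linear.uniform_limit[OF bounded_linear_snd]
  have "chol (\<lambda>x. fst (F x)) U"
    by (rule chol_uniform_limit[OF chol_fst_compose[OF Fn] f[OF lim] U])
  moreover have "chol (\<lambda>x. fst (snd (F x))) U"
    by (rule chol_uniform_limit[OF chol_fst_compose[OF chol_snd_compose[OF Fn]] f[OF s[OF lim]] U])
  moreover have "chol (\<lambda>x. snd (snd (F x))) U"
    by (rule chol_uniform_limit[OF chol_snd_compose[OF chol_snd_compose[OF Fn]] s[OF s[OF lim]] U])
  ultimately have "chol (\<lambda>x. (fst (F x), fst (snd (F x)), snd (snd (F x)))) U"
    by (intro chol_Pair)
  then show ?thesis by simp
qed

section \<open>Picard iteration for the singular equation\<close>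

lemma norm_fst_le': "norm (fst p) \<le> norm p" and norm_snd_le': "norm (snd p) \<le> norm p"
  using norm_fst_le[of "fst p" "snd p"] norm_snd_le[of "snd p" "fst p"] by simp_all

lemma norm_triple_le: "norm (a, b, c) \<le> norm a + norm b + norm c"
  using norm_Pair_le[of a "(b, c)"] norm_Pair_le[of b c] by linarith

text \<open>The quasi-homogeneity clause makes the solutions for different parameters \<open>e\<close> fit together
  to a single map of \<open>s *\<^sub>C e\<close>.\<close>

theorem singular_ode_solution:
  fixes K :: "complex \<times> c3 \<times> complex \<times> complex \<Rightarrow> c3" and b1 b2 b3 :: real
  assumes K: "chol K (ball 0 r)" and r: "r > 0" and b: "b1 \<ge> 0" "b2 \<ge> 0" "b3 \<ge> 0"
  defines "hom \<equiv> \<forall>s w e c. s \<noteq> 0 \<longrightarrow> (s, c *\<^sub>C w, c *\<^sub>C e) \<in> ball 0 r \<longrightarrow> (c * s, w, e) \<in> ball 0 r \<longrightarrow>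
    K (s, c *\<^sub>C w, c *\<^sub>C e) = (c * c) *\<^sub>C K (c * s, w, e)"
  obtains \<rho> \<Omega> where "\<rho> > 0" "chol \<Omega> (ball 0 \<rho> \<times> ball 0 \<rho>)"
    "\<And>s e. s \<in> ball 0 \<rho> \<Longrightarrow> e \<in> ball 0 \<rho> \<Longrightarrow> (s, \<Omega> (s, e), e) \<in> ball 0 r"
    "\<And>e. e \<in> ball 0 \<rho> \<Longrightarrow> \<Omega> (0, e) = 0"
    "\<And>s e. s \<in> ball 0 \<rho> \<Longrightarrow> e \<in> ball 0 \<rho> \<Longrightarrow>
        \<exists>d1. ((\<lambda>s. fst (\<Omega> (s, e))) has_field_derivative d1) (at s) \<and>
           s * d1 = - of_real b1 * fst (\<Omega> (s, e)) + s * fst (K (s, \<Omega> (s, e), e))"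
    "\<And>s e. s \<in> ball 0 \<rho> \<Longrightarrow> e \<in> ball 0 \<rho> \<Longrightarrow>
        \<exists>d2. ((\<lambda>s. fst (snd (\<Omega> (s, e)))) has_field_derivative d2) (at s) \<and>
           s * d2 = - of_real b2 * fst (snd (\<Omega> (s, e))) + s * fst (snd (K (s, \<Omega> (s, e), e)))"
    "\<And>s e. s \<in> ball 0 \<rho> \<Longrightarrow> e \<in> ball 0 \<rho> \<Longrightarrow>
        \<exists>d3. ((\<lambda>s. snd (snd (\<Omega> (s, e)))) has_field_derivative d3) (at s) \<and>
           s * d3 = - of_real b3 * snd (snd (\<Omega> (s, e))) + s * snd (snd (K (s, \<Omega> (s, e), e)))"
    "\<And>s e c. hom \<Longrightarrow> s \<in> ball 0 \<rho> \<Longrightarrow> c * s \<in> ball 0 \<rho> \<Longrightarrow> e \<in> ball 0 \<rho> \<Longrightarrow> c *\<^sub>C e \<in> ball 0 \<rho> \<Longrightarrow>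
        \<Omega> (s, c *\<^sub>C e) = c *\<^sub>C \<Omega> (c * s, e)"
proof -
  obtain r' L where r': "r' > 0" "ball 0 r' \<subseteq> ball (0 :: complex \<times> c3 \<times> complex \<times> complex) r"
      and L: "L-lipschitz_on (ball 0 r') K"
    using chol_locally_lipschitz_c3[OF K, of 0] r by auto
  have L0: "L \<ge> 0" using L by (rule lipschitz_on_nonneg)
  define M where "M = norm (K 0) + L * r'"
  have M0: "M \<ge> 0" using L0 r' by (simp add: M_def)
  have KM: "norm (K x) \<le> M" if "x \<in> ball 0 r'" for x
  proof -
    have "norm (K x - K 0) \<le> L * norm (x - 0)"
      using r' that by (intro lipschitz_on_normD[OF L]) auto
    also have "\<dots> \<le> L * r'" using that L0 by (intro mult_left_mono) auto
    finally show ?thesis using norm_triangle_sub[of "K x" "K 0"] by (simp add: M_def)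
  qed
  \<comment> \<open>Three blocks of norm at most \<open>\<delta>\<close> fit into the ball of radius
    \<open>r'\<close>. In \<open>\<rho>\<close>, the bound by \<open>\<delta>\<close> keeps
    arguments in that ball, the second term makes \<open>T\<close> preserve the bound
    \<open>\<delta>\<close>, and the third makes \<open>T\<close> halve distances. The threes there
    count the components of the unknown.\<close>
  define \<delta> where "\<delta> = r' / 3"
  define \<rho> where "\<rho> = min \<delta> (min (\<delta> / (3 * (M + 1))) (1 / (6 * (L + 1))))"
  have \<delta>: "\<delta> > 0" using r' by (simp add: \<delta>_def)
  have \<rho>: "\<rho> > 0" using \<delta> M0 L0 by (simp add: \<rho>_def)
  have \<rho>\<delta>: "\<rho> \<le> \<delta>" by (simp add: \<rho>_def)
  have "\<rho> * (3 * (M + 1)) \<le> \<delta>"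
    using M0 by (simp add: \<rho>_def pos_le_divide_eq[symmetric])
  then have \<rho>M: "3 * (\<rho> * M) \<le> \<delta>" using \<rho> by (simp add: algebra_simps)
  have "\<rho> * (6 * (L + 1)) \<le> 1"
    using L0 by (simp add: \<rho>_def pos_le_divide_eq[symmetric])
  then have \<rho>L: "3 * (\<rho> * L) \<le> 1 / 2" using \<rho> by (simp add: algebra_simps)
  define D where "D = ball (0::complex) \<rho> \<times> ball (0 :: complex \<times> complex) \<rho>"
  have D: "open D" unfolding D_def by (intro open_Times open_ball)
  have inb: "(s, w, e) \<in> ball 0 r'" if "(s, e) \<in> D" "norm w \<le> \<delta>" for s e and w :: c3
    using norm_triple_le[of s w e] that \<rho>\<delta> by (auto simp: D_def \<delta>_def)
  define \<kappa> where "\<kappa> = (\<lambda>V (p :: complex \<times> complex \<times> complex). K (fst p, V p, snd p))"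
  define T where "T = (\<lambda>V (p :: complex \<times> complex \<times> complex).
     (fst p * weighted_mean b1 (\<lambda>q. fst (\<kappa> V q)) p,
      fst p * weighted_mean b2 (\<lambda>q. fst (snd (\<kappa> V q))) p,
      fst p * weighted_mean b3 (\<lambda>q. snd (snd (\<kappa> V q))) p))"
  \<comment> \<open>Quasi-homogeneity is put into the invariant class: it is preserved by
    \<open>T\<close> and by limits, so the fixed point inherits it without an appeal to uniqueness
    of solutions.\<close>
  define P where "P = (\<lambda>V :: complex \<times> complex \<times> complex \<Rightarrow> c3. chol V D \<and> (\<forall>p\<in>D. norm (V p) \<le> \<delta>) \<and>
    (hom \<longrightarrow> (\<forall>s e c. s \<in> ball 0 \<rho> \<longrightarrow> c * s \<in> ball 0 \<rho> \<longrightarrow> e \<in> ball 0 \<rho> \<longrightarrow> c *\<^sub>C e \<in> ball 0 \<rho> \<longrightarrow>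
        V (s, c *\<^sub>C e) = c *\<^sub>C V (c * s, e))))"
  have PD: "norm (V p) \<le> \<delta>" if "P V" "p \<in> D" for V p using that by (auto simp: P_def)
  have \<kappa>hol: "chol (\<kappa> V) D" if "P V" for V
    unfolding \<kappa>_def
  proof (rule chol_compose[OF chol_subset[OF K r'(2)]])
    show "chol (\<lambda>p. (fst p, V p, snd p)) D"
      using that by (intro chol_Pair chol_fst chol_snd D) (auto simp: P_def)
    show "(\<lambda>p. (fst p, V p, snd p)) ` D \<subseteq> ball 0 r'"
      using PD[OF that] inb[of "fst p" "snd p" for p] by (intro image_subsetI) simp
  qed auto
  note \<kappa>1 = chol_fst_compose[OF \<kappa>hol] and \<kappa>2 = chol_fst_compose[OF chol_snd_compose[OF \<kappa>hol]]
    and \<kappa>3 = chol_snd_compose[OF chol_snd_compose[OF \<kappa>hol]]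
  have n1: "norm (fst x) \<le> norm x" and n2: "norm (fst (snd x)) \<le> norm x" and n3: "norm (snd (snd x)) \<le> norm x"
    for x :: c3
    using norm_fst_le'[of x] norm_snd_le'[of x] norm_fst_le'[of "snd x"] norm_snd_le'[of "snd x"] by linarith+
  have Tdiff: "norm (T u p - T v p) \<le> 3 * (\<rho> * C)"
    if "P u" "P v" "p \<in> D" and C: "\<And>q. q \<in> D \<Longrightarrow> norm (\<kappa> u q - \<kappa> v q) \<le> C" for u v p C
  proof -
    have le: "norm (weighted_mean b (\<lambda>q. \<pi> (\<kappa> u q)) p - weighted_mean b (\<lambda>q. \<pi> (\<kappa> v q)) p) \<le> C"
      if "b \<ge> 0" "chol (\<lambda>q. \<pi> (\<kappa> u q)) D" "chol (\<lambda>q. \<pi> (\<kappa> v q)) D"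
        "\<And>x y. norm (\<pi> x - \<pi> y) \<le> norm (x - y)" for b and \<pi> :: "c3 \<Rightarrow> complex"
    proof (rule norm_weighted_mean_diff_le[where r = \<rho> and E = "ball 0 \<rho>"])
      show "norm (\<pi> (\<kappa> u q) - \<pi> (\<kappa> v q)) \<le> C" if "q \<in> ball 0 \<rho> \<times> ball 0 \<rho>" for q
        using order_trans[OF \<open>\<And>x y. norm (\<pi> x - \<pi> y) \<le> norm (x - y)\<close> C] that by (simp add: D_def)
    qed (use that \<open>p \<in> D\<close> in \<open>auto simp: D_def chol_imp_continuous_on\<close>)
    note le = le[OF b(1) \<kappa>1[OF that(1)] \<kappa>1[OF that(2)]] le[OF b(2) \<kappa>2[OF that(1)] \<kappa>2[OF that(2)]]
      le[OF b(3) \<kappa>3[OF that(1)] \<kappa>3[OF that(2)]]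
    have le: "norm (weighted_mean b1 (\<lambda>q. fst (\<kappa> u q)) p - weighted_mean b1 (\<lambda>q. fst (\<kappa> v q)) p) \<le> C"
        "norm (weighted_mean b2 (\<lambda>q. fst (snd (\<kappa> u q))) p - weighted_mean b2 (\<lambda>q. fst (snd (\<kappa> v q))) p) \<le> C"
        "norm (weighted_mean b3 (\<lambda>q. snd (snd (\<kappa> u q))) p - weighted_mean b3 (\<lambda>q. snd (snd (\<kappa> v q))) p) \<le> C"
      by (rule le, metis n1 n2 n3 fst_diff snd_diff)+
    have C0: "C \<ge> 0" using le(1) norm_ge_zero order_trans by blast
    have fp: "norm (fst p) \<le> \<rho>" using that by (auto simp: D_def)
    have "norm (T u p - T v p) \<le>
        norm (fst p) * norm (weighted_mean b1 (\<lambda>q. fst (\<kappa> u q)) p - weighted_mean b1 (\<lambda>q. fst (\<kappa> v q)) p)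
      + norm (fst p) * norm (weighted_mean b2 (\<lambda>q. fst (snd (\<kappa> u q))) p - weighted_mean b2 (\<lambda>q. fst (snd (\<kappa> v q))) p)
      + norm (fst p) * norm (weighted_mean b3 (\<lambda>q. snd (snd (\<kappa> u q))) p - weighted_mean b3 (\<lambda>q. snd (snd (\<kappa> v q))) p)"
      unfolding T_def diff_Pair norm_mult[symmetric] right_diff_distrib by (rule norm_triple_le)
    also have "\<dots> \<le> \<rho> * C + \<rho> * C + \<rho> * C"
      using le fp C0 \<rho> by (intro add_mono mult_mono) auto
    finally show ?thesis by linarith
  qed
  have Tnorm: "norm (T u p) \<le> \<delta>" if "P u" "p \<in> D" for u p
  proof -
    have bd: "norm (weighted_mean b k p) \<le> M"
      if "b \<ge> 0" "chol k D" "\<And>q. q \<in> D \<Longrightarrow> norm (k q) \<le> M" for b and k :: "complex \<times> complex \<times> complex \<Rightarrow> complex"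
    proof -
      have "norm (weighted_mean b k p - weighted_mean b (\<lambda>_. 0) p) \<le> M"
        by (rule norm_weighted_mean_diff_le[where r = \<rho> and E = "ball 0 \<rho>"])
           (use that \<open>p \<in> D\<close> in \<open>auto simp: D_def chol_imp_continuous_on\<close>)
      then show ?thesis by (simp add: weighted_mean_def)
    qed
    have \<kappa>M: "norm (\<kappa> u q) \<le> M" if "q \<in> D" for q
      unfolding \<kappa>_def using inb[of "fst q" "snd q" "u q"] PD[OF \<open>P u\<close> that] that by (intro KM) auto
    have fp: "norm (fst p) \<le> \<rho>" using that by (auto simp: D_def)
    have "norm (T u p) \<le> norm (fst p) * norm (weighted_mean b1 (\<lambda>q. fst (\<kappa> u q)) p)
      + norm (fst p) * norm (weighted_mean b2 (\<lambda>q. fst (snd (\<kappa> u q))) p)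
      + norm (fst p) * norm (weighted_mean b3 (\<lambda>q. snd (snd (\<kappa> u q))) p)"
      unfolding T_def norm_mult[symmetric] by (rule norm_triple_le)
    also have "\<dots> \<le> \<rho> * M + \<rho> * M + \<rho> * M"
      using fp M0 \<rho> b \<kappa>1[OF that(1)] \<kappa>2[OF that(1)] \<kappa>3[OF that(1)]
        order_trans[OF n1 \<kappa>M] order_trans[OF n2 \<kappa>M] order_trans[OF n3 \<kappa>M]
      by (intro add_mono mult_mono bd) auto
    finally show ?thesis using \<rho>M by linarith
  qed
  have Thom: "T V (s, c *\<^sub>C e) = c *\<^sub>C T V (c * s, e)"
    if V: "P V" and hom: hom and se: "s \<in> ball 0 \<rho>" "c * s \<in> ball 0 \<rho>" "e \<in> ball 0 \<rho>" "c *\<^sub>C e \<in> ball 0 \<rho>" for V s c e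
  proof (cases "s = 0")
    case True
    then show ?thesis by (simp add: T_def)
  next
    case False
    have kk: "\<kappa> V (of_real t * s, c *\<^sub>C e) = (c * c) *\<^sub>C \<kappa> V (of_real t * (c * s), e)" if t: "t \<in> {0..1} - {0}" for t :: real
    proof -
      have ts: "of_real t * s \<in> ball 0 \<rho>" "c * (of_real t * s) \<in> ball 0 \<rho>"
        using of_real_mult_in_ball[of t s \<rho>] of_real_mult_in_ball[of t "c * s" \<rho>] t se
        by (auto simp: mult.left_commute)
      have Vc: "V (of_real t * s, c *\<^sub>C e) = c *\<^sub>C V (c * (of_real t * s), e)"
        using V hom ts se unfolding P_def by blast
      have DD: "(of_real t * s, c *\<^sub>C e) \<in> D" "(c * (of_real t * s), e) \<in> D"
        using ts se by (auto simp: D_def)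
      have "K (of_real t * s, c *\<^sub>C V (c * (of_real t * s), e), c *\<^sub>C e)
          = (c * c) *\<^sub>C K (c * (of_real t * s), V (c * (of_real t * s), e), e)"
      proof (rule hom[unfolded hom_def, rule_format])
        show "of_real t * s \<noteq> 0" using False t by simp
        show "(of_real t * s, c *\<^sub>C V (c * (of_real t * s), e), c *\<^sub>C e) \<in> ball 0 r"
          using inb[OF DD(1) PD[OF V DD(1)]] r'(2) unfolding Vc by blast
        show "(c * (of_real t * s), V (c * (of_real t * s), e), e) \<in> ball 0 r"
          using inb[OF DD(2) PD[OF V DD(2)]] r'(2) by blast
      qed
      then show ?thesis by (simp add: \<kappa>_def Vc mult.left_commute)
    qed
    have wm: "s * weighted_mean b (\<lambda>q. \<pi> (\<kappa> V q)) (s, c *\<^sub>C e) = c * (c * s * weighted_mean b (\<lambda>q. \<pi> (\<kappa> V q)) (c * s, e))"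
      if "\<And>x. \<pi> ((c * c) *\<^sub>C x) = (c * c) * \<pi> x" for \<pi> :: "c3 \<Rightarrow> complex" and b
    proof -
      \<comment> \<open>The homogeneity of \<open>K\<close> is available for nonzero first argument
        only; the parameter value \<open>t = 0\<close> is discarded as a null set.\<close>
      have "weighted_mean b (\<lambda>q. \<pi> (\<kappa> V q)) (s, c *\<^sub>C e)
          = integral {0..1} (\<lambda>t. (c * c) * (of_real (weight b t) * \<pi> (\<kappa> V (of_real t * (c * s), e))))"
        unfolding weighted_mean_def
        by (rule integral_spike[where S = "{0}"]) (use kk that in \<open>auto simp: algebra_simps\<close>)
      then show ?thesis by (simp add: weighted_mean_def)
    qed
    show ?thesis
      unfolding T_def using wm[of fst b1] wm[of "\<lambda>x. fst (snd x)" b2] wm[of "\<lambda>x. snd (snd x)" b3] by simp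
  qed
  have PT: "P (T V)" if "P V" for V
    unfolding P_def
  proof (intro conjI)
    show "chol (T V) D"
      unfolding T_def
      by (intro chol_Pair chol_mult chol_fst D; unfold D_def; intro chol_weighted_mean open_ball b; fold D_def)
         (intro \<kappa>1 \<kappa>2 \<kappa>3 that)+
  qed (use Tnorm[OF that] Thom[OF that] in blast)+
  have "\<exists>V. P V \<and> (\<forall>x\<in>D. T V x = V x)"
  proof (rule uniform_fixed_point[where ?v0.0 = "\<lambda>_. 0" and B = \<delta>])
    show "P (\<lambda>_. 0)" unfolding P_def using \<delta> D by (auto intro: chol_const)
    show "norm (T u x - T v x) \<le> c / 2"
      if uv: "P u" "P v" and le: "\<And>x. x \<in> D \<Longrightarrow> norm (u x - v x) \<le> c" and x: "x \<in> D" for u v c x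
    proof -
      have "norm (T u x - T v x) \<le> 3 * (\<rho> * (L * c))"
      proof (rule Tdiff[OF uv x])
        fix q assume q: "q \<in> D"
        have "norm (\<kappa> u q - \<kappa> v q) \<le> L * norm ((fst q, u q, snd q) - (fst q, v q, snd q))"
          unfolding \<kappa>_def using inb[of "fst q" "snd q"] q PD[OF uv(1) q] PD[OF uv(2) q]
          by (intro lipschitz_on_normD[OF L]) auto
        also have "norm ((fst q, u q, snd q) - (fst q, v q, snd q)) = norm (u q - v q)"
          by (simp add: norm_Pair)
        also have "L * \<dots> \<le> L * c" using le[OF q] L0 by (rule mult_left_mono)
        finally show "norm (\<kappa> u q - \<kappa> v q) \<le> L * c" .
      qed
      also have "\<dots> = (3 * (\<rho> * L)) * c" by simp
      also have "\<dots> \<le> 1/2 * c"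
        using \<rho>L order_trans[OF norm_ge_zero le[OF x]] by (rule mult_right_mono)
      finally show ?thesis by simp
    qed
    show "P l" if u: "\<And>n. P (u n)" and lim: "uniform_limit D u l sequentially" for u l
      unfolding P_def
    proof (intro conjI)
      have "chol (u n) D" for n using u unfolding P_def by blast
      then show "chol l D" by (rule chol_uniform_limit_c3[OF _ lim D])
      have lt: "(\<lambda>n. u n p) \<longlonglongrightarrow> l p" if "p \<in> D" for p
        using tendsto_uniform_limitI[OF lim that] .
      show "\<forall>p\<in>D. norm (l p) \<le> \<delta>"
      proof
        fix p assume p: "p \<in> D"
        show "norm (l p) \<le> \<delta>"
          by (rule Lim_bounded[OF tendsto_norm[OF lt[OF p]]]) (simp add: PD[OF u p])
      qed
      show "hom \<longrightarrow> (\<forall>s e c. s \<in> ball 0 \<rho> \<longrightarrow> c * s \<in> ball 0 \<rho> \<longrightarrow> e \<in> ball 0 \<rho> \<longrightarrow> c *\<^sub>C e \<in> ball 0 \<rho> \<longrightarrow>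
        l (s, c *\<^sub>C e) = c *\<^sub>C l (c * s, e))"
      proof (intro impI allI)
        fix s c :: complex and e :: "complex \<times> complex" assume hom and se: "s \<in> ball 0 \<rho>" "c * s \<in> ball 0 \<rho>" "e \<in> ball 0 \<rho>" "c *\<^sub>C e \<in> ball 0 \<rho>"
        have "u n (s, c *\<^sub>C e) = c *\<^sub>C u n (c * s, e)" for n
          using u[of n] \<open>hom\<close> se unfolding P_def by blast
        moreover have "(\<lambda>n. c *\<^sub>C u n (c * s, e)) \<longlonglongrightarrow> c *\<^sub>C l (c * s, e)"
          using se by (intro tendsto_intros lt) (auto simp: D_def)
        moreover have "(\<lambda>n. u n (s, c *\<^sub>C e)) \<longlonglongrightarrow> l (s, c *\<^sub>C e)"
          using se by (intro lt) (auto simp: D_def)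
        ultimately show "l (s, c *\<^sub>C e) = c *\<^sub>C l (c * s, e)"
          by (simp add: LIMSEQ_unique)
      qed
    qed
  qed (use PT PD in auto)
  then obtain V where V: "P V" "\<And>x. x \<in> D \<Longrightarrow> T V x = V x" by blast
  have ode: "\<exists>d. ((\<lambda>s. \<pi> (V (s, e))) has_field_derivative d) (at s) \<and>
      s * d = - of_real b * \<pi> (V (s, e)) + s * \<pi> (K (s, V (s, e), e))"
    if s: "s \<in> ball 0 \<rho>" and e: "e \<in> ball 0 \<rho>" and b: "b \<ge> 0" and hol: "chol (\<lambda>q. \<pi> (\<kappa> V q)) D"
      and TV: "\<And>p. \<pi> (T V p) = fst p * weighted_mean b (\<lambda>q. \<pi> (\<kappa> V q)) p" for s e b and \<pi> :: "c3 \<Rightarrow> complex"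
  proof -
    define h where "h = (\<lambda>s. \<pi> (\<kappa> V (s, e)))"
    have "chol h (ball 0 \<rho>)" unfolding h_def
      by (rule chol_compose[OF hol]) (use e in \<open>auto intro!: chol_Pair chol_const chol_id simp: D_def\<close>)
    then have "h holomorphic_on ball 0 \<rho>" by (simp add: chol_iff_holomorphic)
    define J where "J = (\<lambda>s. integral {0..1} (\<lambda>t. of_real (weight b t) * h (of_real t * s)))"
    obtain J' where J': "(J has_field_derivative J') (at s)" "s * J' = h s - (of_real b + 1) * J s"
      using weighted_mean_ode[OF \<open>h holomorphic_on ball 0 \<rho>\<close> b s] unfolding J_def by (elim exE conjE)
    have eq: "\<pi> (V (x, e)) = x * J x" if "x \<in> ball 0 \<rho>" for x
      using V(2)[of "(x, e)"] TV[of "(x, e)"] that e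
      by (simp add: D_def J_def h_def weighted_mean_def)
    have "((\<lambda>x. x * J x) has_field_derivative (1 * J s + J' * s)) (at s)"
      by (intro DERIV_mult DERIV_ident J'(1))
    then have "((\<lambda>x. \<pi> (V (x, e))) has_field_derivative (1 * J s + J' * s)) (at s)"
      by (rule has_field_derivative_transform_within_open[OF _ open_ball s]) (use eq in auto)
    \<comment> \<open>The product rule contributes one more \<open>J s\<close>, which lowers the
      coefficient \<open>b + 1\<close> of the equation for \<open>J\<close> to
      \<open>b\<close>.\<close>
    moreover have "s * (1 * J s + J' * s) = - of_real b * \<pi> (V (s, e)) + s * \<pi> (K (s, V (s, e), e))"
    proof -
      have "s * (1 * J s + J' * s) = s * (J s + s * J')" by simp
      also have "\<dots> = s * (J s + (h s - (of_real b + 1) * J s))" by (simp only: J'(2))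
      also have "\<dots> = - of_real b * (s * J s) + s * h s" by (simp add: algebra_simps)
      finally show ?thesis by (simp add: eq[OF s] h_def \<kappa>_def)
    qed
    ultimately show ?thesis by blast
  qed
  show thesis
  proof (rule that[OF \<rho>])
    show "chol V (ball 0 \<rho> \<times> ball 0 \<rho>)" using V(1) unfolding P_def D_def by blast
    show "(s, V (s, e), e) \<in> ball 0 r" if "s \<in> ball 0 \<rho>" "e \<in> ball 0 \<rho>" for s e
    proof -
      have "(s, e) \<in> D" using that by (auto simp: D_def)
      then show ?thesis using inb PD[OF V(1)] r'(2) by blast
    qed
    show "V (0, e) = 0" if "e \<in> ball 0 \<rho>" for e
    proof -
      have "(0, e) \<in> D" using that \<rho> by (auto simp: D_def)
      from V(2)[OF this] show ?thesis by (simp add: T_def zero_prod_def)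
    qed
    show "V (s, c *\<^sub>C e) = c *\<^sub>C V (c * s, e)"
      if hom "s \<in> ball 0 \<rho>" "c * s \<in> ball 0 \<rho>" "e \<in> ball 0 \<rho>" "c *\<^sub>C e \<in> ball 0 \<rho>" for s e c
      using V(1) that unfolding P_def by blast
  qed (rule ode; use \<kappa>1[OF V(1)] \<kappa>2[OF V(1)] \<kappa>3[OF V(1)] b in \<open>simp add: T_def\<close>)+
qed

section \<open>Trajectories\<close>

text \<open>Division by \<open>s\<close> twice. The first quotient at \<open>s = 0\<close> is the
  derivative of \<open>f\<close> at the origin in direction \<open>p\<close>, which vanishes, so it
  can be divided again. The radius 4 leaves room for the points \<open>(0, e) + w\<close> and
  \<open>(1, u, v)\<close> at which \<open>k\<close> is evaluated later.\<close>

lemma hol_order2_blowup: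
  assumes f: "hol_order2 f"
  shows "\<exists>\<rho>>0. \<exists>k. chol k (ball 0 \<rho> \<times> ball 0 4) \<and>
     (\<forall>s\<in>ball 0 \<rho>. \<forall>p\<in>ball 0 4. f (s *\<^sub>C p) = s * s * k (s, p))"
proof -
  obtain R where R: "R > 0" "holo3 f (ball 0 R)" and f0: "f 0 = 0" "(f has_derivative (\<lambda>_. 0)) (at 0)"
    using f unfolding hol_order2_def by blast
  have cf: "chol f (ball 0 R)"
    using R(2) unfolding holo3_def chol_def by (auto simp: split_paired_all)
  define H where "H = (\<lambda>q::complex \<times> c3. f (fst q *\<^sub>C snd q))"
  have op: "open (ball (0::complex) (R/4) \<times> ball (0::c3) 4)" by (intro open_Times open_ball)
  have "chol H (ball 0 (R/4) \<times> ball 0 4)"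
    unfolding H_def
  proof (rule chol_compose[OF cf])
    show "chol (\<lambda>q::complex \<times> c3. fst q *\<^sub>C snd q) (ball 0 (R/4) \<times> ball 0 4)"
      by (intro chol_cscale chol_fst chol_snd op)
    show "(\<lambda>q::complex \<times> c3. fst q *\<^sub>C snd q) ` (ball 0 (R/4) \<times> ball 0 4) \<subseteq> ball 0 R"
    proof (rule image_subsetI)
      fix q :: "complex \<times> c3" assume q: "q \<in> ball 0 (R/4) \<times> ball 0 4"
      then have "cmod (fst q) * norm (snd q) < (R/4) * 4"
        using R(1) by (intro mult_strict_mono) auto
      then show "fst q *\<^sub>C snd q \<in> ball 0 R" by (simp add: norm_cscale)
    qed
  qed
  moreover have "R / 4 > 0" "H (0, w) = 0" for w using R(1) f0 by (simp_all add: H_def)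
  ultimately obtain Q where Q: "chol Q (ball 0 (R/4/2) \<times> ball 0 4)"
    and HQ: "\<And>x w. x \<in> ball 0 (R/4/2) \<Longrightarrow> w \<in> ball 0 4 \<Longrightarrow> H (x, w) = x * Q (x, w)"
    using chol_divide_by_coordinate[of H "R/4" "ball 0 4"] open_ball by metis
  have Q0: "Q (0, p) = 0" if p: "p \<in> ball 0 4" for p
  proof -
    have "((\<lambda>t. f (0 + t *\<^sub>C p)) has_field_derivative 0) (at 0)"
      by (rule chol_line[where D = "\<lambda>_. 0"]) (use f0 in auto)
    then have "((\<lambda>t. t * Q (t, p)) has_field_derivative 0) (at 0)"
      by (rule has_field_derivative_transform_within_open[OF _ open_ball[of 0 "R/4/2"]])
         (use HQ p R(1) in \<open>auto simp: H_def\<close>)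
    moreover have "(\<lambda>t. Q (t, p)) holomorphic_on ball 0 (R/4/2)"
    proof -
      have "chol (\<lambda>t. Q (t, p)) (ball 0 (R/4/2))"
        by (rule chol_compose[OF Q]) (use p in \<open>auto intro!: chol_Pair chol_const chol_id\<close>)
      then show ?thesis by (simp add: chol_iff_holomorphic)
    qed
    then have "((\<lambda>t. Q (t, p)) has_field_derivative deriv (\<lambda>t. Q (t, p)) 0) (at 0)"
      using R(1) by (intro holomorphic_derivI[where S = "ball 0 (R/4/2)"]) auto
    then have "((\<lambda>t. t * Q (t, p)) has_field_derivative (1 * Q (0, p) + deriv (\<lambda>t. Q (t, p)) 0 * 0)) (at 0)"
      by (intro DERIV_mult DERIV_ident)
    ultimately show ?thesis using DERIV_unique by fastforce
  qed
  have "R/4/2 > 0" using R(1) by simp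
  from chol_divide_by_coordinate[OF Q this open_ball Q0] obtain k where k: "chol k (ball 0 (R/4/2/2) \<times> ball 0 4)"
    and Qk: "\<And>x w. x \<in> ball 0 (R/4/2/2) \<Longrightarrow> w \<in> ball 0 4 \<Longrightarrow> Q (x, w) = x * k (x, w)"
    by blast
  have "f (s *\<^sub>C p) = s * s * k (s, p)" if "s \<in> ball 0 (R/4/2/2)" "p \<in> ball 0 4" for s p
    using HQ[of s p] Qk[OF that] that R(1) by (auto simp: H_def)
  with k R(1) show ?thesis by (intro exI[of _ "R/4/2/2"]) auto
qed

text \<open>The set of times at which the solutions agree is closed by continuity. It is open
  because near such a time the second solution is also in the ball, and Gronwall's inequality
  applies to the squared distance. Hence it is the whole line.\<close>

lemma ode_solution_unique:
  fixes \<gamma>1 \<gamma>2 :: "real \<Rightarrow> 'a::real_inner"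
  assumes L: "L-lipschitz_on (ball 0 R) X"
    and g1: "\<And>t. (\<gamma>1 has_vector_derivative X (\<gamma>1 t)) (at t)" and in1: "\<And>t. \<gamma>1 t \<in> ball 0 R"
    and g2: "\<And>t. (\<gamma>2 has_vector_derivative X (\<gamma>2 t)) (at t)" and init: "\<gamma>1 0 = \<gamma>2 0"
  shows "\<gamma>1 = \<gamma>2"
proof -
  define n where "n = (\<lambda>t. (\<gamma>1 t - \<gamma>2 t) \<bullet> (\<gamma>1 t - \<gamma>2 t))"
  define n' where "n' = (\<lambda>t. 2 * ((\<gamma>1 t - \<gamma>2 t) \<bullet> (X (\<gamma>1 t) - X (\<gamma>2 t))))"
  have dn: "(n has_real_derivative n' t) (at t)" for t
  proof -
    have d: "((\<lambda>t. \<gamma>1 t - \<gamma>2 t) has_derivative (\<lambda>h. h *\<^sub>R (X (\<gamma>1 t) - X (\<gamma>2 t)))) (at t)"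
      using has_vector_derivative_diff[OF g1 g2] by (simp add: has_vector_derivative_def)
    have "(n has_derivative (\<lambda>h. (\<gamma>1 t - \<gamma>2 t) \<bullet> (h *\<^sub>R (X (\<gamma>1 t) - X (\<gamma>2 t)))
        + (h *\<^sub>R (X (\<gamma>1 t) - X (\<gamma>2 t))) \<bullet> (\<gamma>1 t - \<gamma>2 t))) (at t)"
      unfolding n_def by (rule has_derivative_inner[OF d d])
    then show ?thesis
      unfolding has_field_derivative_def n'_def
      by (rule has_derivative_eq_rhs) (auto simp: fun_eq_iff inner_commute algebra_simps)
  qed
  have bd: "\<bar>n' t\<bar> \<le> 2 * L * n t" if "\<gamma>2 t \<in> ball 0 R" for t
  proof -
    have "\<bar>(\<gamma>1 t - \<gamma>2 t) \<bullet> (X (\<gamma>1 t) - X (\<gamma>2 t))\<bar> \<le> norm (\<gamma>1 t - \<gamma>2 t) * norm (X (\<gamma>1 t) - X (\<gamma>2 t))"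
      by (rule Cauchy_Schwarz_ineq2)
    also have "\<dots> \<le> norm (\<gamma>1 t - \<gamma>2 t) * (L * norm (\<gamma>1 t - \<gamma>2 t))"
      using lipschitz_on_normD[OF L in1 that] by (intro mult_left_mono) auto
    finally show ?thesis
      by (simp add: n'_def n_def abs_mult dot_square_norm power2_eq_square algebra_simps)
  qed
  have cont1: "continuous_on UNIV \<gamma>1" and cont2: "continuous_on UNIV \<gamma>2"
    using g1 g2 by (auto intro!: continuous_at_imp_continuous_on has_vector_derivative_continuous)
  define A where "A = {t. \<gamma>1 t = \<gamma>2 t}"
  have "closed A" unfolding A_def by (intro closed_Collect_eq cont1 cont2)
  moreover have "open A"
    unfolding open_dist
  proof
    fix t0 assume "t0 \<in> A"
    then have n0: "n t0 = 0" by (simp add: A_def n_def)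
    have "\<gamma>2 t0 \<in> ball 0 R" using in1[of t0] \<open>t0 \<in> A\<close> by (simp add: A_def)
    moreover have "open (\<gamma>2 -` ball 0 R)"
      by (rule open_vimage[OF open_ball cont2])
    ultimately obtain e where e: "e > 0" "\<And>t. dist t t0 < e \<Longrightarrow> \<gamma>2 t \<in> ball 0 R"
      unfolding open_dist by (metis vimageE vimageI)
    have "n t \<le> 0" if t: "dist t t0 < e" for t
    proof (cases "t \<ge> t0")
      case True
      \<comment> \<open>The Gronwall factor turns the bound on \<open>n'\<close> by
        \<open>2 * L * n\<close> into monotonicity; for times before \<open>t0\<close> the exponent
        changes sign.\<close>
      define F where "F = (\<lambda>t. exp (- 2 * L * (t - t0)) * n t)"
      have "F t \<le> F t0"
      proof (rule DERIV_nonpos_imp_nonincreasing[where f = F, OF True])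
        fix x assume x: "t0 \<le> x" "x \<le> t"
        have "\<gamma>2 x \<in> ball 0 R" using x t by (intro e) (auto simp: dist_real_def)
        then have "n' x - 2 * L * n x \<le> 0" using bd[of x] by linarith
        then have "exp (- 2 * L * (x - t0)) * (n' x - 2 * L * n x) \<le> 0"
          by (simp add: mult_nonneg_nonpos)
        moreover have "(F has_real_derivative exp (- 2 * L * (x - t0)) * (n' x - 2 * L * n x)) (at x)"
          unfolding F_def by (auto intro!: derivative_eq_intros dn simp: algebra_simps)
        ultimately show "\<exists>y. DERIV F x :> y \<and> y \<le> 0" by blast
      qed
      then show ?thesis by (simp add: F_def n0 mult_le_0_iff)
    next
      case False
      define F where "F = (\<lambda>t. exp (2 * L * (t - t0)) * n t)"
      have "F t \<le> F t0"
      proof (rule DERIV_nonneg_imp_nondecreasing[where f = F])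
        show "t \<le> t0" using False by simp
        fix x assume x: "t \<le> x" "x \<le> t0"
        have "\<gamma>2 x \<in> ball 0 R" using x t by (intro e) (auto simp: dist_real_def)
        then have "n' x + 2 * L * n x \<ge> 0" using bd[of x] by linarith
        then have "exp (2 * L * (x - t0)) * (n' x + 2 * L * n x) \<ge> 0"
          by simp
        moreover have "(F has_real_derivative exp (2 * L * (x - t0)) * (n' x + 2 * L * n x)) (at x)"
          unfolding F_def by (auto intro!: derivative_eq_intros dn simp: algebra_simps)
        ultimately show "\<exists>y. DERIV F x :> y \<and> y \<ge> 0" by blast
      qed
      then show ?thesis by (simp add: F_def n0 mult_le_0_iff)
    qed
    then have "t \<in> A" if "dist t t0 < e" for t
    proof -
      have "n t = 0"
        using \<open>\<And>t. dist t t0 < e \<Longrightarrow> n t \<le> 0\<close>[OF that] inner_ge_zero[of "\<gamma>1 t - \<gamma>2 t"] unfolding n_def by linarith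
      then show ?thesis by (simp add: n_def A_def)
    qed
    with e show "\<exists>e>0. \<forall>y. dist y t0 < e \<longrightarrow> y \<in> A" by blast
  qed
  ultimately have "A = {} \<or> A = UNIV" by (simp add: clopen[symmetric])
  with init show ?thesis by (auto simp: A_def)
qed

text \<open>The derivative condition says that \<open>\<Phi>\<close> carries the rotation exp(i w t)
  q to a solution. Rotations preserve the ball, so this solution exists for all time and stays where
  the field is Lipschitz. Injectivity of \<open>\<Phi>\<close> excludes a smaller period, and
  uniqueness extends the claim to every solution through the point.\<close>

lemma periodic_traj_of_linear_flow:
  fixes \<Phi> :: "'a::complex_normed \<Rightarrow> c3" and w :: real
  assumes D: "\<And>q. q \<in> ball 0 r \<Longrightarrow> \<exists>D. (\<Phi> has_derivative D) (at q) \<and> D ((\<i> * of_real w) *\<^sub>C q) = X (\<Phi> q)"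
    and inj: "inj_on \<Phi> (ball 0 r)" and im: "\<And>q. q \<in> ball 0 r \<Longrightarrow> \<Phi> q \<in> ball 0 R"
    and L: "L-lipschitz_on (ball 0 R) X" and w: "w \<noteq> 0" and q: "q \<in> ball 0 r" "q \<noteq> 0"
  shows "periodic_traj X (\<Phi> q) (2 * pi / \<bar>w\<bar>)"
proof -
  define \<epsilon> where "\<epsilon> = (\<lambda>t::real. exp (\<i> * of_real w * of_real t))"
  define \<gamma> where "\<gamma> = (\<lambda>t. \<Phi> (\<epsilon> t *\<^sub>C q))"
  have n\<epsilon>: "cmod (\<epsilon> t) = 1" for t
  proof -
    have "\<epsilon> t = exp (\<i> * of_real (w * t))" by (simp add: \<epsilon>_def mult.assoc)
    then show ?thesis by (simp only: norm_exp_i_times)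
  qed
  have inb: "\<epsilon> t *\<^sub>C q \<in> ball 0 r" for t
    using q n\<epsilon>[of t] by (simp add: norm_cscale)
  have d\<gamma>: "(\<gamma> has_vector_derivative X (\<gamma> t)) (at t)" for t
  proof -
    have "(\<epsilon> has_vector_derivative (\<i> * of_real w) * \<epsilon> t) (at t)"
    proof -
      have "((\<lambda>z. exp (\<i> * of_real w * z)) has_field_derivative (\<i> * of_real w) * exp (\<i> * of_real w * of_real t)) (at (of_real t))"
        by (auto intro!: derivative_eq_intros)
      from has_vector_derivative_real_field[OF this] show ?thesis by (simp add: \<epsilon>_def)
    qed
    then have d\<epsilon>: "(\<epsilon> has_derivative (\<lambda>h. h *\<^sub>R ((\<i> * of_real w) * \<epsilon> t))) (at t)"
      by (simp add: has_vector_derivative_def)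
    have "((\<lambda>t. \<epsilon> t *\<^sub>C q) has_derivative (\<lambda>h. (h *\<^sub>R ((\<i> * of_real w) * \<epsilon> t)) *\<^sub>C q)) (at t)"
      by (rule has_derivative_eq_rhs[OF has_derivative_cscale[OF d\<epsilon> has_derivative_const]]) simp
    moreover have "(h *\<^sub>R ((\<i> * of_real w) * \<epsilon> t)) *\<^sub>C q = h *\<^sub>R ((\<i> * of_real w) *\<^sub>C (\<epsilon> t *\<^sub>C q))" for h
      by (simp add: cscale_cscale scaleR_conv_of_real mult.assoc flip: cscale_of_real)
    ultimately have d1: "((\<lambda>t. \<epsilon> t *\<^sub>C q) has_derivative (\<lambda>h. h *\<^sub>R ((\<i> * of_real w) *\<^sub>C (\<epsilon> t *\<^sub>C q)))) (at t)"
      by simp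
    obtain D where D: "(\<Phi> has_derivative D) (at (\<epsilon> t *\<^sub>C q))"
        "D ((\<i> * of_real w) *\<^sub>C (\<epsilon> t *\<^sub>C q)) = X (\<Phi> (\<epsilon> t *\<^sub>C q))"
      using D inb by blast
    have "(\<gamma> has_derivative (\<lambda>h. D (h *\<^sub>R ((\<i> * of_real w) *\<^sub>C (\<epsilon> t *\<^sub>C q))))) (at t)"
      unfolding \<gamma>_def using diff_chain_at[OF d1 D(1)] by (simp add: o_def)
    then show ?thesis
      unfolding has_vector_derivative_def
      using D(2) has_derivative_linear[OF D(1)] by (simp add: \<gamma>_def linear_cmul)
  qed
  have \<gamma>0: "\<gamma> 0 = \<Phi> q" by (simp add: \<gamma>_def \<epsilon>_def)
  have per: "\<gamma> (t + 2 * pi / \<bar>w\<bar>) = \<gamma> t" for t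
  proof -
    \<comment> \<open>The period involves the absolute value of \<open>w\<close>, so the phase
      advances by plus or minus 2 pi according to the sign of \<open>w\<close>.\<close>
    have "\<epsilon> (t + 2 * pi / \<bar>w\<bar>) = exp (\<i> * of_real w * of_real t + of_real (2 * sgn w) * (of_real pi * \<i>))"
      using w by (simp add: \<epsilon>_def algebra_simps sgn_real_def abs_real_def)
    also have "\<dots> = \<epsilon> t"
      unfolding exp_add \<epsilon>_def using w
      by (cases "w > 0") (auto simp: sgn_real_def exp_two_pi_i exp_minus mult.assoc[symmetric])
    finally show ?thesis by (simp add: \<gamma>_def)
  qed
  have min: "\<gamma> s \<noteq> \<Phi> q" if s: "0 < s" "s < 2 * pi / \<bar>w\<bar>" for s
  proof
    assume "\<gamma> s = \<Phi> q"
    then have "\<epsilon> s *\<^sub>C q = q"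
      using inj inb q unfolding \<gamma>_def inj_on_def by blast
    then have "(\<epsilon> s + - 1) *\<^sub>C q = 0"
      using cscale_of_real[of "-1" q] by (simp add: cscale_add_left del: add_uminus_conv_diff)
    then have "cmod (\<epsilon> s + - 1) * norm q = 0"
      by (metis norm_cscale norm_zero)
    then have "\<epsilon> s = 1" using q by simp
    then obtain m :: int where m: "w * s = of_int (2 * m) * pi"
      unfolding \<epsilon>_def exp_eq_1 by auto
    \<comment> \<open>A return requires \<open>w * s\<close> to be a multiple of 2 pi, but before
      the period its modulus is less than 2 pi, so the multiple is zero.\<close>
    have "\<bar>w\<bar> * s < 2 * pi" using s w by (simp add: field_simps)
    moreover have "\<bar>w * s\<bar> = \<bar>w\<bar> * s" using s by (simp add: abs_mult)
    ultimately have "\<bar>of_int (2 * m) * pi\<bar> < 2 * pi" using m by simp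
    then have "\<bar>real_of_int m\<bar> < 1" by (simp add: abs_mult)
    then have "m = 0" by linarith
    with m s w show False by simp
  qed
  have uniq: "\<gamma>' = \<gamma>" if "\<gamma>' 0 = \<Phi> q" "\<And>t. (\<gamma>' has_vector_derivative X (\<gamma>' t)) (at t)" for \<gamma>'
    using ode_solution_unique[OF L d\<gamma> _ that(2)] im inb \<gamma>0 that(1) unfolding \<gamma>_def by metis
  show ?thesis
    unfolding periodic_traj_def using \<gamma>0 d\<gamma> per min uniq by metis
qed

section \<open>The invariant surface\<close>

lemma hol_order2_chol: "hol_order2 f \<Longrightarrow> \<exists>R>0. chol f (ball 0 R)"
  unfolding hol_order2_def holo3_def chol_def by (auto simp: split_paired_all)

lemma sys_eq: "sys w1 w2 f g h p = (\<i> * of_real w1 * fst p + f p, \<i> * of_real w2 * fst (snd p) + g p,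
    \<i> * of_real w2 * snd (snd p) + h p)"
  by (cases p) (simp add: sys_def)

lemma sys_lipschitz:
  assumes "hol_order2 f" "hol_order2 g" "hol_order2 h"
  shows "\<exists>R>0. \<exists>L. L-lipschitz_on (ball 0 R) (sys w1 w2 f g h)"
proof -
  obtain R1 R2 R3 where R: "R1 > 0" "chol f (ball 0 R1)" "R2 > 0" "chol g (ball 0 R2)" "R3 > 0" "chol h (ball 0 R3)"
    using assms hol_order2_chol by metis
  define R where "R = min R1 (min R2 R3)"
  have "chol f (ball 0 R)" "chol g (ball 0 R)" "chol h (ball 0 R)"
    by (auto intro: chol_subset[OF R(2)] chol_subset[OF R(4)] chol_subset[OF R(6)] simp: R_def subset_ball)
  then have "chol (sys w1 w2 f g h) (ball 0 R)"
    unfolding sys_eq[abs_def]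
    by (intro chol_Pair chol_add chol_mult chol_const chol_fst_compose chol_snd_compose chol_id open_ball)
  then show ?thesis
    using chol_locally_lipschitz_c3[of "sys w1 w2 f g h" "ball 0 R" 0] R by (force simp: R_def)
qed

section \<open>Linearisation of the flow on the invariant surface\<close>

lemma chol_derivative_cscale:
  assumes "chol F U" "p \<in> U" "(F has_derivative D) (at p)"
  shows "D (c *\<^sub>C v) = c *\<^sub>C D v"
  using assms by (metis cholE has_derivative_unique)

text \<open>The points \<open>s (c p)\<close> and \<open>(c s) p\<close> coincide; evaluating
  \<open>f\<close> there by both factorisations and cancelling \<open>s * s\<close> gives the
  identity. It provides the homogeneity that the singular equation needs.\<close>

lemma quasi_homogeneous_quotient:
  assumes k: "\<And>s p. s \<in> ball 0 r \<Longrightarrow> p \<in> ball 0 4 \<Longrightarrow> f (s *\<^sub>C p) = s * s * k (s, p)"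
    and "s \<noteq> 0" "s \<in> ball 0 r" "c *\<^sub>C p \<in> ball 0 4" "c * s \<in> ball 0 r" "p \<in> ball 0 4"
  shows "k (s, c *\<^sub>C p) = (c * c) * (k (c * s, p) :: complex)"
proof -
  have "s * s * k (s, c *\<^sub>C p) = f (s *\<^sub>C c *\<^sub>C p)"
    using assms by simp
  also have "\<dots> = f ((c * s) *\<^sub>C p)" by (simp add: cscale_cscale mult.commute)
  also have "\<dots> = (c * s) * (c * s) * k (c * s, p)" using assms by simp
  finally have "s * s * k (s, c *\<^sub>C p) = s * s * ((c * c) * k (c * s, p))"
    by (simp add: algebra_simps)
  then show ?thesis using \<open>s \<noteq> 0\<close> by simp
qed

text \<open>For fixed \<open>e\<close> the curve \<open>W(s) = s((0, e) + \<Omega>(s, e))\<close> solves \<open>i w\<^sub>2 s W'(s) = X(W(s))\<close>; by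
  quasi-homogeneity of \<open>\<Omega>\<close> all these curves lie on the image of one map of \<open>q = s e\<close>.\<close>

lemma yz_linearizing_map:
  assumes w: "w2 \<noteq> 0" "\<bar>w1\<bar> \<le> \<bar>w2\<bar>" and fgh: "hol_order2 f" "hol_order2 g" "hol_order2 h"
  shows "\<exists>\<rho>>0. \<exists>\<Phi> :: complex \<times> complex \<Rightarrow> c3. chol \<Phi> (ball 0 \<rho>) \<and> \<Phi> 0 = 0 \<and>
     (\<Phi> has_derivative (\<lambda>q. (0, q))) (at 0) \<and>
     (\<forall>q\<in>ball 0 \<rho>. \<forall>D. (\<Phi> has_derivative D) (at q) \<longrightarrow> D ((\<i> * of_real w2) *\<^sub>C q) = sys w1 w2 f g h (\<Phi> q))"
proof -
  obtain r1 k1 where 1: "r1 > 0" "chol k1 (ball 0 r1 \<times> ball 0 4)"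
    "\<And>s p. s \<in> ball 0 r1 \<Longrightarrow> p \<in> ball 0 4 \<Longrightarrow> f (s *\<^sub>C p) = s * s * k1 (s, p)"
    using hol_order2_blowup[OF fgh(1)] by blast
  obtain r2 k2 where 2: "r2 > 0" "chol k2 (ball 0 r2 \<times> ball 0 4)"
    "\<And>s p. s \<in> ball 0 r2 \<Longrightarrow> p \<in> ball 0 4 \<Longrightarrow> g (s *\<^sub>C p) = s * s * k2 (s, p)"
    using hol_order2_blowup[OF fgh(2)] by blast
  obtain r3 k3 where 3: "r3 > 0" "chol k3 (ball 0 r3 \<times> ball 0 4)"
    "\<And>s p. s \<in> ball 0 r3 \<Longrightarrow> p \<in> ball 0 4 \<Longrightarrow> h (s *\<^sub>C p) = s * s * k3 (s, p)"
    using hol_order2_blowup[OF fgh(3)] by blast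
  define r where "r = min (min r1 r2) (min r3 1)"
  have r: "r > 0" using 1 2 3 by (simp add: r_def)
  define \<mu> where "\<mu> = \<i> * complex_of_real w2"
  have \<mu>: "\<mu> \<noteq> 0" using w by (simp add: \<mu>_def)
  \<comment> \<open>Blow-up coordinates of the point \<open>s ((0, e) + w)\<close> on the sought
    curve.\<close>
  define pt where "pt = (\<lambda>q :: complex \<times> c3 \<times> complex \<times> complex. (fst q, (0, snd (snd q)) + fst (snd q)))"
  have cpt: "chol pt (ball 0 r)"
    unfolding pt_def
    by (intro chol_Pair chol_add chol_const chol_fst_compose chol_snd_compose chol_id open_ball)
  have ptb: "fst (pt q) \<in> ball 0 r1" "fst (pt q) \<in> ball 0 r2" "fst (pt q) \<in> ball 0 r3" "snd (pt q) \<in> ball 0 4"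
    if "q \<in> ball 0 r" for q
  proof -
    have q: "norm q < r" using that by simp
    have "norm (fst q) \<le> norm q" "norm (fst (snd q)) \<le> norm q" "norm (snd (snd q)) \<le> norm q"
      using norm_fst_le'[of q] norm_snd_le'[of q] norm_fst_le'[of "snd q"] norm_snd_le'[of "snd q"] by linarith+
    then have n: "norm (fst q) < r" "norm (fst (snd q)) < 1" "norm (snd (snd q)) < 1"
      using q by (auto simp: r_def)
    then show "fst (pt q) \<in> ball 0 r1" "fst (pt q) \<in> ball 0 r2" "fst (pt q) \<in> ball 0 r3"
      by (auto simp: pt_def r_def)
    have "norm ((0::complex, snd (snd q)) + fst (snd q)) \<le> norm (snd (snd q)) + norm (fst (snd q))"
      using norm_triangle_ineq[of "(0::complex, snd (snd q))" "fst (snd q)"] by (simp add: norm_Pair)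
    then show "snd (pt q) \<in> ball 0 4" using n by (simp add: pt_def)
  qed
  have ptb': "pt q \<in> ball 0 r1 \<times> ball 0 4" "pt q \<in> ball 0 r2 \<times> ball 0 4" "pt q \<in> ball 0 r3 \<times> ball 0 4"
    if "q \<in> ball 0 r" for q
    using ptb[OF that] by (auto simp: mem_Times_iff)
  define K where "K = (\<lambda>q. (k1 (pt q) / \<mu>, k2 (pt q) / \<mu>, k3 (pt q) / \<mu>))"
  have K: "chol K (ball 0 r)"
    unfolding K_def using \<mu> ptb'
    by (intro chol_Pair chol_divide chol_const open_ball chol_compose[OF 1(2) cpt] chol_compose[OF 2(2) cpt]
        chol_compose[OF 3(2) cpt] image_subsetI) auto
  have hom: "\<forall>s w e c. s \<noteq> 0 \<longrightarrow> (s, c *\<^sub>C w, c *\<^sub>C e) \<in> ball 0 r \<longrightarrow> (c * s, w, e) \<in> ball 0 r \<longrightarrow>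
    K (s, c *\<^sub>C w, c *\<^sub>C e) = (c * c) *\<^sub>C K (c * s, w, e)"
  proof (intro allI impI)
    fix s c :: complex and w :: c3 and e :: "complex \<times> complex"
    assume s: "s \<noteq> 0" and a: "(s, c *\<^sub>C w, c *\<^sub>C e) \<in> ball 0 r" and b: "(c * s, w, e) \<in> ball 0 r"
    define p where "p = (0, e) + w"
    have pa: "pt (s, c *\<^sub>C w, c *\<^sub>C e) = (s, c *\<^sub>C p)" and pb: "pt (c * s, w, e) = (c * s, p)"
      by (simp_all add: pt_def p_def cscale_add_right)
    note i = ptb[OF a, unfolded pa fst_conv snd_conv] ptb[OF b, unfolded pb fst_conv snd_conv]
    have "k1 (s, c *\<^sub>C p) = (c * c) * k1 (c * s, p)"
      by (rule quasi_homogeneous_quotient[OF 1(3) s i(1) i(4) i(5) i(8)])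
    moreover have "k2 (s, c *\<^sub>C p) = (c * c) * k2 (c * s, p)"
      by (rule quasi_homogeneous_quotient[OF 2(3) s i(2) i(4) i(6) i(8)])
    moreover have "k3 (s, c *\<^sub>C p) = (c * c) * k3 (c * s, p)"
      by (rule quasi_homogeneous_quotient[OF 3(3) s i(3) i(4) i(7) i(8)])
    ultimately show "K (s, c *\<^sub>C w, c *\<^sub>C e) = (c * c) *\<^sub>C K (c * s, w, e)"
      by (simp add: K_def pa pb)
  qed
  \<comment> \<open>Inserting \<open>W = s ((0, e) + \<Omega>)\<close> into
    \<open>\<mu> s W' = X(W)\<close> and dividing by \<open>\<mu> s\<close> leaves
    \<open>s \<Omega>'\<close> on the left and, as coefficients of \<open>\<Omega>\<close> on the
    right, the eigenvalues divided by \<open>\<mu>\<close> minus 1. These are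
    \<open>w1 / w2 - 1, 0, 0\<close>; the remaining term is \<open>s K\<close>.\<close>
  define b1 where "b1 = 1 - w1 / w2"
  have "\<bar>w1 / w2\<bar> \<le> 1" using w by simp
  then have b1: "b1 \<ge> 0" unfolding b1_def by linarith
  obtain \<rho> \<Omega> where \<rho>: "\<rho> > 0" and \<Omega>: "chol \<Omega> (ball 0 \<rho> \<times> ball 0 \<rho>)"
    and inr: "\<And>s e. s \<in> ball 0 \<rho> \<Longrightarrow> e \<in> ball 0 \<rho> \<Longrightarrow> (s, \<Omega> (s, e), e) \<in> ball 0 r"
    and \<Omega>0: "\<And>e. e \<in> ball 0 \<rho> \<Longrightarrow> \<Omega> (0, e) = 0"
    and ode1: "\<And>s e. s \<in> ball 0 \<rho> \<Longrightarrow> e \<in> ball 0 \<rho> \<Longrightarrow> \<exists>d1. ((\<lambda>s. fst (\<Omega> (s, e))) has_field_derivative d1) (at s) \<and>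
           s * d1 = - of_real b1 * fst (\<Omega> (s, e)) + s * fst (K (s, \<Omega> (s, e), e))"
    and ode2: "\<And>s e. s \<in> ball 0 \<rho> \<Longrightarrow> e \<in> ball 0 \<rho> \<Longrightarrow> \<exists>d2. ((\<lambda>s. fst (snd (\<Omega> (s, e)))) has_field_derivative d2) (at s) \<and>
           s * d2 = - of_real 0 * fst (snd (\<Omega> (s, e))) + s * fst (snd (K (s, \<Omega> (s, e), e)))"
    and ode3: "\<And>s e. s \<in> ball 0 \<rho> \<Longrightarrow> e \<in> ball 0 \<rho> \<Longrightarrow> \<exists>d3. ((\<lambda>s. snd (snd (\<Omega> (s, e)))) has_field_derivative d3) (at s) \<and>
           s * d3 = - of_real 0 * snd (snd (\<Omega> (s, e))) + s * snd (snd (K (s, \<Omega> (s, e), e)))"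
    and \<Omega>hom: "\<And>s e c. s \<in> ball 0 \<rho> \<Longrightarrow> c * s \<in> ball 0 \<rho> \<Longrightarrow> e \<in> ball 0 \<rho> \<Longrightarrow> c *\<^sub>C e \<in> ball 0 \<rho> \<Longrightarrow>
        \<Omega> (s, c *\<^sub>C e) = c *\<^sub>C \<Omega> (c * s, e)"
  proof (rule singular_ode_solution[OF K r b1 order_refl order_refl], goal_cases)
    case (1 \<rho> \<Omega>)
    note sol = 1
    show ?case
      by (rule sol(1)[OF sol(2-8) sol(9)[OF hom]]; assumption)
  qed
  \<comment> \<open>\<open>\<Phi> q\<close> is the point at the fixed nonzero time \<open>S\<close>
    on the curve with direction \<open>q / S\<close>. The radius \<open>\<rho>1\<close> below keeps
    this direction within the admissible parameters.\<close>
  define S where "S = complex_of_real (\<rho> / 2)"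
  have S: "S \<noteq> 0" "S \<in> ball 0 \<rho>" "cmod S = \<rho> / 2" using \<rho> by (auto simp: S_def)
  define \<Phi> where "\<Phi> = (\<lambda>q. (0, q) + S *\<^sub>C \<Omega> (S, (1 / S) *\<^sub>C q))"
  define \<rho>1 where "\<rho>1 = \<rho> / 2 * \<rho>"
  have \<rho>1: "\<rho>1 > 0" using \<rho> by (simp add: \<rho>1_def)
  have eb: "(1 / S) *\<^sub>C q \<in> ball 0 \<rho>" if "q \<in> ball 0 \<rho>1" for q :: "complex \<times> complex"
    using that \<rho> by (simp add: norm_cscale norm_divide S(3) \<rho>1_def field_simps)
  have \<Phi>hol: "chol \<Phi> (ball 0 \<rho>1)"
    unfolding \<Phi>_def
    by (intro chol_add chol_Pair chol_const chol_id chol_cscale open_ball chol_compose[OF \<Omega>] image_subsetI)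
       (use eb S in auto)
  \<comment> \<open>Homogeneity trades a factor \<open>c\<close> in the direction for a factor
    \<open>c\<close> in the time. The complex line through \<open>q\<close> is therefore mapped
    along a single solution curve.\<close>
  have curve: "\<Phi> (c *\<^sub>C q) = (c * S) *\<^sub>C ((0, (1 / S) *\<^sub>C q) + \<Omega> (c * S, (1 / S) *\<^sub>C q))"
    if "q \<in> ball 0 \<rho>1" "c * S \<in> ball 0 \<rho>" "c *\<^sub>C (1 / S) *\<^sub>C q \<in> ball 0 \<rho>" for c q
  proof -
    have "\<Omega> (S, c *\<^sub>C (1 / S) *\<^sub>C q) = c *\<^sub>C \<Omega> (c * S, (1 / S) *\<^sub>C q)"
      using that S eb by (intro \<Omega>hom) auto
    then show ?thesis
      using S by (simp add: \<Phi>_def cscale_add_right cscale_cscale mult.commute)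
  qed
  \<comment> \<open>The product rule along that curve, for one coordinate \<open>\<pi>\<close>. It
    is used at \<open>c0 = 0\<close> to find the derivative at the origin and at
    \<open>c0 = 1\<close> to compare with the vector field.\<close>
  have line: "\<pi> (D q) = S * (a + \<omega> (c0 * S)) + c0 * S * (d * S)"
    if q: "q \<in> ball 0 \<rho>1" and c0: "c0 * S \<in> ball 0 \<rho>" "c0 *\<^sub>C (1 / S) *\<^sub>C q \<in> ball 0 \<rho>" "c0 *\<^sub>C q \<in> ball 0 \<rho>1"
      and D: "(\<Phi> has_derivative D) (at (c0 *\<^sub>C q))"
      and \<pi>: "bounded_linear \<pi>" "\<And>c x. \<pi> (c *\<^sub>C x) = c * \<pi> x"
      and a: "\<pi> (0, (1 / S) *\<^sub>C q) = a" and \<omega>: "\<omega> = (\<lambda>s. \<pi> (\<Omega> (s, (1 / S) *\<^sub>C q)))"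
      and d: "(\<omega> has_field_derivative d) (at (c0 * S))"
    for q c0 D d a \<omega> and \<pi> :: "c3 \<Rightarrow> complex"
  proof -
    define N where "N = {c. c * S \<in> ball 0 \<rho>} \<inter> {c. c *\<^sub>C (1 / S) *\<^sub>C q \<in> ball 0 \<rho>}"
    have N: "open N"
      unfolding N_def mem_ball by (intro open_Int open_Collect_less continuous_intros)
    have "c0 \<in> N" using c0 by (simp add: N_def)
    have "((\<lambda>p. \<pi> (\<Phi> p)) has_derivative (\<lambda>v. \<pi> (D v))) (at (0 + c0 *\<^sub>C q))"
      using bounded_linear.has_derivative[OF \<pi>(1) D] by simp
    then have "((\<lambda>t. \<pi> (\<Phi> (0 + t *\<^sub>C q))) has_field_derivative \<pi> (D q)) (at c0)"
      by (rule chol_line) (simp add: chol_derivative_cscale[OF \<Phi>hol c0(3) D] \<pi>)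
    then have "((\<lambda>t. t * S * (a + \<omega> (t * S))) has_field_derivative \<pi> (D q)) (at c0)"
    proof (rule has_field_derivative_transform_within_open[OF _ N \<open>c0 \<in> N\<close>])
      fix c assume "c \<in> N"
      then have "\<Phi> (c *\<^sub>C q) = (c * S) *\<^sub>C ((0, (1 / S) *\<^sub>C q) + \<Omega> (c * S, (1 / S) *\<^sub>C q))"
        using q by (intro curve) (auto simp: N_def)
      then show "\<pi> (\<Phi> (0 + c *\<^sub>C q)) = c * S * (a + \<omega> (c * S))"
        using a by (simp add: \<pi> \<omega> linear_add[OF bounded_linear.linear[OF \<pi>(1)]])
    qed
    moreover have "((\<lambda>t. t * S * (a + \<omega> (t * S))) has_field_derivative
        (1 * S * (a + \<omega> (c0 * S)) + (0 + d * (1 * S)) * (c0 * S))) (at c0)"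
      by (intro DERIV_mult DERIV_add DERIV_const DERIV_cmult_right DERIV_ident
          DERIV_chain2[where f = \<omega> and g = "\<lambda>t. t * S", OF d])
    ultimately show ?thesis
      using DERIV_unique by (fastforce simp: algebra_simps)
  qed
  have \<pi>: "bounded_linear (fst :: c3 \<Rightarrow> complex)" "bounded_linear (\<lambda>x :: c3. fst (snd x))"
     "bounded_linear (\<lambda>x :: c3. snd (snd x))"
    using bounded_linear_compose[OF bounded_linear_fst bounded_linear_snd]
      bounded_linear_compose[OF bounded_linear_snd bounded_linear_snd] by (auto intro: bounded_linear_fst)
  have "\<Phi> 0 = 0"
    \<comment> \<open>The case \<open>c = 0\<close> of homogeneity gives
      \<open>\<Omega> (S, 0) = 0\<close>.\<close>
    using \<Omega>hom[of S 0 0] \<rho> S by (simp add: \<Phi>_def zero_prod_def)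
  moreover have "(\<Phi> has_derivative (\<lambda>q. (0, q))) (at 0)"
  proof -
    obtain D where D: "(\<Phi> has_derivative D) (at 0)" using \<Phi>hol \<rho>1 by (meson cholE centre_in_ball)
    have small: "D q = (0, q)" if q: "q \<in> ball 0 \<rho>1" for q
    proof -
      have D': "(\<Phi> has_derivative D) (at (0 *\<^sub>C q))" using D by simp
      have c0: "0 * S \<in> ball 0 \<rho>" "0 *\<^sub>C (1 / S) *\<^sub>C q \<in> ball 0 \<rho>" "0 *\<^sub>C q \<in> ball 0 \<rho>1"
        using \<rho> \<rho>1 by simp_all
      note e = eb[OF q]
      obtain d1 where d1: "((\<lambda>s. fst (\<Omega> (s, (1 / S) *\<^sub>C q))) has_field_derivative d1) (at (0 * S))"
        using ode1[OF c0(1) e] by blast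
      obtain d2 where d2: "((\<lambda>s. fst (snd (\<Omega> (s, (1 / S) *\<^sub>C q)))) has_field_derivative d2) (at (0 * S))"
        using ode2[OF c0(1) e] by blast
      obtain d3 where d3: "((\<lambda>s. snd (snd (\<Omega> (s, (1 / S) *\<^sub>C q)))) has_field_derivative d3) (at (0 * S))"
        using ode3[OF c0(1) e] by blast
      have "fst (D q) = 0" "fst (snd (D q)) = fst q" "snd (snd (D q)) = snd q"
        using line[OF q c0 D' \<pi>(1) _ _ refl d1] line[OF q c0 D' \<pi>(2) _ _ refl d2]
          line[OF q c0 D' \<pi>(3) _ _ refl d3] \<Omega>0[OF e] S by simp_all
      then show ?thesis by (simp add: prod_eq_iff)
    qed
    have "D q = (0, q)" for q
    proof (cases "q = 0")
      case True
      then show ?thesis using small[of 0] \<rho>1 by simp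
    next
      case False
      define t where "t = \<rho>1 / (2 * norm q)"
      have t: "t > 0" using False \<rho>1 by (simp add: t_def)
      have "t *\<^sub>R q \<in> ball 0 \<rho>1" using False \<rho>1 by (simp add: t_def)
      from small[OF this] have "t *\<^sub>R D q = t *\<^sub>R (0, q)"
        using has_derivative_linear[OF D] by (simp add: linear_cmul)
      then show ?thesis using t by (simp only: real_vector.scale_cancel_left) simp
    qed
    then have "D = (\<lambda>q. (0, q))" by (rule ext)
    then show ?thesis using D by simp
  qed
  moreover have "D ((\<i> * of_real w2) *\<^sub>C q) = sys w1 w2 f g h (\<Phi> q)"
    if q: "q \<in> ball 0 \<rho>1" and D: "(\<Phi> has_derivative D) (at q)" for q D
  proof -
    define e where "e = (1 / S) *\<^sub>C q"
    have e: "e \<in> ball 0 \<rho>" using eb[OF q] by (simp add: e_def)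
    have D': "(\<Phi> has_derivative D) (at (1 *\<^sub>C q))" using D by simp
    have c0: "1 * S \<in> ball 0 \<rho>" "1 *\<^sub>C (1 / S) *\<^sub>C q \<in> ball 0 \<rho>" "1 *\<^sub>C q \<in> ball 0 \<rho>1"
      using S e q by (simp_all add: e_def)
    obtain d1 where d1: "((\<lambda>s. fst (\<Omega> (s, e))) has_field_derivative d1) (at (1 * S))"
        "S * d1 = - of_real b1 * fst (\<Omega> (S, e)) + S * fst (K (S, \<Omega> (S, e), e))"
      using ode1[OF S(2) e] by auto
    obtain d2 where d2: "((\<lambda>s. fst (snd (\<Omega> (s, e)))) has_field_derivative d2) (at (1 * S))"
        "S * d2 = S * fst (snd (K (S, \<Omega> (S, e), e)))"
      using ode2[OF S(2) e] by auto
    obtain d3 where d3: "((\<lambda>s. snd (snd (\<Omega> (s, e)))) has_field_derivative d3) (at (1 * S))"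
        "S * d3 = S * snd (snd (K (S, \<Omega> (S, e), e)))"
      using ode3[OF S(2) e] by auto
    define p where "p = (0, e) + \<Omega> (S, e)"
    have pin: "(S, \<Omega> (S, e), e) \<in> ball 0 r" using inr[OF S(2) e] .
    have pt: "pt (S, \<Omega> (S, e), e) = (S, p)" by (simp add: pt_def p_def)
    have \<Phi>q: "\<Phi> q = S *\<^sub>C p"
      using S by (simp add: \<Phi>_def p_def e_def cscale_add_right cscale_cscale)
    have fS: "f (\<Phi> q) = S * S * k1 (S, p)" "g (\<Phi> q) = S * S * k2 (S, p)" "h (\<Phi> q) = S * S * k3 (S, p)"
      using ptb[OF pin] unfolding pt \<Phi>q by (auto intro!: 1(3) 2(3) 3(3) simp del: mem_ball)
    have K1: "fst (K (S, \<Omega> (S, e), e)) = k1 (S, p) / \<mu>" "fst (snd (K (S, \<Omega> (S, e), e))) = k2 (S, p) / \<mu>"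
        "snd (snd (K (S, \<Omega> (S, e), e))) = k3 (S, p) / \<mu>"
      by (simp_all add: K_def pt)
    have "fst (D q) = S * (0 + fst (\<Omega> (S, e))) + S * (d1 * S)"
      using line[OF q c0 D' \<pi>(1) _ _ refl d1(1)[unfolded e_def]] by (simp add: e_def)
    also have "\<dots> = S * fst (\<Omega> (S, e)) + S * (S * d1)" by (simp add: mult.commute)
    also have "\<dots> = S * fst (\<Omega> (S, e)) * (1 - of_real b1) + S * S * k1 (S, p) / \<mu>"
      unfolding d1(2) K1 by (simp add: algebra_simps)
    finally have E1: "fst (D q) = S * fst (\<Omega> (S, e)) * (1 - of_real b1) + S * S * k1 (S, p) / \<mu>" .
    have D1: "\<mu> * fst (D q) = \<mu> * (1 - of_real b1) * (S * fst (\<Omega> (S, e))) + S * S * k1 (S, p)"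
      unfolding E1 using \<mu> by (simp add: distrib_left)
    have "fst (snd (D q)) = S * (fst e + fst (snd (\<Omega> (S, e)))) + S * (d2 * S)"
      using line[OF q c0 D' \<pi>(2) _ _ refl d2(1)[unfolded e_def]] by (simp add: e_def)
    also have "\<dots> = S * fst (snd p) + S * (S * d2)" by (simp add: mult.commute p_def)
    also have "\<dots> = S * fst (snd p) + S * S * k2 (S, p) / \<mu>" unfolding d2(2) K1 by simp
    finally have E2: "fst (snd (D q)) = S * fst (snd p) + S * S * k2 (S, p) / \<mu>" .
    have D2: "\<mu> * fst (snd (D q)) = \<mu> * (S * fst (snd p)) + S * S * k2 (S, p)"
      unfolding E2 using \<mu> by (simp add: distrib_left)
    have "snd (snd (D q)) = S * (snd e + snd (snd (\<Omega> (S, e)))) + S * (d3 * S)"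
      using line[OF q c0 D' \<pi>(3) _ _ refl d3(1)[unfolded e_def]] by (simp add: e_def)
    also have "\<dots> = S * snd (snd p) + S * (S * d3)" by (simp add: mult.commute p_def)
    also have "\<dots> = S * snd (snd p) + S * S * k3 (S, p) / \<mu>" unfolding d3(2) K1 by simp
    finally have E3: "snd (snd (D q)) = S * snd (snd p) + S * S * k3 (S, p) / \<mu>" .
    have D3: "\<mu> * snd (snd (D q)) = \<mu> * (S * snd (snd p)) + S * S * k3 (S, p)"
      unfolding E3 using \<mu> by (simp add: distrib_left)
    \<comment> \<open>This restores the eigenvalue of the \<open>x\<close>-component from the
      exponent \<open>b1\<close>.\<close>
    have \<mu>b: "\<mu> * (1 - of_real b1) = \<i> * of_real w1"
      using w by (simp add: \<mu>_def b1_def)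
    have "D (\<mu> *\<^sub>C q) = \<mu> *\<^sub>C D q" by (rule chol_derivative_cscale[OF \<Phi>hol q D])
    then show ?thesis
      using D1 D2 D3 fS
      by (simp add: sys_eq \<mu>_def[symmetric] \<Phi>q prod_eq_iff \<mu>b p_def mult.assoc[symmetric])
  qed
  ultimately show ?thesis using \<Phi>hol \<rho>1 by blast
qed

text \<open>A substitute for continuity of the derivative at 0. \<open>N\<close> is quadratically
  small near 0, and the Cauchy estimate on a ball of radius \<open>r\<close> about a point of norm
  below \<open>r\<close> loses only one factor \<open>r\<close>.\<close>

lemma chol_small_derivative:
  fixes N :: "'a::complex_normed \<Rightarrow> complex"
  assumes N: "chol N (ball 0 \<rho>)" and \<rho>: "\<rho> > 0" and N0: "N 0 = 0" "(N has_derivative (\<lambda>_. 0)) (at 0)"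
    and \<epsilon>: "\<epsilon> > 0"
  shows "\<exists>r>0. r \<le> \<rho> \<and> (\<forall>q\<in>ball 0 r. \<forall>D. (N has_derivative D) (at q) \<longrightarrow> (\<forall>d. cmod (D d) \<le> \<epsilon> * norm d))"
proof -
  have "0 \<in> ball (0::'a) \<rho>" using \<rho> by simp
  from chol_locally_lipschitz_complex[OF N this]
  obtain r1 L where r1: "r1 > 0" "ball 0 r1 \<subseteq> ball (0::'a) \<rho>" "L-lipschitz_on (ball 0 r1) N"
    by blast
  have L0: "L \<ge> 0" using r1(3) by (rule lipschitz_on_nonneg)
  define s where "s = min r1 \<rho>"
  have s: "s > 0" "ball 0 s \<subseteq> ball (0::'a) \<rho>" using r1 \<rho> by (auto simp: s_def)
  define M where "M = L * s"
  have "cmod (N x) \<le> M" if "x \<in> ball 0 s" for x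
  proof -
    have "cmod (N x - N 0) \<le> L * norm (x - 0)"
      using that r1 by (intro lipschitz_on_normD[OF r1(3)]) (auto simp: s_def)
    also have "\<dots> \<le> L * s" using that L0 by (intro mult_left_mono) auto
    finally show ?thesis by (simp add: N0 M_def)
  qed
  then have quad: "cmod (N d) \<le> 8 * M / s\<^sup>2 * (norm d)\<^sup>2" if "norm d \<le> s/4" for d
    using chol_Taylor_bound[OF chol_subset[OF N s(2)] _ s(1) N0(2) _ that] N0 by simp
  define C where "C = 8 * M / s\<^sup>2"
  have C: "C \<ge> 0" using L0 s by (simp add: C_def M_def)
  \<comment> \<open>Points of \<open>ball q r\<close> have norm below \<open>2 * r\<close>, which
    the first term keeps within the range of the quadratic bound. The resulting estimate
    \<open>2 * C * (2 * r)^2 / r = 8 * C * r\<close> explains the second term.\<close>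
  define r where "r = min (s / 8) (\<epsilon> / (8 * C + 1))"
  have r: "r > 0" using s \<epsilon> C by (simp add: r_def add_nonneg_pos)
  have rs: "2 * r \<le> s / 4" by (simp add: r_def)
  have "r * (8 * C + 1) \<le> \<epsilon>"
    using C by (simp add: r_def pos_le_divide_eq[symmetric])
  then have rC: "8 * C * r \<le> \<epsilon>" using r by (simp add: algebra_simps)
  have "cmod (D d) \<le> \<epsilon> * norm d" if q: "q \<in> ball 0 r" and D: "(N has_derivative D) (at q)" for q D d
  proof -
    have sub: "norm x < 2 * r" if "x \<in> ball q r" for x
      using that q norm_triangle_sub[of x q] by (auto simp: dist_norm norm_minus_commute)
    have subs: "ball q r \<subseteq> ball 0 \<rho>"
    proof
      fix x assume "x \<in> ball q r"
      from sub[OF this] rs s have "x \<in> ball 0 s" by simp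
      then show "x \<in> ball 0 \<rho>" using s by blast
    qed
    have "cmod (D d) \<le> 2 * (C * (2 * r)\<^sup>2) / r * norm d"
    proof (rule chol_derivative_bound[OF chol_subset[OF N subs] _ r D])
      fix x assume "x \<in> ball q r"
      then have x: "norm x < 2 * r" by (rule sub)
      have "cmod (N x) \<le> C * (norm x)\<^sup>2" unfolding C_def using x rs by (intro quad) simp
      also have "\<dots> \<le> C * (2 * r)\<^sup>2" using x C by (intro mult_left_mono power_mono) auto
      finally show "cmod (N x) \<le> C * (2 * r)\<^sup>2" .
    next
      show "D (c *\<^sub>C v) = c *\<^sub>C D v" for c v
        using subs r centre_in_ball[of q r] by (intro chol_derivative_cscale[OF N _ D]) blast
    qed auto
    also have "\<dots> = (8 * C * r) * norm d" using r by (simp add: power2_eq_square)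
    also have "\<dots> \<le> \<epsilon> * norm d" using rC by (intro mult_right_mono) auto
    finally show ?thesis .
  qed
  moreover have "r \<le> \<rho>" using rs s r by (simp add: s_def)
  ultimately show ?thesis using r by blast
qed

text \<open>Near 0 the map differs from the identity by a contraction with constant 1/2, so it and
  its derivatives are injective. Invariance of domain makes the image open, and the derivative of
  the inverse is complex-linear as the inverse of a complex-linear map.\<close>

lemma chol_local_inverse:
  fixes \<Psi> :: "complex \<times> complex \<Rightarrow> complex \<times> complex"
  assumes \<Psi>: "chol \<Psi> (ball 0 \<rho>)" and \<rho>: "\<rho> > 0" and \<Psi>0: "\<Psi> 0 = 0" "(\<Psi> has_derivative (\<lambda>q. q)) (at 0)"
  obtains r \<sigma> where "r > 0" "r \<le> \<rho>" "inj_on \<Psi> (ball 0 r)" "open (\<Psi> ` ball 0 r)" "chol \<sigma> (\<Psi> ` ball 0 r)"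
    "\<And>q. q \<in> ball 0 r \<Longrightarrow> \<sigma> (\<Psi> q) = q"
    "\<And>q D. q \<in> ball 0 r \<Longrightarrow> (\<Psi> has_derivative D) (at q) \<Longrightarrow>
       \<exists>E. (\<sigma> has_derivative E) (at (\<Psi> q)) \<and> (\<forall>v. E (D v) = v)"
proof -
  have fst': "((\<lambda>q. fst (\<Psi> q) - fst q) has_derivative (\<lambda>_. 0)) (at 0)"
    and snd': "((\<lambda>q. snd (\<Psi> q) - snd q) has_derivative (\<lambda>_. 0)) (at 0)"
    using has_derivative_diff[OF has_derivative_fst[OF \<Psi>0(2)] has_derivative_fst[OF has_derivative_ident]]
      has_derivative_diff[OF has_derivative_snd[OF \<Psi>0(2)] has_derivative_snd[OF has_derivative_ident]]
    by simp_all
  have h1: "chol (\<lambda>q. fst (\<Psi> q) - fst q) (ball 0 \<rho>)" and h2: "chol (\<lambda>q. snd (\<Psi> q) - snd q) (ball 0 \<rho>)"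
    using \<Psi> by (auto intro!: chol_diff chol_fst_compose chol_snd_compose chol_id)
  \<comment> \<open>A quarter for each of the two components adds up to the contraction constant
    1/2.\<close>
  obtain r1 where r1: "r1 > 0" "r1 \<le> \<rho>"
      "\<And>q D d. q \<in> ball 0 r1 \<Longrightarrow> ((\<lambda>q. fst (\<Psi> q) - fst q) has_derivative D) (at q) \<Longrightarrow> cmod (D d) \<le> 1/4 * norm d"
    using chol_small_derivative[OF h1 \<rho> _ fst', of "1/4"] \<Psi>0 by auto
  obtain r2 where r2: "r2 > 0" "r2 \<le> \<rho>"
      "\<And>q D d. q \<in> ball 0 r2 \<Longrightarrow> ((\<lambda>q. snd (\<Psi> q) - snd q) has_derivative D) (at q) \<Longrightarrow> cmod (D d) \<le> 1/4 * norm d"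
    using chol_small_derivative[OF h2 \<rho> _ snd', of "1/4"] \<Psi>0 by auto
  define r where "r = min r1 r2"
  have r: "r > 0" "r \<le> \<rho>" using r1 r2 by (auto simp: r_def)
  have sub: "ball 0 r \<subseteq> ball (0 :: complex \<times> complex) \<rho>" using r by auto
  have close: "norm (D d - d) \<le> 1/2 * norm d" if q: "q \<in> ball 0 r" and D: "(\<Psi> has_derivative D) (at q)" for q D d
  proof -
    have "cmod (fst (D d) - fst d) \<le> 1/4 * norm d"
      by (rule r1(3)[of q "\<lambda>d. fst (D d) - fst d"]) (use q D in \<open>auto simp: r_def intro!: derivative_intros has_derivative_fst\<close>)
    moreover have "cmod (snd (D d) - snd d) \<le> 1/4 * norm d"
      by (rule r2(3)[of q "\<lambda>d. snd (D d) - snd d"]) (use q D in \<open>auto simp: r_def intro!: derivative_intros has_derivative_snd\<close>)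
    moreover have "norm (D d - d) \<le> cmod (fst (D d) - fst d) + cmod (snd (D d) - snd d)"
      using norm_Pair_le[of "fst (D d - d)" "snd (D d - d)"] unfolding prod.collapse by simp
    ultimately show ?thesis by linarith
  qed
  have diffb: "norm ((\<Psi> x - x) - (\<Psi> y - y)) \<le> 1/2 * norm (x - y)" if xy: "x \<in> ball 0 r" "y \<in> ball 0 r" for x y
  proof -
    have "\<forall>q\<in>ball 0 r. \<exists>D. (\<Psi> has_derivative D) (at q)" using \<Psi> sub unfolding chol_def by blast
    then obtain D where D: "\<And>q. q \<in> ball 0 r \<Longrightarrow> (\<Psi> has_derivative D q) (at q)" by metis
    show ?thesis
    proof (rule differentiable_bound[where f' = "\<lambda>q d. D q d - d", OF convex_ball _ _ xy])
      fix q :: "complex \<times> complex" assume q: "q \<in> ball 0 r"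
      show "((\<lambda>q. \<Psi> q - q) has_derivative (\<lambda>d. D q d - d)) (at q within ball 0 r)"
        using has_derivative_at_withinI[OF D[OF q]] by (intro derivative_intros)
      show "onorm (\<lambda>d. D q d - d) \<le> 1/2"
        using close[OF q D[OF q]] by (intro onorm_bound) auto
    qed
  qed
  have inj: "inj_on \<Psi> (ball 0 r)"
  proof (rule inj_onI)
    fix x y assume xy: "x \<in> ball 0 r" "y \<in> ball 0 r" "\<Psi> x = \<Psi> y"
    have "norm (x - y) \<le> 1/2 * norm (x - y)"
      using diffb[OF xy(1,2)] xy(3) by (simp add: norm_minus_commute)
    then show "x = y" by simp
  qed
  have cont: "continuous_on (ball 0 r) \<Psi>"
    using chol_imp_continuous_on[OF \<Psi>] sub continuous_on_subset by blast
  have op: "open (\<Psi> ` ball 0 r)"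
    by (rule invariance_of_domain[OF cont open_ball inj])
  define \<sigma> where "\<sigma> = inv_into (ball 0 r) \<Psi>"
  have \<sigma>: "\<sigma> (\<Psi> q) = q" if "q \<in> ball 0 r" for q
    unfolding \<sigma>_def using inj that by (rule inv_into_f_f)
  have deriv: "\<exists>E. (\<sigma> has_derivative E) (at (\<Psi> q)) \<and> (\<forall>v. E (D v) = v) \<and> (\<forall>v. D (E v) = v)"
    if q: "q \<in> ball 0 r" and D: "(\<Psi> has_derivative D) (at q)" for q D
  proof -
    have lin: "linear D" using D by (rule has_derivative_linear)
    have "inj D"
    proof (rule linear_injective_0[OF lin, THEN iffD2], intro allI impI)
      fix d assume "D d = 0"
      then have "norm d \<le> 1/2 * norm d" using close[OF q D, of d] by simp
      then show "d = 0" by simp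
    qed
    then obtain E where E: "linear E" "\<And>x. E (D x) = x" "\<And>x. D (E x) = x"
      using linear_injective_isomorphism[OF lin] by blast
    have "(\<sigma> has_derivative E) (at (\<Psi> q))"
      by (rule has_derivative_inverse_strong[OF open_ball q cont \<sigma> D]) (auto simp: fun_eq_iff E)
    then show ?thesis using E by blast
  qed
  have "chol \<sigma> (\<Psi> ` ball 0 r)"
  proof (rule cholI[OF op])
    fix y assume "y \<in> \<Psi> ` ball 0 r"
    then obtain q where q: "q \<in> ball 0 r" "y = \<Psi> q" by blast
    obtain D where D: "(\<Psi> has_derivative D) (at q)" "\<And>c v. D (c *\<^sub>C v) = c *\<^sub>C D v"
      using \<Psi> q sub by (meson cholE subsetD)
    obtain E where E: "(\<sigma> has_derivative E) (at y)" "\<And>v. E (D v) = v" "\<And>v. D (E v) = v"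
      using deriv[OF q(1) D(1)] q by auto
    have "E (c *\<^sub>C v) = c *\<^sub>C E v" for c v
      using D(2)[of c "E v"] E(2)[of "c *\<^sub>C E v"] E(3)[of v] by simp
    with E(1) show "\<exists>D. (\<sigma> has_derivative D) (at y) \<and> (\<forall>c v. D (c *\<^sub>C v) = c *\<^sub>C D v)" by blast
  qed
  with r inj op \<sigma> deriv show ?thesis by (intro that[of r \<sigma>]) blast+
qed

text \<open>The image of the linearising map is tangent to the (y,z)-plane, so its projection there
  is locally invertible; following the inverse by the first component writes the image as a
  graph.\<close>

theorem yz_isochronous_center_manifold:
  assumes w: "w2 \<noteq> 0" "\<bar>w1\<bar> \<le> \<bar>w2\<bar>" and fgh: "hol_order2 f" "hol_order2 g" "hol_order2 h"
  shows "\<exists>C. yz_center_manifold (sys w1 w2 f g h) C \<and> yz_isochronous (sys w1 w2 f g h) C (2 * pi / \<bar>w2\<bar>)"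
proof -
  define X where "X = sys w1 w2 f g h"
  obtain \<rho>0 \<Phi> where \<rho>0: "\<rho>0 > 0" and \<Phi>: "chol \<Phi> (ball 0 \<rho>0)" and \<Phi>0: "\<Phi> 0 = 0"
    "(\<Phi> has_derivative (\<lambda>q. (0, q))) (at 0)"
    and \<Phi>X: "\<And>q D. q \<in> ball 0 \<rho>0 \<Longrightarrow> (\<Phi> has_derivative D) (at q) \<Longrightarrow> D ((\<i> * of_real w2) *\<^sub>C q) = X (\<Phi> q)"
    using yz_linearizing_map[OF w fgh] unfolding X_def by blast
  obtain R L where R: "R > 0" "L-lipschitz_on (ball 0 R) X"
    using sys_lipschitz[OF fgh] unfolding X_def by blast
  \<comment> \<open>The domain is shrunk so that the image lies where the field is Lipschitz, as
    uniqueness of trajectories requires.\<close>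
  have "open (ball 0 \<rho>0 \<inter> \<Phi> -` ball 0 R)"
    by (rule continuous_open_preimage[OF chol_imp_continuous_on[OF \<Phi>] open_ball open_ball])
  moreover have "0 \<in> ball 0 \<rho>0 \<inter> \<Phi> -` ball 0 R" using \<Phi>0 R \<rho>0 by simp
  ultimately obtain \<rho> where \<rho>: "\<rho> > 0" "ball 0 \<rho> \<subseteq> ball 0 \<rho>0 \<inter> \<Phi> -` ball 0 R"
    using openE by blast
  have \<Phi>\<rho>: "chol \<Phi> (ball 0 \<rho>)" using chol_subset[OF \<Phi>] \<rho> by auto
  have d\<Phi>: "((\<lambda>q. snd (\<Phi> q)) has_derivative (\<lambda>q. q)) (at 0)" and snd\<Phi>0: "snd (\<Phi> 0) = 0"
    using has_derivative_snd[OF \<Phi>0(2)] \<Phi>0(1) by simp_all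
  obtain r \<sigma> where r: "r > 0" "r \<le> \<rho>" and inj: "inj_on (\<lambda>q. snd (\<Phi> q)) (ball 0 r)"
    and op: "open ((\<lambda>q. snd (\<Phi> q)) ` ball 0 r)" and \<sigma>: "chol \<sigma> ((\<lambda>q. snd (\<Phi> q)) ` ball 0 r)"
      "\<And>q. q \<in> ball 0 r \<Longrightarrow> \<sigma> (snd (\<Phi> q)) = q"
    and \<sigma>': "\<And>q D. q \<in> ball 0 r \<Longrightarrow> ((\<lambda>q. snd (\<Phi> q)) has_derivative D) (at q) \<Longrightarrow>
       \<exists>E. (\<sigma> has_derivative E) (at (snd (\<Phi> q))) \<and> (\<forall>v. E (D v) = v)"
  proof (rule chol_local_inverse[OF chol_snd_compose[OF \<Phi>\<rho>] \<rho>(1) snd\<Phi>0 d\<Phi>], goal_cases)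
    case (1 r \<sigma>)
    note inv = 1
    show ?case by (rule inv(1)[OF inv(2-8)]; assumption)
  qed
  define V where "V = (\<lambda>q. snd (\<Phi> q)) ` ball 0 r"
  have rsub: "ball 0 r \<subseteq> ball (0 :: complex \<times> complex) \<rho>0" "ball 0 r \<subseteq> ball (0 :: complex \<times> complex) \<rho>"
    using r \<rho>(2) by (auto simp: subset_eq)
  have "0 \<in> V" unfolding V_def using r \<Phi>0 by (intro image_eqI[of _ _ 0]) auto
  then obtain \<epsilon> where \<epsilon>: "\<epsilon> > 0" "ball 0 \<epsilon> \<subseteq> V"
    using op openE unfolding V_def by blast
  define C where "C = (\<lambda>y. fst (\<Phi> (\<sigma> y)))"
  have Vr: "\<sigma> y \<in> ball 0 r \<and> snd (\<Phi> (\<sigma> y)) = y" if "y \<in> V" for y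
    using that \<sigma>(2) unfolding V_def by auto
  have C\<Phi>: "(C y, y) = \<Phi> (\<sigma> y)" if "y \<in> V" for y
    using Vr[OF that] by (simp add: C_def prod_eq_iff)
  \<comment> \<open>The derivative of \<open>C\<close> takes the (y,z)-part of a vector
    \<open>D v\<close> tangent to the image to its x-part. The field at the point is such a vector,
    with \<open>v\<close> equal to \<open>i w2 q\<close>, so it is tangent to the graph.\<close>
  have tang: "\<exists>D. (C has_derivative D) (at y) \<and> D (snd (X (C y, y))) = fst (X (C y, y)) \<and>
      (\<sigma> y = 0 \<longrightarrow> D = (\<lambda>_. 0))" if y: "y \<in> V" for y
  proof -
    define q where "q = \<sigma> y"
    have q: "q \<in> ball 0 r" "snd (\<Phi> q) = y" using Vr[OF y] by (auto simp: q_def)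
    then have q0: "q \<in> ball 0 \<rho>0" using rsub by blast
    obtain D where D: "(\<Phi> has_derivative D) (at q)" using \<Phi> q0 by (meson cholE)
    obtain E where E: "(\<sigma> has_derivative E) (at y)" "\<And>v. E (snd (D v)) = v"
      using \<sigma>'[OF q(1) has_derivative_snd[OF D]] q by auto
    have "((\<lambda>y. \<Phi> (\<sigma> y)) has_derivative (\<lambda>v. D (E v))) (at y)"
      using diff_chain_at[OF E(1), of \<Phi> D] D by (simp add: o_def q_def)
    from has_derivative_fst[OF this] have "(C has_derivative (\<lambda>v. fst (D (E v)))) (at y)"
      by (simp add: C_def)
    moreover have "X (C y, y) = D ((\<i> * of_real w2) *\<^sub>C q)"
      using \<Phi>X[OF q0 D] C\<Phi>[OF y] by (simp add: q_def)
    moreover have "(\<lambda>v. fst (D (E v))) = (\<lambda>_. 0)" if "q = 0"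
    proof -
      have "D = (\<lambda>q. (0, q))" using D \<Phi>0(2) that has_derivative_unique by blast
      then show ?thesis by simp
    qed
    ultimately show ?thesis
      by (intro exI[of _ "\<lambda>v. fst (D (E v))"]) (simp add: E(2) q_def)
  qed
  have "yz_center_manifold X C"
    unfolding yz_center_manifold_def
  proof (intro exI[of _ \<epsilon>] conjI ballI)
    have "\<sigma> ` V \<subseteq> ball 0 \<rho>0" using Vr rsub by blast
    then have "chol C V"
      unfolding C_def by (intro chol_fst_compose chol_compose[OF \<Phi> \<sigma>(1)[folded V_def]])
    then have "chol C (ball 0 \<epsilon>)" using \<epsilon> chol_subset by blast
    then show "holo2 C (ball 0 \<epsilon>)"
      unfolding chol_def holo2_def by (auto simp: split_paired_all) 
    have s0: "\<sigma> 0 = 0" using \<sigma>(2)[of 0] \<Phi>0 r by simp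
    then show "C 0 = 0" by (simp add: C_def \<Phi>0)
    show "(C has_derivative (\<lambda>_. 0)) (at 0)" using tang[OF \<open>0 \<in> V\<close>] s0 by auto
    show "\<exists>D. (C has_derivative D) (at q) \<and> D (fst (snd (X (C q, q))), snd (snd (X (C q, q)))) = fst (X (C q, q))"
      if "q \<in> ball 0 \<epsilon>" for q
      using tang[OF subsetD[OF \<epsilon>(2) that]] by auto
  qed (use \<epsilon> in auto)
  moreover have "yz_isochronous X C (2 * pi / \<bar>w2\<bar>)"
    unfolding yz_isochronous_def
  proof (intro exI[of _ \<epsilon>] conjI allI impI)
    fix y :: "complex \<times> complex" assume y: "0 < norm y \<and> norm y < \<epsilon>"
    then have yV: "y \<in> V" using \<epsilon> by auto
    have "\<sigma> y \<noteq> 0" using Vr[OF yV] \<Phi>0(1) y by auto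
    have "periodic_traj X (\<Phi> (\<sigma> y)) (2 * pi / \<bar>w2\<bar>)"
    proof (rule periodic_traj_of_linear_flow[where \<Phi> = \<Phi> and r = r, OF _ _ _ R(2) w(1)])
      show "\<exists>D. (\<Phi> has_derivative D) (at q) \<and> D ((\<i> * of_real w2) *\<^sub>C q) = X (\<Phi> q)" if "q \<in> ball 0 r" for q
        using \<Phi>X \<Phi> that rsub by (meson cholE subsetD)
      show "inj_on \<Phi> (ball 0 r)" using inj unfolding inj_on_def by metis
      show "\<Phi> q \<in> ball 0 R" if "q \<in> ball 0 r" for q using that rsub(2) \<rho>(2) by blast
    qed (use Vr[OF yV] \<open>\<sigma> y \<noteq> 0\<close> in auto)
    then show "periodic_traj X (C y, y) (2 * pi / \<bar>w2\<bar>)" using C\<Phi>[OF yV] by simp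
  qed (use \<epsilon> in auto)
  ultimately show ?thesis unfolding X_def by blast
qed

section \<open>Briot--Bouquet systems\<close>

type_synonym c2 = "complex \<times> complex"

text \<open>The linear matrix is \<open>b\<close> times the identity because \<open>y\<close> and
  \<open>z\<close> have the same eigenvalue, and \<open>H 0\<close> is the constant vector. All
  nonlinear terms carry a factor \<open>x\<close>, a feature inherited from the blow-up.\<close>

definition bb_form :: "real \<Rightarrow> (c3 \<Rightarrow> c2) \<Rightarrow> (c3 \<Rightarrow> c2) \<Rightarrow> bool" where
  "bb_form b H G \<longleftrightarrow> (\<exists>r>0. chol H (ball 0 r) \<and>
     (\<forall>x w. (x, w) \<in> ball 0 r \<longrightarrow> G (x, w) = of_real b *\<^sub>C w + x *\<^sub>C H (x, w)))"

lemma bb_form_zero: "bb_form b H G \<Longrightarrow> G (0, 0) = 0"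
proof -
  assume "bb_form b H G"
  then obtain r where "r > 0" "\<And>x w. (x, w) \<in> ball 0 r \<Longrightarrow> G (x, w) = of_real b *\<^sub>C w + x *\<^sub>C H (x, w)"
    unfolding bb_form_def by blast
  from this(2)[of 0 0] this(1) show ?thesis by (simp add: zero_prod_def[symmetric])
qed

lemma bb_form_has_derivative:
  assumes "bb_form b H G"
  shows "(G has_derivative (\<lambda>q. of_real b *\<^sub>C snd q + fst q *\<^sub>C H 0)) (at 0)"
proof -
  obtain r where r: "r > 0" "chol H (ball 0 r)"
      "\<And>x w. (x, w) \<in> ball 0 r \<Longrightarrow> G (x, w) = of_real b *\<^sub>C w + x *\<^sub>C H (x, w)"
    using assms unfolding bb_form_def by blast
  obtain D where D: "(H has_derivative D) (at 0)" using r by (meson cholE centre_in_ball)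
  have b: "bounded_linear (\<lambda>q::c3. of_real b *\<^sub>C snd q)"
    by (intro bounded_linear_compose[OF bounded_bilinear.bounded_linear_right[OF bounded_bilinear_cscale]]
          bounded_linear_snd)
  have "((\<lambda>q. of_real b *\<^sub>C snd q + fst q *\<^sub>C H q) has_derivative
      (\<lambda>q. of_real b *\<^sub>C snd q + (fst (0::c3) *\<^sub>C D q + fst q *\<^sub>C H 0))) (at 0)"
    by (rule has_derivative_add[OF bounded_linear_imp_has_derivative[OF b]
          has_derivative_cscale[OF bounded_linear_imp_has_derivative[OF bounded_linear_fst] D]])
  then have "((\<lambda>q. of_real b *\<^sub>C snd q + fst q *\<^sub>C H q) has_derivative
      (\<lambda>q. of_real b *\<^sub>C snd q + fst q *\<^sub>C H 0)) (at 0)" by simp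
  then show ?thesis
    by (rule has_derivative_transform_within_open[OF _ open_ball[of 0 r]])
       (use r in \<open>auto simp: split_paired_all\<close>)
qed

lemma bb_form_const: "bb_form b H G \<Longrightarrow> bb_const G = H 0"
  and bb_form_lin: "bb_form b H G \<Longrightarrow> bb_lin G w = of_real b *\<^sub>C w"
  unfolding bb_const_def bb_lin_def
  by (simp_all add: frechet_derivative_at[OF bb_form_has_derivative, symmetric] zero_prod_def[symmetric])

text \<open>The reduction with a prescribed \<open>c\<close>. At \<open>b = 1\<close> the vector
  \<open>c\<close> is not determined by the equation, and its freedom produces the infinitely many
  solutions.\<close>

definition reduce :: "(c3 \<Rightarrow> c2) \<Rightarrow> c2 \<Rightarrow> c3 \<Rightarrow> c2" where
  "reduce G c = (\<lambda>(x, u, v). if x \<noteq> 0 then red_expr G c x u v else Lim (at 0) (\<lambda>t. red_expr G c t u v))"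

lemma red_expr_eq: "x \<noteq> 0 \<Longrightarrow> red_expr G c x (fst w) (snd w) = (1 / x) *\<^sub>C G (x, x *\<^sub>C (w + c)) - (w + c)"
  by (simp add: red_expr_def prod_eq_iff cscale_prod_def)

lemma chol_divide_by_coordinate_c2:
  fixes H :: "complex \<times> 'a::complex_normed \<Rightarrow> c2"
  assumes H: "chol H (ball 0 r \<times> W)" and r: "r > 0" and W: "open W"
    and zero: "\<And>w. w \<in> W \<Longrightarrow> H (0, w) = 0"
  shows "\<exists>Q. chol Q (ball 0 (r/2) \<times> W) \<and> (\<forall>x\<in>ball 0 (r/2). \<forall>w\<in>W. H (x, w) = x *\<^sub>C Q (x, w))"
proof -
  obtain Q1 where Q1: "chol Q1 (ball 0 (r/2) \<times> W)" "\<forall>x\<in>ball 0 (r/2). \<forall>w\<in>W. fst (H (x, w)) = x * Q1 (x, w)"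
    using chol_divide_by_coordinate[OF chol_fst_compose[OF H] r W] zero by auto
  obtain Q2 where Q2: "chol Q2 (ball 0 (r/2) \<times> W)" "\<forall>x\<in>ball 0 (r/2). \<forall>w\<in>W. snd (H (x, w)) = x * Q2 (x, w)"
    using chol_divide_by_coordinate[OF chol_snd_compose[OF H] r W] zero by auto
  show ?thesis
    using chol_Pair[OF Q1(1) Q2(1)] Q1(2) Q2(2)
    by (intro exI[of _ "\<lambda>q. (Q1 q, Q2 q)"]) (auto simp: prod_eq_iff)
qed

text \<open>After the substitution the right-hand side is
  \<open>(b - 1) w + (H(x, x (w + c)) - (1 - b) c)\<close>. The condition on \<open>c\<close> makes
  the bracket vanish at \<open>x = 0\<close>, so it is \<open>x\<close> times a holomorphic map. The
  same formula evaluates the limit that defines the value at \<open>x = 0\<close>.\<close>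

lemma bb_form_reduce:
  assumes G: "bb_form b H G" and c: "of_real (1 - b) *\<^sub>C c = H 0"
  shows "\<exists>H'. bb_form (b - 1) H' (reduce G c)"
proof -
  obtain r where r: "r > 0" "chol H (ball 0 r)"
      "\<And>x w. (x, w) \<in> ball 0 r \<Longrightarrow> G (x, w) = of_real b *\<^sub>C w + x *\<^sub>C H (x, w)"
    using G unfolding bb_form_def by blast
  \<comment> \<open>For \<open>norm w < 1\<close> the substituted point has norm at most
    \<open>cmod x * (2 + norm c)\<close>.\<close>
  define s where "s = r / (2 + norm c)"
  have nc: "2 + norm c > 0" by (simp add: add_pos_nonneg)
  have s: "s > 0" using r nc by (simp add: s_def)
  define \<tau> where "\<tau> = (\<lambda>q::c3. (fst q, fst q *\<^sub>C (snd q + c)))"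
  define U where "U = ball (0::complex) s \<times> ball (0::c2) 1"
  have U: "open U" unfolding U_def by (intro open_Times open_ball)
  have \<tau>b: "\<tau> q \<in> ball 0 r" if "q \<in> U" for q
  proof -
    have q: "cmod (fst q) < s" "norm (snd q) < 1" using that by (auto simp: U_def)
    have "norm (\<tau> q) \<le> cmod (fst q) + cmod (fst q) * norm (snd q + c)"
      unfolding \<tau>_def norm_cscale[symmetric] by (rule norm_Pair_le)
    also have "\<dots> \<le> cmod (fst q) + cmod (fst q) * (1 + norm c)"
      using q norm_triangle_ineq[of "snd q" c] by (intro add_left_mono mult_left_mono) auto
    also have "\<dots> = cmod (fst q) * (2 + norm c)" by (simp add: algebra_simps)
    also have "\<dots> < s * (2 + norm c)" using q nc by (intro mult_strict_right_mono) auto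
    also have "\<dots> = r" using nc by (simp add: s_def)
    finally show ?thesis by simp
  qed
  have "chol (\<lambda>q. H (\<tau> q) - H 0) U"
  proof (intro chol_diff chol_const U chol_compose[OF r(2)])
    show "chol \<tau> U" unfolding \<tau>_def
      by (intro chol_Pair chol_cscale chol_add chol_fst chol_snd chol_const U)
    show "\<tau> ` U \<subseteq> ball 0 r" using \<tau>b by blast
  qed
  from chol_divide_by_coordinate_c2[OF this[unfolded U_def] s open_ball]
  obtain H' where H': "chol H' (ball 0 (s/2) \<times> ball 0 1)"
      "\<And>x w. x \<in> ball 0 (s/2) \<Longrightarrow> w \<in> ball 0 1 \<Longrightarrow> H (\<tau> (x, w)) - H 0 = x *\<^sub>C H' (x, w)"
    by (auto simp: \<tau>_def zero_prod_def[symmetric])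
  have eq: "red_expr G c x (fst w) (snd w) = of_real (b - 1) *\<^sub>C w + x *\<^sub>C H' (x, w)"
    if x: "x \<in> ball 0 (s/2)" "x \<noteq> 0" and w: "w \<in> ball 0 1" for x w
  proof -
    have "(x, w) \<in> U" using x w s by (auto simp: U_def)
    then have "(x, x *\<^sub>C (w + c)) \<in> ball 0 r" using \<tau>b[of "(x, w)"] by (simp add: \<tau>_def)
    then have "G (x, x *\<^sub>C (w + c)) = of_real b *\<^sub>C x *\<^sub>C (w + c) + x *\<^sub>C H (\<tau> (x, w))"
      by (simp add: r \<tau>_def)
    then have "red_expr G c x (fst w) (snd w) = of_real b *\<^sub>C (w + c) + H (\<tau> (x, w)) - (w + c)"
      unfolding red_expr_eq[OF x(2)] using x(2) by (simp add: cscale_add_right cscale_cscale mult.commute)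
    also have "\<dots> = of_real (b - 1) *\<^sub>C w + (H (\<tau> (x, w)) - of_real (1 - b) *\<^sub>C c)"
      by (simp add: prod_eq_iff algebra_simps)
    also have "\<dots> = of_real (b - 1) *\<^sub>C w + x *\<^sub>C H' (x, w)"
      using H'(2)[OF x(1) w] unfolding c by simp
    finally show ?thesis .
  qed
  define r' where "r' = min (s/2) 1"
  have sub: "q \<in> ball 0 r' \<Longrightarrow> q \<in> ball 0 (s/2) \<times> ball 0 1" for q :: c3
    using norm_fst_le'[of q] norm_snd_le'[of q] by (auto simp: r'_def mem_Times_iff)
  have "reduce G c (x, w) = of_real (b - 1) *\<^sub>C w + x *\<^sub>C H' (x, w)" if "(x, w) \<in> ball 0 r'" for x w
  proof (cases "x = 0")
    case False
    then show ?thesis using eq[of x w] sub[OF that] by (simp add: reduce_def case_prod_beta)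
  next
    case True
    have w: "w \<in> ball 0 1" using sub[OF that] by auto
    have "chol (\<lambda>t. of_real (b - 1) *\<^sub>C w + t *\<^sub>C H' (t, w)) (ball 0 (s/2))"
      by (intro chol_add chol_const chol_cscale chol_id open_ball chol_compose[OF H'(1)] chol_Pair)
         (use w in auto)
    then have "continuous_on (ball 0 (s/2)) (\<lambda>t. of_real (b - 1) *\<^sub>C w + t *\<^sub>C H' (t, w))"
      by (rule chol_imp_continuous_on)
    then have "isCont (\<lambda>t. of_real (b - 1) *\<^sub>C w + t *\<^sub>C H' (t, w)) 0"
      using s by (simp add: continuous_on_eq_continuous_at)
    then have "((\<lambda>t. of_real (b - 1) *\<^sub>C w + t *\<^sub>C H' (t, w)) \<longlongrightarrow> of_real (b - 1) *\<^sub>C w) (at 0)"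
      by (simp add: isCont_def)
    then have "((\<lambda>t. red_expr G c t (fst w) (snd w)) \<longlongrightarrow> of_real (b - 1) *\<^sub>C w) (at 0)"
    proof (rule Lim_transform_eventually)
      show "\<forall>\<^sub>F t in at 0. of_real (b - 1) *\<^sub>C w + t *\<^sub>C H' (t, w) = red_expr G c t (fst w) (snd w)"
        unfolding eventually_at by (intro exI[of _ "s/2"]) (use eq w s in \<open>auto simp: dist_norm\<close>)
    qed
    then have "Lim (at 0) (\<lambda>t. red_expr G c t (fst w) (snd w)) = of_real (b - 1) *\<^sub>C w"
      by (intro tendsto_Lim) auto
    then show ?thesis using True by (simp add: reduce_def case_prod_beta)
  qed
  moreover have "chol H' (ball 0 r')"
    using sub by (intro chol_subset[OF H'(1)]) auto
  moreover have "r' > 0" using s by (simp add: r'_def)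
  ultimately show ?thesis unfolding bb_form_def by blast
qed

lemma reduction_step_eq_reduce:
  assumes "bb_form b H G" "b \<noteq> 1"
  shows "reduction_step G = reduce G ((1 / of_real (1 - b)) *\<^sub>C H 0)"
proof -
  have "c - bb_lin G c = bb_const G \<longleftrightarrow> c = (1 / of_real (1 - b)) *\<^sub>C H 0" for c
  proof -
    have "c - bb_lin G c = of_real (1 - b) *\<^sub>C c"
      by (simp add: bb_form_lin[OF assms(1)] prod_eq_iff algebra_simps)
    moreover have "of_real (1 - b) *\<^sub>C c = H 0 \<longleftrightarrow> c = (1 / of_real (1 - b)) *\<^sub>C H 0"
      using assms(2) by (auto simp: prod_eq_iff field_simps)
    ultimately show ?thesis by (simp add: bb_form_const[OF assms(1)])
  qed
  then have "(THE c. c - bb_lin G c = bb_const G) = (1 / of_real (1 - b)) *\<^sub>C H 0" by simp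
  then show ?thesis unfolding reduction_step_def reduce_def Let_def by (simp only:)
qed

section \<open>Solutions and their transfer under reduction\<close>

definition bb_sol :: "(c3 \<Rightarrow> c2) \<Rightarrow> (complex \<Rightarrow> c2) \<Rightarrow> bool" where
  "bb_sol G w \<longleftrightarrow> (\<exists>r>0. (\<lambda>x. fst (w x)) holomorphic_on ball 0 r \<and> (\<lambda>x. snd (w x)) holomorphic_on ball 0 r \<and>
     w 0 = 0 \<and> (\<forall>x\<in>ball 0 r. (x * deriv (\<lambda>x. fst (w x)) x, x * deriv (\<lambda>x. snd (w x)) x) = G (x, w x)))"

lemma deriv_ident_mult:
  assumes "f holomorphic_on ball 0 r" "x \<in> ball 0 r"
  shows "deriv (\<lambda>x. x * (f x + c)) x = f x + c + x * deriv f x"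
proof (rule DERIV_imp_deriv)
  have "(f has_field_derivative deriv f x) (at x)"
    using assms by (intro holomorphic_derivI[where S = "ball 0 r"]) auto
  then show "((\<lambda>x. x * (f x + c)) has_field_derivative f x + c + x * deriv f x) (at x)"
    by (auto intro!: derivative_eq_intros)
qed

lemma bb_sol_lift:
  assumes G: "bb_form b H G" and w: "bb_sol (reduce G c) w"
  shows "bb_sol G (\<lambda>x. x *\<^sub>C (w x + c))"
proof -
  obtain r where r: "r > 0" "(\<lambda>x. fst (w x)) holomorphic_on ball 0 r" "(\<lambda>x. snd (w x)) holomorphic_on ball 0 r"
      "w 0 = 0" "\<And>x. x \<in> ball 0 r \<Longrightarrow>
        (x * deriv (\<lambda>x. fst (w x)) x, x * deriv (\<lambda>x. snd (w x)) x) = reduce G c (x, w x)"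
    using w unfolding bb_sol_def by blast
  have "(x * deriv (\<lambda>x. fst (x *\<^sub>C (w x + c))) x, x * deriv (\<lambda>x. snd (x *\<^sub>C (w x + c))) x) = G (x, x *\<^sub>C (w x + c))"
    if x: "x \<in> ball 0 r" for x
  proof (cases "x = 0")
    case True
    then show ?thesis using bb_form_zero[OF G] by (simp add: zero_prod_def)
  next
    case False
    have "(x * deriv (\<lambda>x. fst (w x)) x, x * deriv (\<lambda>x. snd (w x)) x)
        = (1 / x) *\<^sub>C G (x, x *\<^sub>C (w x + c)) - (w x + c)"
      using r(5)[OF x] False red_expr_eq[OF False, of G c "w x"] by (simp add: reduce_def case_prod_beta)
    then have "fst (w x) + fst c + x * deriv (\<lambda>x. fst (w x)) x = fst (G (x, x *\<^sub>C (w x + c))) / x"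
        "snd (w x) + snd c + x * deriv (\<lambda>x. snd (w x)) x = snd (G (x, x *\<^sub>C (w x + c))) / x"
      by (auto simp: prod_eq_iff)
    then show ?thesis
      using False by (simp add: deriv_ident_mult[OF r(2) x] deriv_ident_mult[OF r(3) x] prod_eq_iff)
  qed
  moreover have "(\<lambda>x. fst (x *\<^sub>C (w x + c))) holomorphic_on ball 0 r"
      "(\<lambda>x. snd (x *\<^sub>C (w x + c))) holomorphic_on ball 0 r"
    using r(2,3) by (auto intro!: holomorphic_intros)
  ultimately show ?thesis unfolding bb_sol_def using r(1) by (intro exI[of _ r]) auto
qed

lemma holomorphic_quotient_at_zero:
  assumes "f holomorphic_on ball 0 r" "r > 0" "f 0 = 0"
  shows "(\<lambda>x. if x = 0 then deriv f 0 else f x / x) holomorphic_on ball 0 r"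
  by (rule pole_theorem_0[OF assms(1), where a = 0]) (use assms in auto)

text \<open>A solution vanishing at 0 is \<open>x\<close> times a holomorphic map, and
  \<open>c\<close> is the value of that map at 0. Dividing the equation by \<open>x\<close> and
  letting \<open>x\<close> tend to 0 forces \<open>(1 - b) c = H 0\<close>; for \<open>b = 1\<close>
  this is the obstruction \<open>H 0 = 0\<close>.\<close>

lemma bb_sol_descend:
  assumes G: "bb_form b H G" and w: "bb_sol G w"
  shows "\<exists>c w'. of_real (1 - b) *\<^sub>C c = H 0 \<and> bb_sol (reduce G c) w'"
proof -
  obtain r1 where r1: "r1 > 0" "chol H (ball 0 r1)"
      "\<And>x w. (x, w) \<in> ball 0 r1 \<Longrightarrow> G (x, w) = of_real b *\<^sub>C w + x *\<^sub>C H (x, w)"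
    using G unfolding bb_form_def by blast
  obtain r where r: "r > 0" "(\<lambda>x. fst (w x)) holomorphic_on ball 0 r" "(\<lambda>x. snd (w x)) holomorphic_on ball 0 r"
      "w 0 = 0" "\<And>x. x \<in> ball 0 r \<Longrightarrow>
        (x * deriv (\<lambda>x. fst (w x)) x, x * deriv (\<lambda>x. snd (w x)) x) = G (x, w x)"
    using w unfolding bb_sol_def by blast
  define c where "c = (deriv (\<lambda>x. fst (w x)) 0, deriv (\<lambda>x. snd (w x)) 0)"
  define p where "p = (\<lambda>x. if x = 0 then deriv (\<lambda>x. fst (w x)) 0 else fst (w x) / x)"
  define q where "q = (\<lambda>x. if x = 0 then deriv (\<lambda>x. snd (w x)) 0 else snd (w x) / x)"
  have hp: "p holomorphic_on ball 0 r" and hq: "q holomorphic_on ball 0 r"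
    unfolding p_def q_def using r by (intro holomorphic_quotient_at_zero; simp)+
  have w_eq: "w x = x *\<^sub>C (p x, q x)" for x
    using r(4) by (simp add: p_def q_def prod_eq_iff)
  have dw: "deriv (\<lambda>x. fst (w x)) x = p x + x * deriv p x" "deriv (\<lambda>x. snd (w x)) x = q x + x * deriv q x"
    if "x \<in> ball 0 r" for x
    using deriv_ident_mult[OF hp that, of 0] deriv_ident_mult[OF hq that, of 0] by (simp_all add: w_eq)
  have c_eq: "of_real (1 - b) *\<^sub>C c = H 0"
  proof -
    \<comment> \<open>The difference of both sides of the equation after division by
      \<open>x\<close>. It vanishes for small \<open>x \<noteq> 0\<close>, so its limit at 0 does
      too.\<close>
    define \<theta> where "\<theta> = (\<lambda>x. (p x + x * deriv p x, q x + x * deriv q x) - of_real b *\<^sub>C (p x, q x) - H (x, x *\<^sub>C (p x, q x)))"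
    have cp: "isCont p 0" "isCont q 0" "isCont (deriv p) 0" "isCont (deriv q) 0"
      using holomorphic_on_imp_continuous_on[OF hp] holomorphic_on_imp_continuous_on[OF hq]
        holomorphic_on_imp_continuous_on[OF holomorphic_deriv[OF hp open_ball]]
        holomorphic_on_imp_continuous_on[OF holomorphic_deriv[OF hq open_ball]] r(1)
      by (auto simp: continuous_on_eq_continuous_at)
    have "isCont H 0" using chol_imp_continuous_on[OF r1(2)] r1(1) by (simp add: continuous_on_eq_continuous_at)
    then have "((\<lambda>x. H (x, x *\<^sub>C (p x, q x))) \<longlongrightarrow> H 0) (at 0)"
    proof (rule isCont_tendsto_compose)
      have "((\<lambda>x. (x, x *\<^sub>C (p x, q x))) \<longlongrightarrow> (0, 0 *\<^sub>C (p 0, q 0))) (at 0)"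
        using cp unfolding isCont_def by (intro tendsto_intros)
      then show "((\<lambda>x. (x, x *\<^sub>C (p x, q x))) \<longlongrightarrow> 0) (at 0)"
        by (simp only: cscale_zero_left zero_prod_def[symmetric])
    qed
    then have lim: "(\<theta> \<longlongrightarrow> (p 0 + 0 * deriv p 0, q 0 + 0 * deriv q 0) - of_real b *\<^sub>C (p 0, q 0) - H 0) (at 0)"
      unfolding \<theta>_def using cp unfolding isCont_def by (intro tendsto_intros)
    have "open ((\<lambda>x. (x, w x)) -` ball 0 r1 \<inter> ball 0 r)"
    proof -
      have "continuous_on (ball 0 r) (\<lambda>x. (x, x *\<^sub>C (p x, q x)))"
        by (intro continuous_intros holomorphic_on_imp_continuous_on hp hq)
      then have "continuous_on (ball 0 r) (\<lambda>x. (x, w x))" by (simp add: w_eq)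
      then show ?thesis by (metis Int_commute continuous_open_preimage open_ball)
    qed
    moreover have "0 \<in> (\<lambda>x. (x, w x)) -` ball 0 r1 \<inter> ball 0 r"
      using r r1(1) by (simp add: zero_prod_def[symmetric])
    ultimately have "\<forall>\<^sub>F x in at 0. x \<in> (\<lambda>x. (x, w x)) -` ball 0 r1 \<inter> ball 0 r"
      by (rule eventually_at_in_open')
    moreover have "\<forall>\<^sub>F x in at 0. x \<noteq> (0::complex)" by (simp add: eventually_at_filter)
    ultimately have "\<forall>\<^sub>F x in at 0. \<theta> x = 0"
    proof eventually_elim
      case (elim x)
      have "G (x, w x) = of_real b *\<^sub>C w x + x *\<^sub>C H (x, w x)" using elim by (intro r1(3)) auto
      moreover have "(x * deriv (\<lambda>x. fst (w x)) x, x * deriv (\<lambda>x. snd (w x)) x) = G (x, w x)"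
        using elim by (intro r(5)) auto
      moreover have "x \<in> ball 0 r" using elim by auto
      ultimately have "x *\<^sub>C \<theta> x = 0"
        using dw[of x] by (simp add: \<theta>_def prod_eq_iff w_eq algebra_simps)
      then show ?case using elim by (simp add: prod_eq_iff)
    qed
    then have "(\<theta> \<longlongrightarrow> 0) (at 0)" by (rule tendsto_eventually)
    with lim have "(p 0 + 0 * deriv p 0, q 0 + 0 * deriv q 0) - of_real b *\<^sub>C (p 0, q 0) - H 0 = 0"
      by (rule tendsto_unique[OF at_neq_bot])
    then show ?thesis by (simp add: c_def p_def q_def prod_eq_iff algebra_simps)
  qed
  obtain H' where H': "bb_form (b - 1) H' (reduce G c)" using bb_form_reduce[OF G c_eq] by blast
  define w' where "w' = (\<lambda>x. (p x, q x) - c)"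
  have w'c: "w' x + c = (p x, q x)" for x by (simp add: w'_def)
  have "w' 0 = 0" by (simp add: w'_def c_def p_def q_def zero_prod_def)
  have dw': "deriv (\<lambda>x. fst (w' x)) x = deriv p x" "deriv (\<lambda>x. snd (w' x)) x = deriv q x" if "x \<in> ball 0 r" for x
    using hp hq that by (auto simp: w'_def holomorphic_on_imp_differentiable_at)
  have "(x * deriv (\<lambda>x. fst (w' x)) x, x * deriv (\<lambda>x. snd (w' x)) x) = reduce G c (x, w' x)"
    if x: "x \<in> ball 0 r" for x
  proof (cases "x = 0")
    case True
    then show ?thesis using bb_form_zero[OF H'] \<open>w' 0 = 0\<close> by (simp add: zero_prod_def)
  next
    case False
    have "reduce G c (x, w' x) = (1 / x) *\<^sub>C G (x, w x) - (p x, q x)"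
      using red_expr_eq[OF False, of G c "w' x"] False by (simp add: reduce_def case_prod_beta w'c w_eq)
    also have "G (x, w x) = x *\<^sub>C (p x + x * deriv p x, q x + x * deriv q x)"
      using r(5)[OF x] dw[OF x] by simp
    finally show ?thesis using False dw'[OF x] by simp
  qed
  moreover have "(\<lambda>x. fst (w' x)) holomorphic_on ball 0 r" "(\<lambda>x. snd (w' x)) holomorphic_on ball 0 r"
    using hp hq by (auto simp: w'_def intro!: holomorphic_intros)
  ultimately have "bb_sol (reduce G c) w'"
    unfolding bb_sol_def using r(1) \<open>w' 0 = 0\<close> by blast
  with c_eq show ?thesis by blast
qed

text \<open>Directly the singular equation with exponent \<open>- b\<close>. Its third component is
  filled with the trivial equation, and its parameter is set to 0.\<close>

lemma bb_sol_exists_nonpos: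
  assumes G: "bb_form b H G" and b: "b \<le> 0"
  shows "\<exists>w. bb_sol G w"
proof -
  obtain r where r: "r > 0" "chol H (ball 0 r)"
      "\<And>x w. (x, w) \<in> ball 0 r \<Longrightarrow> G (x, w) = of_real b *\<^sub>C w + x *\<^sub>C H (x, w)"
    using G unfolding bb_form_def by blast
  define \<tau> where "\<tau> = (\<lambda>q :: complex \<times> c3 \<times> c2. (fst q, fst (fst (snd q)), fst (snd (fst (snd q)))))"
  define K where "K = (\<lambda>q. (fst (H (\<tau> q)), snd (H (\<tau> q)), 0::complex))"
  have n\<tau>: "norm (\<tau> q) \<le> norm q" for q
  proof -
    have "norm (fst (fst (snd q)), fst (snd (fst (snd q)))) \<le> norm (fst (snd q))"
      by (cases q) (auto simp: norm_Pair split: prod.splits)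
    then have "norm (\<tau> q) \<le> norm (fst q, fst (snd q))"
      unfolding \<tau>_def norm_Pair by (intro real_sqrt_le_mono add_left_mono power_mono) auto
    also have "\<dots> \<le> norm q"
      by (cases q) (auto simp: norm_Pair split: prod.splits)
    finally show ?thesis .
  qed
  have \<tau>: "chol \<tau> (ball 0 r)"
    unfolding \<tau>_def by (intro chol_Pair chol_fst_compose chol_snd_compose chol_id open_ball)
  have "\<tau> ` ball 0 r \<subseteq> ball 0 r"
    using le_less_trans[OF n\<tau>] by (intro image_subsetI) simp
  from chol_compose[OF r(2) \<tau> this] have "chol (\<lambda>q. H (\<tau> q)) (ball 0 r)" .
  then have K: "chol K (ball 0 r)"
    unfolding K_def by (intro chol_Pair chol_const open_ball chol_fst_compose[of "\<lambda>q. H (\<tau> q)"]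
        chol_snd_compose[of "\<lambda>q. H (\<tau> q)"])
  have b': "- b \<ge> 0" using b by simp
  obtain \<rho> \<Omega> where \<rho>: "\<rho> > 0" and \<Omega>: "chol \<Omega> (ball 0 \<rho> \<times> ball 0 \<rho>)"
    and inr: "\<And>s e. s \<in> ball 0 \<rho> \<Longrightarrow> e \<in> ball 0 \<rho> \<Longrightarrow> (s, \<Omega> (s, e), e) \<in> ball 0 r"
    and \<Omega>0: "\<And>e. e \<in> ball 0 \<rho> \<Longrightarrow> \<Omega> (0, e) = 0"
    and ode1: "\<And>s e. s \<in> ball 0 \<rho> \<Longrightarrow> e \<in> ball 0 \<rho> \<Longrightarrow> \<exists>d1. ((\<lambda>s. fst (\<Omega> (s, e))) has_field_derivative d1) (at s) \<and>
           s * d1 = - of_real (- b) * fst (\<Omega> (s, e)) + s * fst (K (s, \<Omega> (s, e), e))"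
    and ode2: "\<And>s e. s \<in> ball 0 \<rho> \<Longrightarrow> e \<in> ball 0 \<rho> \<Longrightarrow> \<exists>d2. ((\<lambda>s. fst (snd (\<Omega> (s, e)))) has_field_derivative d2) (at s) \<and>
           s * d2 = - of_real (- b) * fst (snd (\<Omega> (s, e))) + s * fst (snd (K (s, \<Omega> (s, e), e)))"
  proof (rule singular_ode_solution[OF K r(1) b' b' order_refl], goal_cases)
    case (1 \<rho> \<Omega>)
    note sol = 1
    show ?case by (rule sol(1)[OF sol(2-7)]; assumption)
  qed
  define w where "w = (\<lambda>x. (fst (\<Omega> (x, 0)), fst (snd (\<Omega> (x, 0)))))"
  have z: "(0::c2) \<in> ball 0 \<rho>" using \<rho> by simp
  have eq: "((\<lambda>x. fst (w x)) has_field_derivative deriv (\<lambda>x. fst (w x)) x) (at x) \<and>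
      ((\<lambda>x. snd (w x)) has_field_derivative deriv (\<lambda>x. snd (w x)) x) (at x) \<and>
      (x * deriv (\<lambda>x. fst (w x)) x, x * deriv (\<lambda>x. snd (w x)) x) = G (x, w x)" if x: "x \<in> ball 0 \<rho>" for x
  proof -
    obtain d1 where d1: "((\<lambda>x. fst (w x)) has_field_derivative d1) (at x)"
        "x * d1 = of_real b * fst (w x) + x * fst (K (x, \<Omega> (x, 0), 0))"
      using ode1[OF x z] by (auto simp: w_def)
    obtain d2 where d2: "((\<lambda>x. snd (w x)) has_field_derivative d2) (at x)"
        "x * d2 = of_real b * snd (w x) + x * fst (snd (K (x, \<Omega> (x, 0), 0)))"
      using ode2[OF x z] by (auto simp: w_def)
    have t: "\<tau> (x, \<Omega> (x, 0), 0) = (x, w x)" by (simp add: \<tau>_def w_def)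
    have "norm (x, w x) < r" using n\<tau>[of "(x, \<Omega> (x, 0), 0)"] inr[OF x z] unfolding t by simp
    then have "G (x, w x) = of_real b *\<^sub>C w x + x *\<^sub>C H (x, w x)" by (intro r(3)) simp
    then show ?thesis
      using d1 d2 by (simp add: DERIV_imp_deriv[OF d1(1)] DERIV_imp_deriv[OF d2(1)] K_def t prod_eq_iff)
  qed
  have "bb_sol G w"
    unfolding bb_sol_def
  proof (intro exI[of _ \<rho>] conjI \<rho> ballI)
    show "w 0 = 0" using \<Omega>0[OF z] by (simp add: w_def zero_prod_def)
    show "(\<lambda>x. fst (w x)) holomorphic_on ball 0 \<rho>" "(\<lambda>x. snd (w x)) holomorphic_on ball 0 \<rho>"
      unfolding holomorphic_on_open[OF open_ball] using eq by blast+
  qed (use eq in blast)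
  then show ?thesis by blast
qed

text \<open>Each reduction lowers \<open>b\<close> by one until it is at most 0; since
  \<open>b\<close> is no positive integer, the value 1 is never met on the way. The solution found
  at the end is lifted back through all steps.\<close>

lemma bb_sol_exists:
  assumes "bb_form b H G" and "\<And>k::nat. k > 0 \<Longrightarrow> b \<noteq> real k"
  shows "\<exists>w. bb_sol G w"
proof -
  have "\<exists>w. bb_sol G w" if "b \<le> real n" "bb_form b H G" "\<And>k::nat. k > 0 \<Longrightarrow> b \<noteq> real k" for n b H G
    using that
  proof (induction n arbitrary: b H G)
    case 0
    then show ?case using bb_sol_exists_nonpos by auto
  next
    case (Suc n)
    have b1: "b \<noteq> 1" using Suc.prems(3)[of 1] by simp
    define c where "c = (1 / of_real (1 - b)) *\<^sub>C H 0"
    have c: "of_real (1 - b) *\<^sub>C c = H 0"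
      using b1 by (simp add: c_def prod_eq_iff)
    obtain H' where H': "bb_form (b - 1) H' (reduce G c)" using bb_form_reduce[OF Suc.prems(2) c] by blast
    have "\<exists>w. bb_sol (reduce G c) w"
    proof (rule Suc.IH[OF _ H'])
      show "b - 1 \<noteq> real k" if "k > 0" for k using Suc.prems(3)[of "Suc k"] by auto
    qed (use Suc.prems in auto)
    then show ?case using bb_sol_lift[OF Suc.prems(2)] by blast
  qed
  moreover obtain n :: nat where "b \<le> real n" using real_arch_simple by blast
  ultimately show ?thesis using assms by blast
qed

text \<open>Distinctness is tested near 0 because functions representing the same germ may differ
  elsewhere.\<close>

definition inf_sols :: "(c3 \<Rightarrow> c2) \<Rightarrow> bool" where
  "inf_sols G \<longleftrightarrow> (\<exists>S :: nat \<Rightarrow> complex \<Rightarrow> c2. (\<forall>n. bb_sol G (S n)) \<and>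
     (\<forall>m n. m \<noteq> n \<longrightarrow> \<not> (\<forall>\<^sub>F x in nhds 0. S m x = S n x)))"

section \<open>Infinitely many solutions and resonance\<close>

lemma eventually_at_cscale_cancel:
  fixes f g :: "complex \<Rightarrow> c2"
  assumes "\<forall>\<^sub>F x in nhds 0. x *\<^sub>C f x = x *\<^sub>C g x"
  shows "\<forall>\<^sub>F x in at 0. f x = g x"
  using assms unfolding eventually_at_filter by eventually_elim (auto simp: prod_eq_iff)

lemma inf_sols_lift:
  assumes G: "bb_form b H G" and inf: "inf_sols (reduce G c)"
  shows "inf_sols G"
proof -
  obtain S :: "nat \<Rightarrow> complex \<Rightarrow> c2" where S: "\<And>n. bb_sol (reduce G c) (S n)"
      "\<And>m n. m \<noteq> n \<Longrightarrow> \<not> (\<forall>\<^sub>F x in nhds 0. S m x = S n x)"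
    using inf unfolding inf_sols_def by blast
  have S0: "S n 0 = 0" for n using S(1)[of n] unfolding bb_sol_def by blast
  have "\<not> (\<forall>\<^sub>F x in nhds 0. x *\<^sub>C (S m x + c) = x *\<^sub>C (S n x + c))" if "m \<noteq> n" for m n
  proof
    assume "\<forall>\<^sub>F x in nhds 0. x *\<^sub>C (S m x + c) = x *\<^sub>C (S n x + c)"
    then have "\<forall>\<^sub>F x in at 0. S m x = S n x"
      using eventually_at_cscale_cancel[of "\<lambda>x. S m x + c" "\<lambda>x. S n x + c"] by simp
    \<comment> \<open>Cancelling \<open>x\<close> gives agreement off 0 only; at 0 itself all
      solutions vanish.\<close>
    then have "\<forall>\<^sub>F x in nhds 0. S m x = S n x"
      unfolding eventually_at_filter by eventually_elim (metis S0 UNIV_I)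
    with S(2)[OF that] show False by blast
  qed
  with bb_sol_lift[OF G S(1)] show ?thesis
    unfolding inf_sols_def by (intro exI[of _ "\<lambda>n x. x *\<^sub>C (S n x + c)"]) auto
qed

lemma bb_sol_isCont: "bb_sol G w \<Longrightarrow> isCont w 0"
proof -
  assume "bb_sol G w"
  then obtain r where r: "r > 0" "(\<lambda>x. fst (w x)) holomorphic_on ball 0 r" "(\<lambda>x. snd (w x)) holomorphic_on ball 0 r"
    unfolding bb_sol_def by blast
  then have "continuous_on (ball 0 r) (\<lambda>x. (fst (w x), snd (w x)))"
    by (intro continuous_intros holomorphic_on_imp_continuous_on)
  then show "isCont w 0" using r(1) by (simp add: continuous_on_eq_continuous_at)
qed

text \<open>For \<open>b = 1\<close> and vanishing constant vector every \<open>c\<close> is admissible in the substitution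
  \<open>w = x(w' + c)\<close>.\<close>

lemma inf_sols_resonant:
  assumes G: "bb_form 1 H G" and H0: "H 0 = 0"
  shows "inf_sols G"
proof -
  \<comment> \<open>Any sequence of distinct vectors would serve: \<open>c n\<close> is the
    derivative at 0 of the lifted solution and so distinguishes the germs.\<close>
  define c where "c = (\<lambda>n::nat. (of_nat n, 0) :: c2)"
  have "\<exists>w. bb_sol (reduce G (c n)) w" for n
  proof -
    obtain H' where "bb_form (1 - 1) H' (reduce G (c n))"
      using bb_form_reduce[OF G, of "c n"] H0 by auto
    then show ?thesis using bb_sol_exists_nonpos by auto
  qed
  then obtain w where w: "\<And>n. bb_sol (reduce G (c n)) (w n)" by metis
  have w0: "w n 0 = 0" for n using w[of n] unfolding bb_sol_def by blast
  have "\<not> (\<forall>\<^sub>F x in nhds 0. x *\<^sub>C (w m x + c m) = x *\<^sub>C (w n x + c n))" if "m \<noteq> n" for m n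
  proof
    assume "\<forall>\<^sub>F x in nhds 0. x *\<^sub>C (w m x + c m) = x *\<^sub>C (w n x + c n)"
    then have ev: "\<forall>\<^sub>F x in at 0. w m x + c m = w n x + c n" by (rule eventually_at_cscale_cancel)
    have lim: "((\<lambda>x. w k x + c k) \<longlongrightarrow> 0 + c k) (at 0)" for k
      using bb_sol_isCont[OF w[of k]] w0[of k] by (intro tendsto_add tendsto_const) (simp add: isCont_def)
    have "((\<lambda>x. w n x + c n) \<longlongrightarrow> 0 + c m) (at 0)"
      by (rule Lim_transform_eventually[OF lim ev])
    then have "0 + c m = 0 + c n" by (rule tendsto_unique[OF at_neq_bot _ lim])
    then show False using that by (simp add: c_def)
  qed
  with bb_sol_lift[OF G w] show ?thesis
    unfolding inf_sols_def by (intro exI[of _ "\<lambda>n x. x *\<^sub>C (w n x + c n)"]) auto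
qed

text \<open>For \<open>j = 0\<close> the exponent is 1, where the first-order terms decide. For
  larger \<open>j\<close> the vector \<open>c\<close> is forced, so solutions exist for the system
  exactly when they exist for its reduction, and infinite families lift.\<close>

lemma bb_resonance_dichotomy:
  assumes "bb_form (real j + 1) H G"
  shows "(bb_const ((reduction_step ^^ j) G) = 0 \<longrightarrow> inf_sols G) \<and>
    (bb_const ((reduction_step ^^ j) G) \<noteq> 0 \<longrightarrow> \<not> (\<exists>w. bb_sol G w))"
  using assms
proof (induction j arbitrary: H G)
  case 0
  then have G: "bb_form 1 H G" by simp
  have "H 0 = 0" if "bb_sol G w" for w
    using bb_sol_descend[OF G that] by auto
  then show ?case using inf_sols_resonant[OF G] bb_form_const[OF G] by auto
next
  case (Suc j)
  define b where "b = real (Suc j) + 1"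
  have G: "bb_form b H G" using Suc.prems by (simp add: b_def)
  have b1: "b \<noteq> 1" by (simp add: b_def)
  define c where "c = (1 / of_real (1 - b)) *\<^sub>C H 0"
  have c: "of_real (1 - b) *\<^sub>C c' = H 0 \<longleftrightarrow> c' = c" for c'
    using b1 by (auto simp: c_def prod_eq_iff field_simps)
  have red: "reduction_step G = reduce G c"
    unfolding c_def by (rule reduction_step_eq_reduce[OF G b1])
  obtain H' where "bb_form (b - 1) H' (reduce G c)" using bb_form_reduce[OF G] c by blast
  then have H': "bb_form (real j + 1) H' (reduce G c)" by (simp add: b_def add.commute)
  \<comment> \<open>The first reduction is split off on the inside, so that the induction
    hypothesis, general in the system, applies to the reduced one.\<close>
  have step: "(reduction_step ^^ Suc j) G = (reduction_step ^^ j) (reduce G c)"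
    by (simp only: funpow_Suc_right o_apply red)
  have "\<exists>w. bb_sol (reduce G c) w" if "bb_sol G w" for w
    using bb_sol_descend[OF G that] by (simp add: c del: of_real_diff)
  then show ?case
    unfolding step using Suc.IH[OF H'] inf_sols_lift[OF G] by blast
qed

text \<open>At \<open>(x, x u, x v)\<close> every component of the field has a factor
  \<open>x\<close>, and after cancelling it the denominator tends to \<open>i w1\<close>, which is
  nonzero. The second claim permits passing between the quotient in the Briot--Bouquet system and
  the undivided invariance equation.\<close>

lemma bb_x_form:
  assumes fgh: "hol_order2 f" "hol_order2 g" "hol_order2 h" and w: "w1 \<noteq> 0"
  shows "\<exists>H. bb_form (w2 / w1 - 1) H (bb_x (sys w1 w2 f g h)) \<and>
    (\<exists>r>0. \<forall>x u v. x \<noteq> 0 \<longrightarrow> (x, u, v) \<in> ball 0 r \<longrightarrow> fst (sys w1 w2 f g h (x, x * u, x * v)) \<noteq> 0)"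
proof -
  define X where "X = sys w1 w2 f g h"
  obtain r1 k1 where 1: "r1 > 0" "chol k1 (ball 0 r1 \<times> ball 0 4)"
    "\<And>s p. s \<in> ball 0 r1 \<Longrightarrow> p \<in> ball 0 4 \<Longrightarrow> f (s *\<^sub>C p) = s * s * k1 (s, p)"
    using hol_order2_blowup[OF fgh(1)] by blast
  obtain r2 k2 where 2: "r2 > 0" "chol k2 (ball 0 r2 \<times> ball 0 4)"
    "\<And>s p. s \<in> ball 0 r2 \<Longrightarrow> p \<in> ball 0 4 \<Longrightarrow> g (s *\<^sub>C p) = s * s * k2 (s, p)"
    using hol_order2_blowup[OF fgh(2)] by blast
  obtain r3 k3 where 3: "r3 > 0" "chol k3 (ball 0 r3 \<times> ball 0 4)"
    "\<And>s p. s \<in> ball 0 r3 \<Longrightarrow> p \<in> ball 0 4 \<Longrightarrow> h (s *\<^sub>C p) = s * s * k3 (s, p)"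
    using hol_order2_blowup[OF fgh(3)] by blast
  define r0 where "r0 = min (min r1 r2) (min r3 1)"
  have r0: "r0 > 0" using 1 2 3 by (simp add: r0_def)
  define \<tau> where "\<tau> = (\<lambda>q::c3. (fst q, (1::complex, snd q)))"
  have \<tau>hol: "chol \<tau> (ball 0 r0)"
    unfolding \<tau>_def by (intro chol_Pair chol_const chol_fst chol_snd open_ball)
  have \<tau>b: "fst q \<in> ball 0 r1" "fst q \<in> ball 0 r2" "fst q \<in> ball 0 r3" "(1::complex, snd q) \<in> ball 0 4"
    if "q \<in> ball 0 r0" for q :: c3
  proof -
    have n: "norm (fst q) < r0" "norm (snd q) < r0" using that norm_fst_le'[of q] norm_snd_le'[of q] by auto
    then show "fst q \<in> ball 0 r1" "fst q \<in> ball 0 r2" "fst q \<in> ball 0 r3" by (auto simp: r0_def)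
    have "norm (1::complex, snd q) \<le> 1 + norm (snd q)" using norm_Pair_le[of "1::complex" "snd q"] by simp
    then show "(1::complex, snd q) \<in> ball 0 4" using n by (simp add: r0_def)
  qed
  have \<tau>r: "\<tau> ` ball 0 r0 \<subseteq> ball 0 r1 \<times> ball 0 4" "\<tau> ` ball 0 r0 \<subseteq> ball 0 r2 \<times> ball 0 4"
      "\<tau> ` ball 0 r0 \<subseteq> ball 0 r3 \<times> ball 0 4"
    using \<tau>b unfolding \<tau>_def by (auto simp del: mem_ball)
  have k: "chol (\<lambda>q. k1 (\<tau> q)) (ball 0 r0)" "chol (\<lambda>q. k2 (\<tau> q)) (ball 0 r0)" "chol (\<lambda>q. k3 (\<tau> q)) (ball 0 r0)"
    by (rule chol_compose[OF 1(2) \<tau>hol \<tau>r(1)] chol_compose[OF 2(2) \<tau>hol \<tau>r(2)] chol_compose[OF 3(2) \<tau>hol \<tau>r(3)])+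
  define den where "den = (\<lambda>q::c3. \<i> * of_real w1 + fst q * k1 (\<tau> q))"
  have dhol: "chol den (ball 0 r0)"
    unfolding den_def by (intro chol_add chol_mult chol_const chol_fst k open_ball)
  have "open (ball 0 r0 \<inter> den -` (- {0}))"
    by (intro continuous_open_preimage chol_imp_continuous_on dhol open_ball open_Compl closed_singleton)
  moreover have "0 \<in> ball 0 r0 \<inter> den -` (- {0})" using r0 w by (simp add: den_def)
  ultimately obtain r where r: "r > 0" "ball 0 r \<subseteq> ball 0 r0 \<inter> den -` (- {0})"
    using openE by blast
  have den: "den q \<noteq> 0" if "q \<in> ball 0 r" for q using that r(2) by auto
  have sub: "q \<in> ball 0 r0" if "q \<in> ball 0 r" for q :: c3 using that r(2) by blast
  define m where "m = complex_of_real (w2 / w1)"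
  have mw: "\<i> * of_real w2 = m * (\<i> * of_real w1)" using w by (simp add: m_def)
  define H where "H = (\<lambda>q::c3. ((k2 (\<tau> q) - m * fst (snd q) * k1 (\<tau> q)) / den q,
      (k3 (\<tau> q) - m * snd (snd q) * k1 (\<tau> q)) / den q))"
  have khol: "chol (\<lambda>q. k1 (\<tau> q)) (ball 0 r)" "chol (\<lambda>q. k2 (\<tau> q)) (ball 0 r)"
      "chol (\<lambda>q. k3 (\<tau> q)) (ball 0 r)" "chol den (ball 0 r)"
    using r(2) by (auto intro: chol_subset[OF k(1)] chol_subset[OF k(2)] chol_subset[OF k(3)] chol_subset[OF dhol])
  have Hhol: "chol H (ball 0 r)"
    unfolding H_def
    by (intro chol_Pair chol_divide chol_diff chol_mult khol chol_const open_ball chol_fst_compose chol_snd_compose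
        chol_id) (use den in auto)
  have Xeq: "X (x, x * u, x * v) = (x * den (x, u, v), x * (\<i> * of_real w2 * u + x * k2 (\<tau> (x, u, v))),
      x * (\<i> * of_real w2 * v + x * k3 (\<tau> (x, u, v))))" if "(x, u, v) \<in> ball 0 r" for x u v
  proof -
    note b = \<tau>b[OF sub[OF that], simplified fst_conv snd_conv]
    have "f (x, x * u, x * v) = x * x * k1 (\<tau> (x, u, v))" "g (x, x * u, x * v) = x * x * k2 (\<tau> (x, u, v))"
      "h (x, x * u, x * v) = x * x * k3 (\<tau> (x, u, v))"
      using 1(3)[OF b(1,4)] 2(3)[OF b(2,4)] 3(3)[OF b(3,4)] by (simp_all add: \<tau>_def)
    then show ?thesis by (simp add: X_def sys_def den_def algebra_simps)
  qed
  have expr: "bb_x_expr X x u v = of_real (w2 / w1 - 1) *\<^sub>C (u, v) + x *\<^sub>C H (x, u, v)"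
    if x: "x \<noteq> 0" and q: "(x, u, v) \<in> ball 0 r" for x u v
  proof -
    have "(x * (\<i> * of_real w2 * a + x * l)) / (x * den (x, u, v)) - a
        = of_real (w2 / w1 - 1) * a + x * ((l - m * a * k1 (\<tau> (x, u, v))) / den (x, u, v))" for a l
    proof -
      \<comment> \<open>Writing \<open>i w1\<close> as \<open>den\<close> minus \<open>x\<close>
        times the value of \<open>k1\<close> makes the linear part a multiple of the denominator and
        leaves a remainder with a factor \<open>x\<close>.\<close>
      have e: "\<i> * of_real w2 * a + x * l = m * a * den (x, u, v) + x * (l - m * a * k1 (\<tau> (x, u, v)))"
        unfolding mw by (simp add: den_def algebra_simps)
      have "of_real (w2 / w1 - 1) = m - 1" by (simp add: m_def)
      then show ?thesis
        unfolding e using den[OF q] x by (simp add: add_divide_distrib left_diff_distrib del: of_real_diff of_real_divide)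
    qed
    then show ?thesis
      using Xeq[OF q] by (simp add: bb_x_expr_def H_def prod_eq_iff)
  qed
  have "bb_form (w2 / w1 - 1) H (bb_x X)"
    unfolding bb_form_def
  proof (intro exI[of _ r] conjI r(1) Hhol allI impI)
    fix x :: complex and p :: c2 assume q: "(x, p) \<in> ball 0 r"
    obtain u v where p: "p = (u, v)" by fastforce
    show "bb_x X (x, p) = of_real (w2 / w1 - 1) *\<^sub>C p + x *\<^sub>C H (x, p)"
    proof (cases "x = 0")
      case False
      then show ?thesis using expr[of x u v] q by (simp add: bb_x_def p)
    next
      case True
      define A where "A = (\<lambda>t. (t, u, v)) -` ball (0::c3) r"
      have A: "open A" unfolding A_def
        by (intro open_vimage open_ball continuous_intros)
      have "0 \<in> A" using q True by (simp add: A_def p)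
      have "chol (\<lambda>t. of_real (w2 / w1 - 1) *\<^sub>C (u, v) + t *\<^sub>C H (t, u, v)) A"
        by (intro chol_add chol_const chol_cscale chol_id A chol_compose[OF Hhol] chol_Pair)
           (auto simp: A_def)
      then have "continuous_on A (\<lambda>t. of_real (w2 / w1 - 1) *\<^sub>C (u, v) + t *\<^sub>C H (t, u, v))"
        by (rule chol_imp_continuous_on)
      then have "isCont (\<lambda>t. of_real (w2 / w1 - 1) *\<^sub>C (u, v) + t *\<^sub>C H (t, u, v)) 0"
        using A \<open>0 \<in> A\<close> continuous_on_eq_continuous_at by blast
      then have "((\<lambda>t. of_real (w2 / w1 - 1) *\<^sub>C (u, v) + t *\<^sub>C H (t, u, v))
          \<longlongrightarrow> of_real (w2 / w1 - 1) *\<^sub>C (u, v) + 0 *\<^sub>C H (0, u, v)) (at 0)"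
        unfolding isCont_def .
      then have "((\<lambda>t. bb_x_expr X t u v) \<longlongrightarrow> of_real (w2 / w1 - 1) *\<^sub>C (u, v) + 0 *\<^sub>C H (0, u, v)) (at 0)"
      proof (rule Lim_transform_eventually)
        have "\<forall>\<^sub>F t in at 0. t \<in> A" using A \<open>0 \<in> A\<close> by (rule eventually_at_in_open')
        moreover have "\<forall>\<^sub>F t in at 0. t \<noteq> (0::complex)" by (simp add: eventually_at_filter)
        ultimately show "\<forall>\<^sub>F t in at 0. of_real (w2 / w1 - 1) *\<^sub>C (u, v) + t *\<^sub>C H (t, u, v) = bb_x_expr X t u v"
          by eventually_elim (simp add: expr A_def)
      qed
      then have "Lim (at 0) (\<lambda>t. bb_x_expr X t u v) = of_real (w2 / w1 - 1) *\<^sub>C (u, v) + 0 *\<^sub>C H (0, u, v)"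
        by (intro tendsto_Lim) auto
      then show ?thesis using True by (simp add: bb_x_def p)
    qed
  qed
  moreover have "fst (X (x, x * u, x * v)) \<noteq> 0" if "x \<noteq> 0" "(x, u, v) \<in> ball 0 r" for x u v
    using Xeq[OF that(2)] den[OF that(2)] that(1) by simp
  ultimately show ?thesis unfolding X_def using r(1) by blast
qed

section \<open>Invariant curves\<close>

lemma sys_zero: "hol_order2 f \<Longrightarrow> hol_order2 g \<Longrightarrow> hol_order2 h \<Longrightarrow> sys w1 w2 f g h (0, 0, 0) = (0, 0, 0)"
  by (simp add: sys_def hol_order2_def zero_prod_def)

lemma isCont_ball_subset:
  fixes f :: "complex \<Rightarrow> 'a::metric_space"
  assumes "isCont f 0" "open S" "f 0 \<in> S"
  shows "\<exists>d>0. \<forall>x\<in>ball 0 d. f x \<in> S"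
proof -
  obtain e where e: "e > 0" "ball (f 0) e \<subseteq> S" using assms openE by blast
  then obtain d where "d > 0" "\<And>x. dist x 0 < d \<Longrightarrow> dist (f x) (f 0) < e"
    using assms(1) unfolding continuous_at_eps_delta by meson
  then show ?thesis using e by (intro exI[of _ d]) (auto simp: dist_commute subset_eq)
qed

text \<open>Undoing the blow-up: \<open>w 0 = 0\<close> makes the curve tangent to the x-axis, and
  multiplying the system by the first component of the field gives invariance.\<close>

lemma x_center_manifold_of_bb_sol:
  assumes fgh: "hol_order2 f" "hol_order2 g" "hol_order2 h" and w1: "w1 \<noteq> 0"
    and w: "bb_sol (bb_x (sys w1 w2 f g h)) w"
  shows "x_center_manifold (sys w1 w2 f g h) (\<lambda>x. x * fst (w x)) (\<lambda>x. x * snd (w x))"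
proof -
  define X where "X = sys w1 w2 f g h"
  obtain r where r: "r > 0" "(\<lambda>x. fst (w x)) holomorphic_on ball 0 r" "(\<lambda>x. snd (w x)) holomorphic_on ball 0 r"
      "w 0 = 0" "\<And>x. x \<in> ball 0 r \<Longrightarrow>
        (x * deriv (\<lambda>x. fst (w x)) x, x * deriv (\<lambda>x. snd (w x)) x) = bb_x X (x, w x)"
    using w unfolding bb_sol_def X_def by blast
  obtain rn where rn: "rn > 0" "\<And>x u v. x \<noteq> 0 \<Longrightarrow> (x, u, v) \<in> ball 0 rn \<Longrightarrow> fst (X (x, x * u, x * v)) \<noteq> 0"
    using bb_x_form[OF fgh w1, of w2] unfolding X_def by blast
  have "isCont (\<lambda>x. (x, w x)) 0" using bb_sol_isCont[OF w] by (intro continuous_intros)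
  then obtain d where d: "d > 0" "\<And>x. x \<in> ball 0 d \<Longrightarrow> (x, w x) \<in> ball 0 rn"
    using isCont_ball_subset[of "\<lambda>x. (x, w x)" "ball 0 rn"] rn(1) r(4) by (auto simp: zero_prod_def[symmetric])
  define r' where "r' = min r d"
  have r': "r' > 0" using r d by (simp add: r'_def)
  have h: "(\<lambda>x. fst (w x)) holomorphic_on ball 0 r'" "(\<lambda>x. snd (w x)) holomorphic_on ball 0 r'"
    by (auto simp: r'_def subset_ball intro: holomorphic_on_subset[OF r(2)] holomorphic_on_subset[OF r(3)])
  have dv: "deriv (\<lambda>x. x * fst (w x)) x = fst (w x) + x * deriv (\<lambda>x. fst (w x)) x"
      "deriv (\<lambda>x. x * snd (w x)) x = snd (w x) + x * deriv (\<lambda>x. snd (w x)) x" if "x \<in> ball 0 r'" for x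
    using deriv_ident_mult[OF h(1) that, of 0] deriv_ident_mult[OF h(2) that, of 0] by simp_all
  have inv: "deriv (\<lambda>x. x * fst (w x)) x * fst (X (x, x * fst (w x), x * snd (w x))) = fst (snd (X (x, x * fst (w x), x * snd (w x)))) \<and>
      deriv (\<lambda>x. x * snd (w x)) x * fst (X (x, x * fst (w x), x * snd (w x))) = snd (snd (X (x, x * fst (w x), x * snd (w x))))"
    if x: "x \<in> ball 0 r'" for x
  proof (cases "x = 0")
    case True
    then show ?thesis using sys_zero[OF fgh, of w1 w2] by (simp add: X_def)
  next
    case False
    have "(x, fst (w x), snd (w x)) \<in> ball 0 rn" using d(2)[of x] x by (simp add: r'_def)
    then have ne: "fst (X (x, x * fst (w x), x * snd (w x))) \<noteq> 0" by (rule rn(2)[OF False])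
    have "(x * deriv (\<lambda>x. fst (w x)) x, x * deriv (\<lambda>x. snd (w x)) x) = bb_x_expr X x (fst (w x)) (snd (w x))"
      using r(5)[of x] x False by (simp add: r'_def bb_x_def case_prod_beta)
    then show ?thesis using ne by (simp add: dv[OF x] bb_x_expr_def)
  qed
  have hol: "(\<lambda>x. x * fst (w x)) holomorphic_on ball 0 r'" "(\<lambda>x. x * snd (w x)) holomorphic_on ball 0 r'"
    using h by (auto intro!: holomorphic_intros)
  show ?thesis
    unfolding x_center_manifold_def X_def[symmetric]
    by (intro exI[of _ r'] conjI r' hol ballI) (use inv dv[of 0] r' r(4) in auto)
qed

text \<open>The blow-up of the curve: tangency to the x-axis makes the quotients by \<open>x\<close>
  extend with value 0, as a solution must. Dividing the invariance equation needs the first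
  component of the field to be nonzero off \<open>x = 0\<close>.\<close>

lemma bb_sol_of_x_center_manifold:
  assumes fgh: "hol_order2 f" "hol_order2 g" "hol_order2 h" and w1: "w1 \<noteq> 0"
    and cm: "x_center_manifold (sys w1 w2 f g h) \<phi> \<psi>"
  shows "\<exists>w. bb_sol (bb_x (sys w1 w2 f g h)) w"
proof -
  define X where "X = sys w1 w2 f g h"
  obtain r where r: "r > 0" "\<phi> holomorphic_on ball 0 r" "\<psi> holomorphic_on ball 0 r"
     "\<phi> 0 = 0" "\<psi> 0 = 0" "deriv \<phi> 0 = 0" "deriv \<psi> 0 = 0"
     "\<And>x. x \<in> ball 0 r \<Longrightarrow> deriv \<phi> x * fst (X (x, \<phi> x, \<psi> x)) = fst (snd (X (x, \<phi> x, \<psi> x)))"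
     "\<And>x. x \<in> ball 0 r \<Longrightarrow> deriv \<psi> x * fst (X (x, \<phi> x, \<psi> x)) = snd (snd (X (x, \<phi> x, \<psi> x)))"
    using cm unfolding x_center_manifold_def X_def by blast
  obtain H where H: "bb_form (w2 / w1 - 1) H (bb_x X)" and
    "\<exists>r>0. \<forall>x u v. x \<noteq> 0 \<longrightarrow> (x, u, v) \<in> ball 0 r \<longrightarrow> fst (X (x, x * u, x * v)) \<noteq> 0"
    using bb_x_form[OF fgh w1, of w2] unfolding X_def by blast
  then obtain rn where rn: "rn > 0" "\<And>x u v. x \<noteq> 0 \<Longrightarrow> (x, u, v) \<in> ball 0 rn \<Longrightarrow> fst (X (x, x * u, x * v)) \<noteq> 0"
    by blast
  define p where "p = (\<lambda>x. if x = 0 then deriv \<phi> 0 else \<phi> x / x)"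
  define q where "q = (\<lambda>x. if x = 0 then deriv \<psi> 0 else \<psi> x / x)"
  have hp: "p holomorphic_on ball 0 r" and hq: "q holomorphic_on ball 0 r"
    unfolding p_def q_def using r by (intro holomorphic_quotient_at_zero; simp)+
  have pq: "\<phi> = (\<lambda>x. x * p x)" "\<psi> = (\<lambda>x. x * q x)" using r by (auto simp: p_def q_def)
  have p0: "p 0 = 0" "q 0 = 0" using r by (auto simp: p_def q_def)
  have "continuous_on (ball 0 r) (\<lambda>x. (x, p x, q x))"
    using hp hq by (intro continuous_intros holomorphic_on_imp_continuous_on)
  then have "isCont (\<lambda>x. (x, p x, q x)) 0" using r(1) by (simp add: continuous_on_eq_continuous_at)
  then obtain d where d: "d > 0" "\<And>x. x \<in> ball 0 d \<Longrightarrow> (x, p x, q x) \<in> ball 0 rn"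
    using isCont_ball_subset[of "\<lambda>x. (x, p x, q x)" "ball 0 rn"] rn(1) p0 by (auto simp: zero_prod_def[symmetric])
  define r' where "r' = min r d"
  have r': "r' > 0" using r d by (simp add: r'_def)
  have h: "p holomorphic_on ball 0 r'" "q holomorphic_on ball 0 r'"
    by (auto simp: r'_def subset_ball intro: holomorphic_on_subset[OF hp] holomorphic_on_subset[OF hq])
  have dv: "deriv \<phi> x = p x + x * deriv p x" "deriv \<psi> x = q x + x * deriv q x" if "x \<in> ball 0 r'" for x
    using deriv_ident_mult[OF h(1) that, of 0] deriv_ident_mult[OF h(2) that, of 0] by (simp_all add: pq)
  have "(x * deriv p x, x * deriv q x) = bb_x X (x, p x, q x)" if x: "x \<in> ball 0 r'" for x
  proof (cases "x = 0")
    case True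
    then show ?thesis using bb_form_zero[OF H] by (simp add: p0 zero_prod_def)
  next
    case False
    have ne: "fst (X (x, x * p x, x * q x)) \<noteq> 0" using d(2)[of x] x by (intro rn(2)[OF False]) (simp add: r'_def)
    have "deriv \<phi> x = fst (snd (X (x, x * p x, x * q x))) / fst (X (x, x * p x, x * q x))"
      "deriv \<psi> x = snd (snd (X (x, x * p x, x * q x))) / fst (X (x, x * p x, x * q x))"
      using r(8)[of x] r(9)[of x] x ne by (simp_all add: r'_def pq field_simps)
    then show ?thesis using False dv[OF x] by (simp add: bb_x_def bb_x_expr_def algebra_simps)
  qed
  then have "bb_sol (bb_x X) (\<lambda>x. (p x, q x))"
    unfolding bb_sol_def using r' h p0 by (intro exI[of _ r']) (auto simp: zero_prod_def)
  then show ?thesis unfolding X_def by blast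
qed

text \<open>On the curve the flow is one-dimensional, and \<open>\<sigma>(x) = x exp (\<integral>(i w\<^sub>1/P - 1/x) dx)\<close>, with \<open>P\<close> the
  first component of the field along the curve, satisfies \<open>P \<sigma>' = i w\<^sub>1 \<sigma>\<close>.\<close>

lemma x_center_manifold_isochronous:
  assumes fgh: "hol_order2 f" "hol_order2 g" "hol_order2 h" and w1: "w1 \<noteq> 0"
    and cm: "x_center_manifold (sys w1 w2 f g h) \<phi> \<psi>"
  shows "x_isochronous (sys w1 w2 f g h) \<phi> \<psi> (2 * pi / \<bar>w1\<bar>)"
proof -
  define X where "X = sys w1 w2 f g h"
  obtain r where r: "r > 0" "\<phi> holomorphic_on ball 0 r" "\<psi> holomorphic_on ball 0 r"
     "\<phi> 0 = 0" "\<psi> 0 = 0" "deriv \<phi> 0 = 0" "deriv \<psi> 0 = 0"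
     "\<And>x. x \<in> ball 0 r \<Longrightarrow> deriv \<phi> x * fst (X (x, \<phi> x, \<psi> x)) = fst (snd (X (x, \<phi> x, \<psi> x)))"
     "\<And>x. x \<in> ball 0 r \<Longrightarrow> deriv \<psi> x * fst (X (x, \<phi> x, \<psi> x)) = snd (snd (X (x, \<phi> x, \<psi> x)))"
    using cm unfolding x_center_manifold_def X_def by blast
  obtain r1 k1 where 1: "r1 > 0" "chol k1 (ball 0 r1 \<times> ball 0 4)"
    "\<And>s p. s \<in> ball 0 r1 \<Longrightarrow> p \<in> ball 0 4 \<Longrightarrow> f (s *\<^sub>C p) = s * s * k1 (s, p)"
    using hol_order2_blowup[OF fgh(1)] by blast
  obtain R L where R: "R > 0" "L-lipschitz_on (ball 0 R) X"
    using sys_lipschitz[OF fgh] unfolding X_def by blast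
  define p where "p = (\<lambda>x. if x = 0 then deriv \<phi> 0 else \<phi> x / x)"
  define q where "q = (\<lambda>x. if x = 0 then deriv \<psi> 0 else \<psi> x / x)"
  have hp: "p holomorphic_on ball 0 r" and hq: "q holomorphic_on ball 0 r"
    unfolding p_def q_def using r by (intro holomorphic_quotient_at_zero; simp)+
  have pq: "\<phi> x = x * p x" "\<psi> x = x * q x" for x using r by (auto simp: p_def q_def)
  have p0: "p 0 = 0" "q 0 = 0" using r by (auto simp: p_def q_def)
  have cpq: "isCont p 0" "isCont q 0" "isCont \<phi> 0" "isCont \<psi> 0"
    using holomorphic_on_imp_continuous_on[OF hp] holomorphic_on_imp_continuous_on[OF hq]
      holomorphic_on_imp_continuous_on[OF r(2)] holomorphic_on_imp_continuous_on[OF r(3)] r(1)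
    by (auto simp: continuous_on_eq_continuous_at)
  have "isCont (\<lambda>x. (1::complex, p x, q x)) 0" using cpq by (intro continuous_intros)
  moreover have "(1::complex, p 0, q 0) \<in> ball 0 4" using norm_triple_le[of "1::complex" "0::complex" "0::complex"] by (simp add: p0)
  ultimately obtain d1 where d1: "d1 > 0" "\<And>x. x \<in> ball 0 d1 \<Longrightarrow> (1::complex, p x, q x) \<in> ball 0 4"
    using isCont_ball_subset[of "\<lambda>x. (1::complex, p x, q x)" "ball 0 4"] by auto
  define r2 where "r2 = min r (min r1 d1)"
  have r2: "r2 > 0" using r 1 d1 by (simp add: r2_def)
  define F where "F = (\<lambda>x. k1 (x, (1, p x, q x)))"
  have sub2: "ball 0 r2 \<subseteq> ball (0::complex) r" "ball 0 r2 \<subseteq> ball (0::complex) r1" "ball 0 r2 \<subseteq> ball (0::complex) d1"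
    by (auto simp: r2_def)
  have "chol F (ball 0 r2)"
    unfolding F_def
  proof (rule chol_compose[OF 1(2)])
    have "chol p (ball 0 r2)" "chol q (ball 0 r2)"
      using hp hq sub2(1) holomorphic_on_subset by (auto simp: chol_iff_holomorphic)
    then show "chol (\<lambda>x. (x, 1::complex, p x, q x)) (ball 0 r2)"
      by (intro chol_Pair chol_id chol_const open_ball)
    show "(\<lambda>x. (x, 1::complex, p x, q x)) ` ball 0 r2 \<subseteq> ball 0 r1 \<times> ball 0 4"
      using d1(2) sub2 by blast
  qed
  then have F: "F holomorphic_on ball 0 r2" by (simp add: chol_iff_holomorphic)
  define den where "den = (\<lambda>x. \<i> * of_real w1 + x * F x)"
  have dhol: "den holomorphic_on ball 0 r2" unfolding den_def by (intro holomorphic_intros F)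
  have P: "fst (X (x, \<phi> x, \<psi> x)) = x * den x" if x: "x \<in> ball 0 r2" for x
  proof -
    have "x \<in> ball 0 r1" "(1::complex, p x, q x) \<in> ball 0 4" using x sub2 d1(2) by blast+
    from 1(3)[OF this] have "f (x, \<phi> x, \<psi> x) = x * x * F x" by (simp add: F_def pq)
    then show ?thesis by (simp add: X_def sys_def den_def algebra_simps)
  qed
  have "isCont den 0"
    using holomorphic_on_imp_continuous_on[OF dhol] r2 by (simp add: continuous_on_eq_continuous_at)
  moreover have "den 0 \<in> - {0}" using w1 by (simp add: den_def)
  ultimately obtain d2 where d2: "d2 > 0" "\<And>x. x \<in> ball 0 d2 \<Longrightarrow> den x \<in> - {0}"
    using isCont_ball_subset[OF _ open_Compl[OF closed_singleton]] by metis
  have "isCont (\<lambda>x. (x, \<phi> x, \<psi> x)) 0" using cpq by (intro continuous_intros)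
  moreover have "(0::complex, \<phi> 0, \<psi> 0) \<in> ball 0 R" using R(1) r by (simp add: zero_prod_def[symmetric])
  ultimately obtain d3 where d3: "d3 > 0" "\<And>x. x \<in> ball 0 d3 \<Longrightarrow> (x, \<phi> x, \<psi> x) \<in> ball 0 R"
    using isCont_ball_subset[of "\<lambda>x. (x, \<phi> x, \<psi> x)" "ball 0 R"] by auto
  define r3 where "r3 = min r2 (min d2 d3)"
  have r3: "r3 > 0" using r2 d2 d3 by (simp add: r3_def)
  have sub3: "ball 0 r3 \<subseteq> ball (0::complex) r2" "ball 0 r3 \<subseteq> ball (0::complex) d2" "ball 0 r3 \<subseteq> ball (0::complex) d3"
    by (auto simp: r3_def)
  have dne: "den x \<noteq> 0" if "x \<in> ball 0 r3" for x using d2(2)[of x] that sub3 by auto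
  \<comment> \<open>With \<open>P = x * den\<close>, this function equals
    \<open>i w1 / P - 1 / x\<close>; the poles at 0 have cancelled.\<close>
  have "(\<lambda>x. - F x / den x) holomorphic_on ball 0 r3"
    using dne by (intro holomorphic_intros holomorphic_on_subset[OF F sub3(1)] holomorphic_on_subset[OF dhol sub3(1)])
  then obtain \<eta> where "\<And>x. x \<in> ball 0 r3 \<Longrightarrow> (\<eta> has_field_derivative - F x / den x) (at x within ball 0 r3)"
    using holomorphic_convex_primitive'[OF convex_ball open_ball] by blast
  then have \<eta>: "(\<eta> has_field_derivative - F x / den x) (at x)" if "x \<in> ball 0 r3" for x
    using that at_within_open[OF that open_ball] by metis
  define \<sigma> where "\<sigma> = (\<lambda>x. x * exp (\<eta> x))"
  have d\<sigma>: "(\<sigma> has_field_derivative exp (\<eta> x) * (\<i> * of_real w1 / den x)) (at x)" if x: "x \<in> ball 0 r3" for x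
  proof -
    have "(\<sigma> has_field_derivative exp (\<eta> x) + x * (exp (\<eta> x) * (- F x / den x))) (at x)"
      unfolding \<sigma>_def by (auto intro!: derivative_eq_intros \<eta> x)
    moreover have "exp (\<eta> x) + x * (exp (\<eta> x) * (- F x / den x)) = exp (\<eta> x) * ((den x - x * F x) / den x)"
      using dne[OF x] by (simp add: field_simps)
    moreover have "den x - x * F x = \<i> * of_real w1" by (simp add: den_def)
    ultimately show ?thesis by simp
  qed
  have \<sigma>hol: "\<sigma> holomorphic_on ball 0 r3"
    unfolding holomorphic_on_open[OF open_ball] using d\<sigma> by blast
  \<comment> \<open>As \<open>den 0 = i w1\<close>, this derivative is
    \<open>exp (\<eta> 0)\<close>, so \<open>\<sigma>\<close> is a local coordinate.\<close>
  have dnz: "deriv \<sigma> 0 \<noteq> 0" using DERIV_imp_deriv[OF d\<sigma>[of 0]] r3 w1 by (simp add: den_def)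
  have "0 \<in> ball (0::complex) r3" using r3 by simp
  from has_complex_derivative_locally_injective[OF \<sigma>hol this open_ball dnz]
  obtain r4 where r4: "r4 > 0" "ball 0 r4 \<subseteq> ball (0::complex) r3" "inj_on \<sigma> (ball 0 r4)" .
  have \<sigma>4: "\<sigma> holomorphic_on ball 0 r4" using \<sigma>hol r4(2) by (rule holomorphic_on_subset)
  obtain \<kappa> where \<kappa>: "\<kappa> holomorphic_on \<sigma> ` ball 0 r4" "\<And>z. z \<in> ball 0 r4 \<Longrightarrow> deriv \<sigma> z * deriv \<kappa> (\<sigma> z) = 1"
      "\<And>z. z \<in> ball 0 r4 \<Longrightarrow> \<kappa> (\<sigma> z) = z"
    using holomorphic_has_inverse[OF \<sigma>4 open_ball r4(3)] by metis
  have op: "open (\<sigma> ` ball 0 r4)" by (rule open_mapping_thm3[OF \<sigma>4 open_ball r4(3)])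
  have "\<sigma> 0 = 0" by (simp add: \<sigma>_def)
  then have "0 \<in> \<sigma> ` ball 0 r4" using r4(1) by (intro image_eqI[of _ _ 0]) auto
  then obtain r5 where r5: "r5 > 0" "ball 0 r5 \<subseteq> \<sigma> ` ball 0 r4" using op openE by blast
  \<comment> \<open>The curve parametrised by the linearising coordinate
    \<open>s = \<sigma> x\<close>.\<close>
  define \<Phi> where "\<Phi> = (\<lambda>s. (\<kappa> s, \<phi> (\<kappa> s), \<psi> (\<kappa> s)))"
  have pre: "\<exists>x\<in>ball 0 r4. s = \<sigma> x \<and> \<kappa> s = x" if "s \<in> ball 0 r5" for s
    using that r5(2) \<kappa>(3) by blast
  have \<Phi>X: "\<exists>D. (\<Phi> has_derivative D) (at s) \<and> D ((\<i> * of_real w1) *\<^sub>C s) = X (\<Phi> s)" if s: "s \<in> ball 0 r5" for s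
  proof -
    obtain x where x: "x \<in> ball 0 r4" "s = \<sigma> x" "\<kappa> s = x" using pre[OF s] by blast
    have x3: "x \<in> ball 0 r3" and x2: "x \<in> ball 0 r2" and xr: "x \<in> ball 0 r"
      using x(1) r4(2) sub3 sub2 by blast+
    have "s \<in> \<sigma> ` ball 0 r4" using x by blast
    then have d\<kappa>: "(\<kappa> has_field_derivative deriv \<kappa> s) (at s)"
      using \<kappa>(1) op by (rule holomorphic_derivI[rotated 2])
    have d\<phi>: "(\<phi> has_field_derivative deriv \<phi> x) (at (\<kappa> s))" "(\<psi> has_field_derivative deriv \<psi> x) (at (\<kappa> s))"
      using holomorphic_derivI[OF r(2) open_ball xr] holomorphic_derivI[OF r(3) open_ball xr] x(3) by simp_all
    have "(\<Phi> has_derivative (\<lambda>h. (deriv \<kappa> s * h, deriv \<phi> x * deriv \<kappa> s * h, deriv \<psi> x * deriv \<kappa> s * h))) (at s)"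
      unfolding \<Phi>_def
      by (intro has_derivative_Pair)
         (use d\<kappa> DERIV_chain2[OF d\<phi>(1) d\<kappa>] DERIV_chain2[OF d\<phi>(2) d\<kappa>] in \<open>simp_all add: has_field_derivative_def\<close>)
    \<comment> \<open>This is \<open>P \<sigma>' = i w1 \<sigma>\<close> read through the inverse
      function. The other two components follow from it by the invariance of the graph.\<close>
    moreover have "deriv \<kappa> s * (\<i> * of_real w1 * s) = fst (X (x, \<phi> x, \<psi> x))"
    proof -
      have "exp (\<eta> x) * (\<i> * of_real w1 / den x) * deriv \<kappa> s = 1"
        using \<kappa>(2)[OF x(1)] DERIV_imp_deriv[OF d\<sigma>[OF x3]] x(2) by simp
      then have "exp (\<eta> x) * \<i> * of_real w1 * deriv \<kappa> s = den x"
        using dne[OF x3] by (simp add: field_simps)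
      then have "deriv \<kappa> s * (\<i> * of_real w1 * s) = x * den x"
        unfolding x(2) \<sigma>_def by (simp add: algebra_simps)
      then show ?thesis using P[OF x2] by simp
    qed
    ultimately show ?thesis
      using r(8)[OF xr] r(9)[OF xr] x(3)
      by (intro exI[of _ "\<lambda>h. (deriv \<kappa> s * h, deriv \<phi> x * deriv \<kappa> s * h, deriv \<psi> x * deriv \<kappa> s * h)"])
         (simp add: \<Phi>_def prod_eq_iff mult.assoc)
  qed
  have inj: "inj_on \<Phi> (ball 0 r5)"
  proof (rule inj_onI)
    fix s t assume st: "s \<in> ball 0 r5" "t \<in> ball 0 r5" "\<Phi> s = \<Phi> t"
    then have "\<kappa> s = \<kappa> t" by (simp add: \<Phi>_def)
    then show "s = t" using pre[OF st(1)] pre[OF st(2)] by metis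
  qed
  have im: "\<Phi> s \<in> ball 0 R" if s: "s \<in> ball 0 r5" for s
  proof -
    obtain x where x: "x \<in> ball 0 r4" "\<kappa> s = x" using pre[OF s] by blast
    have "x \<in> ball 0 d3" using x(1) r4(2) sub3 by blast
    then show ?thesis using d3(2)[of x] x(2) by (simp add: \<Phi>_def)
  qed
  have "isCont \<sigma> 0" using d\<sigma>[of 0] r3 DERIV_isCont by auto
  then obtain d4 where d4: "d4 > 0" "\<And>x. x \<in> ball 0 d4 \<Longrightarrow> \<sigma> x \<in> ball 0 r5"
    using isCont_ball_subset[of \<sigma> "ball 0 r5"] r5(1) \<open>\<sigma> 0 = 0\<close> by auto
  have "periodic_traj X (x, \<phi> x, \<psi> x) (2 * pi / \<bar>w1\<bar>)" if x: "x \<noteq> 0" "cmod x < min d4 r4" for x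
  proof -
    have "\<kappa> (\<sigma> x) = x" using x by (intro \<kappa>(3)) simp
    then have "\<Phi> (\<sigma> x) = (x, \<phi> x, \<psi> x)" by (simp add: \<Phi>_def)
    moreover have "periodic_traj X (\<Phi> (\<sigma> x)) (2 * pi / \<bar>w1\<bar>)"
      by (rule periodic_traj_of_linear_flow[where \<Phi> = \<Phi> and r = r5, OF \<Phi>X inj im R(2) w1])
         (use d4(2)[of x] x in \<open>auto simp: \<sigma>_def\<close>)
    ultimately show ?thesis by simp
  qed
  then show ?thesis
    unfolding x_isochronous_def X_def[symmetric] using d4(1) r4(1) by (intro exI[of _ "min d4 r4"]) auto
qed

theorem theorem3p7:
  fixes w1 w2 :: real and f g h :: "c3 \<Rightarrow> complex"
  assumes "w1 \<noteq> 0" and "w2 \<noteq> 0" and "w1 \<noteq> w2" and "\<bar>w1\<bar> \<le> \<bar>w2\<bar>"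
    and "hol_order2 f" and "hol_order2 g" and "hol_order2 h"
  shows
    "(\<exists>C. yz_center_manifold (sys w1 w2 f g h) C \<and>
          yz_isochronous (sys w1 w2 f g h) C (2 * pi / \<bar>w2\<bar>))
   \<and> ((\<not> (\<exists>k::nat. k > 0 \<and> w2 / w1 = real k)) \<longrightarrow>
       (\<exists>\<phi> \<psi>. x_center_manifold (sys w1 w2 f g h) \<phi> \<psi> \<and>
              x_isochronous (sys w1 w2 f g h) \<phi> \<psi> (2 * pi / \<bar>w1\<bar>)))
   \<and> (\<forall>k::nat. k > 0 \<and> w2 / w1 = real k \<longrightarrow>
       (bb_const ((reduction_step ^^ (k - 2)) (bb_x (sys w1 w2 f g h))) = (0, 0) \<longrightarrow>
          (\<exists>M :: nat \<Rightarrow> (complex \<Rightarrow> complex) \<times> (complex \<Rightarrow> complex).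
             (\<forall>n. x_center_manifold (sys w1 w2 f g h) (fst (M n)) (snd (M n)) \<and>
                  x_isochronous (sys w1 w2 f g h) (fst (M n)) (snd (M n)) (2 * pi / \<bar>w1\<bar>)) \<and>
             (\<forall>m n. m \<noteq> n \<longrightarrow> \<not> same_germ (M m) (M n))))
       \<and> (bb_const ((reduction_step ^^ (k - 2)) (bb_x (sys w1 w2 f g h))) \<noteq> (0, 0) \<longrightarrow>
          \<not> (\<exists>\<phi> \<psi>. x_center_manifold (sys w1 w2 f g h) \<phi> \<psi>)))"
proof (intro conjI impI allI; (elim conjE)?)
  note fgh = assms(5-7)
  define X where "X = sys w1 w2 f g h"
  note cmI = x_center_manifold_of_bb_sol[OF fgh assms(1), of w2, folded X_def]
    and iso = x_center_manifold_isochronous[OF fgh assms(1), of w2, folded X_def]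
  obtain H where H: "bb_form (w2 / w1 - 1) H (bb_x X)"
    using bb_x_form[OF fgh assms(1), of w2] unfolding X_def by blast
  show "\<exists>C. yz_center_manifold (sys w1 w2 f g h) C \<and> yz_isochronous (sys w1 w2 f g h) C (2 * pi / \<bar>w2\<bar>)"
    by (rule yz_isochronous_center_manifold[OF assms(2,4) fgh])
  show "\<exists>\<phi> \<psi>. x_center_manifold (sys w1 w2 f g h) \<phi> \<psi> \<and> x_isochronous (sys w1 w2 f g h) \<phi> \<psi> (2 * pi / \<bar>w1\<bar>)"
    if nr: "\<not> (\<exists>k::nat. k > 0 \<and> w2 / w1 = real k)"
  proof -
    have "w2 / w1 - 1 \<noteq> real k" if "k > 0" for k :: nat
    proof
      assume "w2 / w1 - 1 = real k"
      then have "w2 / w1 = real (Suc k)" by simp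
      with nr show False by blast
    qed
    then obtain w where "bb_sol (bb_x X) w" using bb_sol_exists[OF H] by blast
    with cmI iso show ?thesis unfolding X_def by blast
  qed
  fix k :: nat assume k: "k > 0" "w2 / w1 = real k"
  \<comment> \<open>Distinct frequencies exclude \<open>k = 1\<close>, so \<open>k - 2\<close> is a
    genuine difference, and the exponent \<open>k - 1\<close> reaches 1 after exactly that many
    reductions.\<close>
  have "k \<noteq> 1" using k assms(1,3) by auto
  then have "w2 / w1 - 1 = real (k - 2) + 1" using k by (simp add: of_nat_diff)
  then have dich: "(bb_const ((reduction_step ^^ (k - 2)) (bb_x X)) = 0 \<longrightarrow> inf_sols (bb_x X)) \<and>
    (bb_const ((reduction_step ^^ (k - 2)) (bb_x X)) \<noteq> 0 \<longrightarrow> \<not> (\<exists>w. bb_sol (bb_x X) w))"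
    using bb_resonance_dichotomy H by metis
  show "\<exists>M :: nat \<Rightarrow> (complex \<Rightarrow> complex) \<times> (complex \<Rightarrow> complex).
             (\<forall>n. x_center_manifold (sys w1 w2 f g h) (fst (M n)) (snd (M n)) \<and>
                  x_isochronous (sys w1 w2 f g h) (fst (M n)) (snd (M n)) (2 * pi / \<bar>w1\<bar>)) \<and>
             (\<forall>m n. m \<noteq> n \<longrightarrow> \<not> same_germ (M m) (M n))"
    if "bb_const ((reduction_step ^^ (k - 2)) (bb_x (sys w1 w2 f g h))) = (0, 0)"
  proof -
    have "inf_sols (bb_x X)" using dich that by (simp add: X_def zero_prod_def)
    then obtain S :: "nat \<Rightarrow> complex \<Rightarrow> c2" where S: "\<And>n. bb_sol (bb_x X) (S n)"
        "\<And>m n. m \<noteq> n \<Longrightarrow> \<not> (\<forall>\<^sub>F x in nhds 0. S m x = S n x)"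
      unfolding inf_sols_def by blast
    have S0: "S n 0 = 0" for n using S(1)[of n] unfolding bb_sol_def by blast
    define M where "M = (\<lambda>n. (\<lambda>x. x * fst (S n x), \<lambda>x. x * snd (S n x)))"
    have "\<not> same_germ (M m) (M n)" if "m \<noteq> n" for m n
    proof
      assume "same_germ (M m) (M n)"
      then have "\<forall>\<^sub>F x in nhds 0. x *\<^sub>C S m x = x *\<^sub>C S n x"
        unfolding same_germ_def by eventually_elim (simp add: M_def prod_eq_iff)
      then have "\<forall>\<^sub>F x in at 0. S m x = S n x" by (rule eventually_at_cscale_cancel)
      then have "\<forall>\<^sub>F x in nhds 0. S m x = S n x"
        unfolding eventually_at_filter by eventually_elim (metis S0 UNIV_I)
      with S(2)[OF that] show False by blast
    qed
    moreover have "x_center_manifold X (fst (M n)) (snd (M n))" for n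
      unfolding M_def fst_conv snd_conv by (rule cmI[OF S(1)])
    ultimately show ?thesis using iso unfolding X_def by blast
  qed
  show "\<not> (\<exists>\<phi> \<psi>. x_center_manifold (sys w1 w2 f g h) \<phi> \<psi>)"
    if "bb_const ((reduction_step ^^ (k - 2)) (bb_x (sys w1 w2 f g h))) \<noteq> (0, 0)"
    using dich that bb_sol_of_x_center_manifold[OF fgh assms(1), of w2] by (auto simp: X_def zero_prod_def)
qed

end
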